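(* Assume that $\log p/n=o(1)$ as $n\to\infty$, that there is a constant $\sigma>3\eta>0$ with $\phi_{\max}\ge \phi_j+\sigma$ for all $j\ge 2$, and that $\{\bm X_t\}_{t\in\mathbb Z}$ is a zero-mean, $\alpha$-mixing, stationary Gaussian process. There is a constant $c>0$ such that, for every $b>0$, setting \[ \tilde\zeta_n:=\sqrt{\frac{(b+4\tilde s)\log p}{cn}},\qquad \tilde\gamma_n:=\phi_{\max}\Bigl(\tilde\zeta_n\sum_{l=0}^n\rho(l)\Bigr), \] for every $p>6$ and every $n$ such that $\tilde\zeta_n^2<\tilde\zeta_n$, \[ P\bigl(\|\hat{\bm\beta}_n^0-\bm\beta^0\|_2\le\delta_n\bigr)\ge1-\exp(-b\log p), \] where \[ \delta_n:=\frac{\tilde\gamma_n\phi_{\max}+\sqrt{\tilde\gamma_n^2\phi_{\max}^2+4(\sigma-3\eta-\tilde\gamma_n)\tilde s\lambda_0}}{2(\sigma-3\eta-\tilde\gamma_n)}. \]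
   Context: $\{\bm X_t\}_{t\in\mathbb Z}$ is an $\mathbb R^p$-valued, strictly stationary, centered time series, with $p=p(n)$ allowed to depend on the sample size $n$; $\bm X_1,\dots,\bm X_n$ are observed. Put $\Sigma_0=E[\bm X_t\bm X_t^\top]$ and $\hat\Sigma_n=\frac1n\sum_{t=1}^n\bm X_t\bm X_t^\top$. The eigenvalues of $\Sigma_0$ are written $\phi_1^2\ge\dots\ge\phi_p^2$ with $\phi_1\ge\dots\ge\phi_p\ge0$, and $\phi_{\max}:=\phi_1$ (so $\phi_{\max}^2$ is the largest eigenvalue of $\Sigma_0$). Let $\bm q^0$ be a unit ($l_2$) eigenvector of $\Sigma_0$ for $\phi_{\max}^2$ and $\bm\beta^0:=\phi_{\max}\bm q^0$. Let $S=\{j:\bm\beta^0_j\ne0\}$ and $s_0=|S|$. For a constant $\eta>0$ let $\mathcal B=\{\bm\beta\in\mathbb R^p:\|\bm\beta-\bm\beta^0\|_2\le\eta\}$. Let $R_n(\bm\beta):=-\frac12\bm\beta^\top\hat\Sigma_n\bm\beta+\frac14\|\bm\beta\|_2^4$ and $\|\bm\beta\|_0$ the number of nonzero entries of $\bm\beta$. For a tuning parameter $\lambda_0\ge0$, the $l_0$-penalized estimator is \[ \hat{\bm\beta}_n^0:=\arg\min_{\bm\beta\in\mathcal B}\{R_n(\bm\beta)+\lambda_0\|\bm\beta\|_0\} \] (equivalently, the minimizer over $\mathcal B$ of $\frac14\|\hat\Sigma_n-\bm\beta\bm\beta^\top\|_F^2+\lambda_0\|\bm\beta\|_0$). The constant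 $s\ge0$ is a nonnegative constant such that $\hat{\bm\beta}_n^0=\arg\min_{\bm\beta\in\mathcal B\cap\mathcal B_0(s)}R_n(\bm\beta)$, where $\mathcal B_0(s):=\{\bm\beta\in\mathbb R^p:\|\bm\beta\|_0\le s\}$; and $\tilde s:=\max\{s_0,s\}$. Mixing: $\alpha(l):=\sup\{|P(A\cap B)-P(A)P(B)|: A\in\sigma(\bm X_s,s\le t),\,B\in\sigma(\bm X_s,s\ge t+l),\ t\in\mathbb Z\}$, and the process is $\alpha$-mixing if $\alpha(l)\to0$ as $l\to\infty$. The $\rho$-mixing coefficients are $\rho(l):=\sup\{\mathrm{Cov}(f(\bm X_t),g(\bm X_{t+l})):E[f]=E[g]=0,\ E[f^2]=E[g^2]=1\}$.
   Formalization: The condition σ−3η−γ̃_n>0 is added for the n and b considered; without it δ_n is negative, not real or undefined, and the claimed probability bound fails (e.g. i.i.d. Gaussian data with λ_0=0). *)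

theory Defs
  imports "HOL-Probability.Probability" "Jordan_Normal_Form.Char_Poly"
begin

text \<open>
  The dimension $p = p(n)$ of the time series changes with the sample size, so vectors and matrices
  are those of \<^theory>\<open>Jordan_Normal_Form.Matrix\<close>, whose dimension is a value and not a type.
  A process is a map from time and outcome to a vector. The vector type carries no
  $\sigma$-algebra, so measurability and joint laws are expressed through the coordinates.
\<close>

type_synonym 'a process = "int \<Rightarrow> 'a \<Rightarrow> real vec"

definition l2_norm_vec :: "real vec \<Rightarrow> real" where
  "l2_norm_vec v = sqrt (scalar_prod v v)"

definition l0_norm_vec :: "real vec \<Rightarrow> nat" where
  "l0_norm_vec v = card {j. j < dim_vec v \<and> vec_index v j \<noteq> 0}"

definition random_vec :: "'a measure \<Rightarrow> nat \<Rightarrow> ('a \<Rightarrow> real vec) \<Rightarrow> bool" where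
  "random_vec M d Y \<longleftrightarrow>
     (\<forall>\<omega>\<in>space M. Y \<omega> \<in> carrier_vec d) \<and>
     (\<forall>j<d. (\<lambda>\<omega>. vec_index (Y \<omega>) j) \<in> borel_measurable M)"

text \<open>Strict stationarity: all finite-dimensional distributions are invariant under time shifts.\<close>

definition joint_law :: "'a measure \<Rightarrow> nat \<Rightarrow> 'a process \<Rightarrow> int set \<Rightarrow> int \<Rightarrow> (int \<times> nat \<Rightarrow> real) measure" where
  "joint_law M d X T h =
     distr M (Pi\<^sub>M (T \<times> {..<d}) (\<lambda>_. borel))
       (\<lambda>\<omega>. \<lambda>(t, j) \<in> T \<times> {..<d}. vec_index (X (t + h) \<omega>) j)"

definition strictly_stationary :: "'a measure \<Rightarrow> nat \<Rightarrow> 'a process \<Rightarrow> bool" where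
  "strictly_stationary M d X \<longleftrightarrow>
     (\<forall>T h. finite T \<longrightarrow> joint_law M d X T h = joint_law M d X T 0)"

definition zero_mean :: "'a measure \<Rightarrow> nat \<Rightarrow> 'a process \<Rightarrow> bool" where
  "zero_mean M d X \<longleftrightarrow>
     (\<forall>t. \<forall>j<d. integrable M (\<lambda>\<omega>. vec_index (X t \<omega>) j) \<and>
                 integral\<^sup>L M (\<lambda>\<omega>. vec_index (X t \<omega>) j) = 0)"

text \<open>
  Degenerate (almost surely constant) normal variables are allowed; \<^const>\<open>normal_density\<close> only
  covers positive variance.
\<close>

definition gaussian_variable :: "'a measure \<Rightarrow> ('a \<Rightarrow> real) \<Rightarrow> bool" where
  "gaussian_variable M Y \<longleftrightarrow>
     Y \<in> borel_measurable M \<and>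
     ((\<exists>\<mu>. AE \<omega> in M. Y \<omega> = \<mu>) \<or>
      (\<exists>\<mu> \<tau>. \<tau> > 0 \<and> distributed M lborel Y (normal_density \<mu> \<tau>)))"

definition gaussian_process :: "'a measure \<Rightarrow> nat \<Rightarrow> 'a process \<Rightarrow> bool" where
  "gaussian_process M d X \<longleftrightarrow>
     (\<forall>T a. finite T \<longrightarrow>
        gaussian_variable M (\<lambda>\<omega>. \<Sum>t\<in>T. \<Sum>j<d. a t j * vec_index (X t \<omega>) j))"

definition sigma_process :: "'a measure \<Rightarrow> nat \<Rightarrow> 'a process \<Rightarrow> int set \<Rightarrow> 'a set set" where
  "sigma_process M d X T =
     sigma_sets (space M)
       {(\<lambda>\<omega>. vec_index (X t \<omega>) j) -` B \<inter> space M | t j B. t \<in> T \<and> j < d \<and> B \<in> sets borel}"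

definition alpha_coeff :: "'a measure \<Rightarrow> nat \<Rightarrow> 'a process \<Rightarrow> nat \<Rightarrow> real" where
  "alpha_coeff M d X l =
     Sup {\<bar>measure M (A \<inter> B) - measure M A * measure M B\<bar> | A B t.
            A \<in> sigma_process M d X {..t} \<and> B \<in> sigma_process M d X {t + int l..}}"

definition alpha_mixing :: "'a measure \<Rightarrow> nat \<Rightarrow> 'a process \<Rightarrow> bool" where
  "alpha_mixing M d X \<longleftrightarrow> alpha_coeff M d X \<longlonglongrightarrow> 0"

text \<open>
  The test functions are Borel functions of the coordinates. \<^const>\<open>lebesgue_integral\<close> is 0 for
  non-integrable functions, so a second moment equal to 1 includes square integrability, and then
  all integrals below are genuine. For mean-zero variables the covariance is the mean of the product.
\<close>

definition coords :: "nat \<Rightarrow> real vec \<Rightarrow> nat \<Rightarrow> real" where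
  "coords d v = (\<lambda>j\<in>{..<d}. vec_index v j)"

definition rho_coeff :: "'a measure \<Rightarrow> nat \<Rightarrow> 'a process \<Rightarrow> nat \<Rightarrow> real" where
  "rho_coeff M d X l =
     Sup {integral\<^sup>L M (\<lambda>\<omega>. f (coords d (X t \<omega>)) * g (coords d (X (t + int l) \<omega>))) | f g t.
            f \<in> borel_measurable (Pi\<^sub>M {..<d} (\<lambda>_. borel)) \<and>
            g \<in> borel_measurable (Pi\<^sub>M {..<d} (\<lambda>_. borel)) \<and>
            integral\<^sup>L M (\<lambda>\<omega>. f (coords d (X t \<omega>))) = 0 \<and>
            integral\<^sup>L M (\<lambda>\<omega>. g (coords d (X (t + int l) \<omega>))) = 0 \<and>
            integral\<^sup>L M (\<lambda>\<omega>. (f (coords d (X t \<omega>)))\<^sup>2) = 1 \<and>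
            integral\<^sup>L M (\<lambda>\<omega>. (g (coords d (X (t + int l) \<omega>)))\<^sup>2) = 1}"

text \<open>By stationarity $E[X_t X_t^\top]$ does not depend on $t$; it is taken at $t = 0$.\<close>

definition cov_mat :: "'a measure \<Rightarrow> nat \<Rightarrow> 'a process \<Rightarrow> real mat" where
  "cov_mat M d X =
     mat d d (\<lambda>(i, j). integral\<^sup>L M (\<lambda>\<omega>. vec_index (X 0 \<omega>) i * vec_index (X 0 \<omega>) j))"

definition sample_cov_mat :: "nat \<Rightarrow> 'a process \<Rightarrow> nat \<Rightarrow> 'a \<Rightarrow> real mat" where
  "sample_cov_mat d X n \<omega> =
     mat d d (\<lambda>(i, j). (\<Sum>t=1..n. vec_index (X (int t) \<omega>) i * vec_index (X (int t) \<omega>) j) / real n)"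

text \<open>The eigenvalues of the matrix, with multiplicity and in order, are $\phi_1^2,\dots,\phi_d^2$.\<close>

definition ordered_eigenvalue_roots :: "real mat \<Rightarrow> nat \<Rightarrow> (nat \<Rightarrow> real) \<Rightarrow> bool" where
  "ordered_eigenvalue_roots A d \<phi> \<longleftrightarrow>
     char_poly A = (\<Prod>j=1..d. [:- (\<phi> j)\<^sup>2, 1:]) \<and>
     (\<forall>j\<in>{1..d}. 0 \<le> \<phi> j) \<and>
     (\<forall>i\<in>{1..d}. \<forall>j\<in>{1..d}. i \<le> j \<longrightarrow> \<phi> j \<le> \<phi> i)"

definition local_ball :: "nat \<Rightarrow> real vec \<Rightarrow> real \<Rightarrow> real vec set" where
  "local_ball d \<beta>0 \<eta> = {\<beta> \<in> carrier_vec d. l2_norm_vec (\<beta> - \<beta>0) \<le> \<eta>}"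

definition sparse_vecs :: "nat \<Rightarrow> real \<Rightarrow> real vec set" where
  "sparse_vecs d s = {\<beta> \<in> carrier_vec d. real (l0_norm_vec \<beta>) \<le> s}"

definition emp_risk :: "real mat \<Rightarrow> real vec \<Rightarrow> real" where
  "emp_risk S \<beta> = - (1/2) * scalar_prod \<beta> (S *\<^sub>v \<beta>) + (1/4) * l2_norm_vec \<beta> ^ 4"

text \<open>
  The minimiser need not be unique, so the estimator is any random vector that selects one.
\<close>

definition l0_estimator ::
  "'a measure \<Rightarrow> nat \<Rightarrow> 'a process \<Rightarrow> nat \<Rightarrow> real vec \<Rightarrow> real \<Rightarrow> real \<Rightarrow> ('a \<Rightarrow> real vec) \<Rightarrow> bool" where
  "l0_estimator M d X n \<beta>0 \<eta> lam0 \<beta>hat \<longleftrightarrow>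
     random_vec M d \<beta>hat \<and>
     (\<forall>\<omega>\<in>space M.
        is_arg_min (\<lambda>\<beta>. emp_risk (sample_cov_mat d X n \<omega>) \<beta> + lam0 * real (l0_norm_vec \<beta>))
          (\<lambda>\<beta>. \<beta> \<in> local_ball d \<beta>0 \<eta>) (\<beta>hat \<omega>))"

definition sparsity_constant ::
  "'a measure \<Rightarrow> nat \<Rightarrow> 'a process \<Rightarrow> nat \<Rightarrow> real vec \<Rightarrow> real \<Rightarrow> ('a \<Rightarrow> real vec) \<Rightarrow> real \<Rightarrow> bool" where
  "sparsity_constant M d X n \<beta>0 \<eta> \<beta>hat s \<longleftrightarrow>
     0 \<le> s \<and>
     (AE \<omega> in M.
        is_arg_min (emp_risk (sample_cov_mat d X n \<omega>))
          (\<lambda>\<beta>. \<beta> \<in> local_ball d \<beta>0 \<eta> \<inter> sparse_vecs d s) (\<beta>hat \<omega>))"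

end

theory Submission
  imports Defs "HOL-Complex_Analysis.Conformal_Mappings" "Jordan_Normal_Form.Schur_Decomposition"
begin

text \<open>
  Let \<open>W\<close> be the difference of the sample and the population covariance. On an event of the required
  probability, \<open>W\<close> restricted to vectors supported on the union of the true support and \<open>s\<close> further
  coordinates has operator norm at most a small multiple of \<open>\<phi>\<^sub>m\<^sub>a\<^sub>x \<gamma>\<close>: for a fixed direction
  this is a Hanson--Wright bound for a Gaussian vector whose covariance has row sums bounded through
  the \<open>\<rho>\<close>-mixing coefficients, and a grid together with a union bound makes it uniform.
  The population risk is strongly convex around the leading eigenvector, so the estimator is as
  close to the truth as any \<open>s\<close>-sparse competitor, up to the noise.

  If \<open>s\<close> is at least the true sparsity, the truth itself is a competitor. Otherwise the penalty would
  enter with a factor \<open>1/\<phi>\<^sub>m\<^sub>a\<^sub>x\<close> that the claimed bound does not have. However, \<open>s\<close> is a deterministic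
  constant that must work for almost every sample. The law of the Gaussian sample
  is equivalent to the law of a large multiple of it, for which the penalty is negligible, and this
  forces an \<open>s\<close>-sparse vector to exist close to the truth. So the penalty is never needed in the
  final bound.
\<close>

section \<open>Centred normal variables\<close>

text \<open>Multiplying the sample by a large factor makes the quartic term of the risk negligible
  too, not only the penalty. The minimiser over the ball is then pulled away from the truth \<phi> q
  to the boundary point (\<phi> + \<eta>) q, where the population quadratic form is largest.
  Shrinking by \<phi> / (\<phi> + \<eta>) keeps the support and leads back near the truth; this is
  how the sparse competitor arises. The change of measure only has to preserve null sets: sparsity
  of the estimator is an almost sure statement, penalised minimality holds at every outcome, and as
  the competitor is deterministic, one good outcome of the rescaled law suffices. No orthonormal
  eigenbasis appears. The rescaling follows directions orthonormal for the covariance form, the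
  concentration bound needs row sums only, and the eigenvalue gap is read off from traces of powers.
  Deviations are controlled with \<zeta> / 1000 in place of \<zeta>, which pays for all numerical
  losses and fixes the constant c.\<close>

lemma nn_integral_std_normal_exp:
  "(\<integral>\<^sup>+x. ennreal (exp (r * x)) \<partial>std_normal_distribution) = ennreal (exp (r\<^sup>2 / 2))"
proof -
  have "std_normal_density x * exp (r * x) = exp (r\<^sup>2 / 2) * normal_density r 1 x" for x
    by (simp add: normal_density_def exp_add[symmetric] power2_eq_square field_simps)
  then have "(\<integral>\<^sup>+x. ennreal (exp (r * x)) \<partial>std_normal_distribution)
      = (\<integral>\<^sup>+x. ennreal (exp (r\<^sup>2 / 2)) * ennreal (normal_density r 1 x) \<partial>lborel)"
    by (subst nn_integral_density) (auto simp: ennreal_mult[symmetric])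
  also have "\<dots> = ennreal (exp (r\<^sup>2 / 2)) * (\<integral>\<^sup>+x. ennreal (normal_density r 1 x) \<partial>lborel)"
    by (subst nn_integral_cmult) auto
  also have "(\<integral>\<^sup>+x. ennreal (normal_density r 1 x) \<partial>lborel) = 1"
    by (subst nn_integral_eq_integral) auto
  finally show ?thesis by simp
qed

text \<open>The weight lowers the precision of the standard normal law from 1 to 1 - k, which stays
  positive for k < 1; the factor in front is the change of normalisation.\<close>

lemma std_normal_density_exp_square:
  assumes "k < 1"
  shows "std_normal_density x * exp (k * x\<^sup>2 / 2)
    = 1 / sqrt (1 - k) * normal_density 0 (1 / sqrt (1 - k)) x"
proof -
  have 1: "sqrt (2 * pi * (1 / sqrt (1 - k))\<^sup>2) = sqrt (2 * pi) * (1 / sqrt (1 - k))"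
    using assms by (simp add: real_sqrt_mult power_divide real_sqrt_divide)
  have 2: "x\<^sup>2 / (2 * (1 / sqrt (1 - k))\<^sup>2) = x\<^sup>2 * (1 - k) / 2"
    using assms by (simp add: power_divide)
  show ?thesis
    using assms
    by (simp add: normal_density_def 1 2 exp_add[symmetric] ) (simp add: field_simps)
qed

lemma nn_integral_std_normal_exp_square:
  assumes "k < 1"
  shows "(\<integral>\<^sup>+x. ennreal (exp (k * x\<^sup>2 / 2)) \<partial>std_normal_distribution) = ennreal (1 / sqrt (1 - k))"
proof -
  have "(\<integral>\<^sup>+x. ennreal (exp (k * x\<^sup>2 / 2)) \<partial>std_normal_distribution)
      = (\<integral>\<^sup>+x. ennreal (1 / sqrt (1 - k)) * ennreal (normal_density 0 (1 / sqrt (1 - k)) x) \<partial>lborel)"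
    using assms std_normal_density_exp_square[OF assms]
    by (subst nn_integral_density) (auto simp: ennreal_mult[symmetric])
  also have "\<dots> = ennreal (1 / sqrt (1 - k)) * (\<integral>\<^sup>+x. ennreal (normal_density 0 (1 / sqrt (1 - k)) x) \<partial>lborel)"
    by (subst nn_integral_cmult) auto
  also have "(\<integral>\<^sup>+x. ennreal (normal_density 0 (1 / sqrt (1 - k)) x) \<partial>lborel) = 1"
    using assms by (subst nn_integral_eq_integral) auto
  finally show ?thesis by simp
qed

lemma prob_space_std_normal: "prob_space std_normal_distribution"
  by (rule prob_space_normal_density) simp

text \<open>Stated through the image of the standard normal law under scaling and not through a
  density, so that v = 0, the point mass at 0, needs no separate case.\<close>

definition centered_normal :: "'a measure \<Rightarrow> ('a \<Rightarrow> real) \<Rightarrow> real \<Rightarrow> bool" where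
  "centered_normal M Y v \<longleftrightarrow> Y \<in> borel_measurable M \<and> 0 \<le> v \<and>
     distr M borel Y = distr std_normal_distribution borel (\<lambda>x. sqrt v * x)"

context
  fixes M :: "'a measure" and Y v
  assumes cn: "centered_normal M Y v"
begin

lemma centered_normal_measurable: "Y \<in> borel_measurable M"
  and centered_normal_nonneg: "0 \<le> v"
  using cn by (auto simp: centered_normal_def)

lemma centered_normal_nn_integral:
  assumes [measurable]: "f \<in> borel_measurable borel"
  shows "(\<integral>\<^sup>+\<omega>. f (Y \<omega>) \<partial>M) = (\<integral>\<^sup>+x. f (sqrt v * x) \<partial>std_normal_distribution)"
proof -
  note [measurable] = centered_normal_measurable
  have "(\<integral>\<^sup>+\<omega>. f (Y \<omega>) \<partial>M) = (\<integral>\<^sup>+y. f y \<partial>distr M borel Y)"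
    by (simp add: nn_integral_distr)
  also have "\<dots> = (\<integral>\<^sup>+x. f (sqrt v * x) \<partial>std_normal_distribution)"
    using cn unfolding centered_normal_def by (simp add: nn_integral_distr)
  finally show ?thesis .
qed

lemma centered_normal_integral:
  fixes f :: "real \<Rightarrow> 'b :: {banach, second_countable_topology}"
  assumes [measurable]: "f \<in> borel_measurable borel"
  shows "(\<integral>\<omega>. f (Y \<omega>) \<partial>M) = (\<integral>x. f (sqrt v * x) \<partial>std_normal_distribution)"
    and "integrable M (\<lambda>\<omega>. f (Y \<omega>)) \<longleftrightarrow> integrable std_normal_distribution (\<lambda>x. f (sqrt v * x))"
proof -
  note [measurable] = centered_normal_measurable
  have eq: "distr M borel Y = distr std_normal_distribution borel (\<lambda>x. sqrt v * x)"
    using cn unfolding centered_normal_def by blast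
  have "(\<integral>\<omega>. f (Y \<omega>) \<partial>M) = (\<integral>y. f y \<partial>distr M borel Y)"
    by (rule integral_distr[symmetric]) auto
  also have "\<dots> = (\<integral>x. f (sqrt v * x) \<partial>std_normal_distribution)"
    unfolding eq by (rule integral_distr) auto
  finally show "(\<integral>\<omega>. f (Y \<omega>) \<partial>M) = (\<integral>x. f (sqrt v * x) \<partial>std_normal_distribution)" .
  have "integrable M (\<lambda>\<omega>. f (Y \<omega>)) \<longleftrightarrow> integrable (distr M borel Y) f"
    by (rule integrable_distr_eq[symmetric]) auto
  also have "\<dots> \<longleftrightarrow> integrable std_normal_distribution (\<lambda>x. f (sqrt v * x))"
    unfolding eq by (rule integrable_distr_eq) auto
  finally show "integrable M (\<lambda>\<omega>. f (Y \<omega>)) \<longleftrightarrow> integrable std_normal_distribution (\<lambda>x. f (sqrt v * x))" .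
qed

lemma centered_normal_char:
  "(CLINT \<omega>|M. iexp (t * Y \<omega>)) = of_real (exp (- (t\<^sup>2 * v / 2)))"
proof -
  have "(CLINT \<omega>|M. iexp (t * Y \<omega>)) = (CLINT x|std_normal_distribution. iexp (t * (sqrt v * x)))"
    by (rule centered_normal_integral(1)) auto
  also have "\<dots> = char std_normal_distribution (t * sqrt v)"
    by (simp add: char_def mult.assoc)
  also have "\<dots> = of_real (exp (- (t\<^sup>2 * v / 2)))"
    using centered_normal_nonneg
    by (simp add: char_std_normal_distribution power_mult_distrib)
  finally show ?thesis .
qed

lemma centered_normal_nn_exp:
  "(\<integral>\<^sup>+\<omega>. ennreal (exp (r * Y \<omega>)) \<partial>M) = ennreal (exp (r\<^sup>2 * v / 2))"
proof -
  have "(\<integral>\<^sup>+\<omega>. ennreal (exp (r * Y \<omega>)) \<partial>M)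
      = (\<integral>\<^sup>+x. ennreal (exp (r * sqrt v * x)) \<partial>std_normal_distribution)"
    by (subst centered_normal_nn_integral) (auto simp: mult.assoc)
  then show ?thesis
    using centered_normal_nonneg by (simp add: nn_integral_std_normal_exp power_mult_distrib)
qed

lemma centered_normal_integrable_exp: "integrable M (\<lambda>\<omega>. exp (r * Y \<omega>))"
  using centered_normal_measurable by (intro integrableI_bounded) (auto simp: centered_normal_nn_exp)

lemma centered_normal_square:
  "integrable M (\<lambda>\<omega>. (Y \<omega>)\<^sup>2)" "(\<integral>\<omega>. (Y \<omega>)\<^sup>2 \<partial>M) = v"
proof -
  have "integrable std_normal_distribution (\<lambda>x. (x::real)^2)"
    by (rule integrable_std_normal_distribution_moment)
  then show "integrable M (\<lambda>\<omega>. (Y \<omega>)\<^sup>2)"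
    by (subst centered_normal_integral(2)) (auto simp: power_mult_distrib)
  have "(\<integral>x. x\<^sup>2 \<partial>std_normal_distribution) = 1"
    using std_normal_distribution_even_moments(1)[of 1] by simp
  then show "(\<integral>\<omega>. (Y \<omega>)\<^sup>2 \<partial>M) = v"
    using centered_normal_nonneg
    by (subst centered_normal_integral(1)) (auto simp: power_mult_distrib)
qed

end

text \<open>Levy's uniqueness theorem. Characteristic functions recognise normality both of the
  given variables and after a change of measure.\<close>

lemma centered_normalI_char:
  assumes "prob_space M" and [measurable]: "Y \<in> borel_measurable M" and v: "0 \<le> v"
    and ch: "\<And>t. (CLINT \<omega>|M. iexp (t * Y \<omega>)) = of_real (exp (- (t\<^sup>2 * v / 2)))"
  shows "centered_normal M Y v"
proof -
  have "char (distr M borel Y) = char (distr std_normal_distribution borel (\<lambda>x. sqrt v * x))"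
  proof
    fix t
    have "char (distr M borel Y) t = of_real (exp (- (t\<^sup>2 * v / 2)))"
      unfolding char_def using ch[of t] by (subst integral_distr) auto
    also have "\<dots> = char std_normal_distribution (t * sqrt v)"
      using v by (simp add: char_std_normal_distribution power_mult_distrib)
    also have "\<dots> = char (distr std_normal_distribution borel (\<lambda>x. sqrt v * x)) t"
      unfolding char_def by (subst integral_distr) (auto simp: mult.assoc)
    finally show "char (distr M borel Y) t = char (distr std_normal_distribution borel (\<lambda>x. sqrt v * x)) t" .
  qed
  then have "distr M borel Y = distr std_normal_distribution borel (\<lambda>x. sqrt v * x)"
    using assms(1)
    by (intro Levy_uniqueness prob_space.real_distribution_distr prob_space_std_normal) auto
  with v show ?thesis unfolding centered_normal_def by simp
qed

text \<open>Both sides are entire in \<open>r\<close> and agree on the imaginary axis.\<close>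

lemma joint_normal_mixed_exp:
  fixes Y Z :: "'a \<Rightarrow> real"
  assumes M: "prob_space M"
    and YZ: "\<And>t. centered_normal M (\<lambda>\<omega>. Y \<omega> + t * Z \<omega>) (v + 2 * t * c + t\<^sup>2 * w)"
    and Z: "centered_normal M Z w"
  shows "(CLINT \<omega>|M. iexp (Y \<omega>) * exp (of_real (r * Z \<omega>)))
    = exp (of_real (- v / 2 + r\<^sup>2 * w / 2) + \<i> * of_real (r * c))"
proof -
  interpret prob_space M by fact
  have [measurable]: "Z \<in> borel_measurable M" using centered_normal_measurable[OF Z] .
  have [measurable]: "Y \<in> borel_measurable M"
    using centered_normal_measurable[OF YZ[of 0]] by simp
  define F where "F z = (CLINT \<omega>|M. iexp (Y \<omega>) * exp (z * of_real (Z \<omega>)))" for z :: complex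
  \<comment> \<open>Coefficients of the power series of F. Dominated convergence with the majorant
    exp(|z| |Z|), integrable since Z has all exponential moments, shows that the series converges to
    F everywhere; hence F is entire without differentiation under the integral.\<close>
  define a where "a k = (CLINT \<omega>|M. iexp (Y \<omega>) * (of_real (Z \<omega>) ^ k / fact k))" for k
  have dom: "integrable M (\<lambda>\<omega>. exp (x * \<bar>Z \<omega>\<bar>))" if "0 \<le> x" for x
  proof (rule Bochner_Integration.integrable_bound)
    show "integrable M (\<lambda>\<omega>. exp (x * Z \<omega>) + exp ((- x) * Z \<omega>))"
      by (intro Bochner_Integration.integrable_add centered_normal_integrable_exp[OF Z])
    show "AE \<omega> in M. norm (exp (x * \<bar>Z \<omega>\<bar>)) \<le> norm (exp (x * Z \<omega>) + exp ((- x) * Z \<omega>))"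
    proof (rule AE_I2)
      fix \<omega>
      show "norm (exp (x * \<bar>Z \<omega>\<bar>)) \<le> norm (exp (x * Z \<omega>) + exp ((- x) * Z \<omega>))"
        using exp_gt_zero[of "x * Z \<omega>"] exp_gt_zero[of "(- x) * Z \<omega>"]
        by (cases "0 \<le> Z \<omega>") (auto simp: abs_of_pos add_pos_pos simp del: exp_gt_zero)
    qed
  qed simp
  have term_le: "x ^ k / fact k \<le> exp x" if "0 \<le> x" for x :: real and k
  proof -
    have "(\<Sum>i\<in>{k}. x ^ i /\<^sub>R fact i) \<le> (\<Sum>i. x ^ i /\<^sub>R fact i)"
      using that by (intro sum_le_suminf summable_exp_generic) auto
    then show ?thesis by (simp add: exp_def divide_inverse mult.commute)
  qed
  have int_k: "integrable M (\<lambda>\<omega>. iexp (Y \<omega>) * (of_real (Z \<omega>) ^ k / fact k))" for k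
    by (rule Bochner_Integration.integrable_bound[OF dom[of 1]])
      (auto simp: norm_mult norm_divide norm_power intro!: term_le)
  have part: "(\<Sum>k<N. x ^ k / fact k) \<le> exp x" if "0 \<le> x" for x :: real and N
  proof -
    have "(\<Sum>i<N. x ^ i /\<^sub>R fact i) \<le> (\<Sum>i. x ^ i /\<^sub>R fact i)"
      using that by (intro sum_le_suminf summable_exp_generic) auto
    then show ?thesis by (simp add: exp_def divide_inverse mult.commute)
  qed
  have sums: "(\<lambda>k. a k * (z - 0) ^ k) sums F z" for z
  proof -
    have "(\<lambda>N. CLINT \<omega>|M. (\<Sum>k<N. iexp (Y \<omega>) * ((z * of_real (Z \<omega>)) ^ k / fact k))) \<longlonglongrightarrow> F z"
      unfolding F_def
    proof (rule integral_dominated_convergence[where w = "\<lambda>\<omega>. exp (norm z * \<bar>Z \<omega>\<bar>)"])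
      show "integrable M (\<lambda>\<omega>. exp (norm z * \<bar>Z \<omega>\<bar>))" by (rule dom) simp
      show "AE \<omega> in M. (\<lambda>N. \<Sum>k<N. iexp (Y \<omega>) * ((z * of_real (Z \<omega>)) ^ k / fact k))
              \<longlonglongrightarrow> iexp (Y \<omega>) * exp (z * of_real (Z \<omega>))"
      proof (rule AE_I2)
        fix \<omega>
        have "(\<lambda>k. (z * of_real (Z \<omega>)) ^ k /\<^sub>R fact k) sums exp (z * of_real (Z \<omega>))"
          by (rule exp_converges)
        then have "(\<lambda>k. (z * of_real (Z \<omega>)) ^ k / fact k) sums exp (z * of_real (Z \<omega>))"
          by (simp add: scaleR_conv_of_real divide_inverse mult.commute)
        then show "(\<lambda>N. \<Sum>k<N. iexp (Y \<omega>) * ((z * of_real (Z \<omega>)) ^ k / fact k))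
              \<longlonglongrightarrow> iexp (Y \<omega>) * exp (z * of_real (Z \<omega>))"
          using sums_mult unfolding sums_def by blast
      qed
      show "AE \<omega> in M. norm (\<Sum>k<N. iexp (Y \<omega>) * ((z * of_real (Z \<omega>)) ^ k / fact k))
              \<le> exp (norm z * \<bar>Z \<omega>\<bar>)" for N
      proof (rule AE_I2)
        fix \<omega>
        have "norm (\<Sum>k<N. iexp (Y \<omega>) * ((z * of_real (Z \<omega>)) ^ k / fact k))
            \<le> (\<Sum>k<N. (norm z * \<bar>Z \<omega>\<bar>) ^ k / fact k)"
          by (rule order_trans[OF norm_sum]) (simp add: norm_mult norm_divide norm_power)
        also have "\<dots> \<le> exp (norm z * \<bar>Z \<omega>\<bar>)" by (rule part) simp
        finally show "norm (\<Sum>k<N. iexp (Y \<omega>) * ((z * of_real (Z \<omega>)) ^ k / fact k))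
              \<le> exp (norm z * \<bar>Z \<omega>\<bar>)" .
      qed
    qed auto
    moreover have "(CLINT \<omega>|M. (\<Sum>k<N. iexp (Y \<omega>) * ((z * of_real (Z \<omega>)) ^ k / fact k)))
        = (\<Sum>k<N. a k * (z - 0) ^ k)" for N
    proof -
      have "(CLINT \<omega>|M. (\<Sum>k<N. iexp (Y \<omega>) * ((z * of_real (Z \<omega>)) ^ k / fact k)))
        = (CLINT \<omega>|M. (\<Sum>k<N. iexp (Y \<omega>) * (of_real (Z \<omega>) ^ k / fact k) * z ^ k))"
        by (simp add: power_mult_distrib mult_ac)
      also have "\<dots> = (\<Sum>k<N. CLINT \<omega>|M. iexp (Y \<omega>) * (of_real (Z \<omega>) ^ k / fact k) * z ^ k)"
        by (intro Bochner_Integration.integral_sum integrable_mult_left int_k)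
      also have "\<dots> = (\<Sum>k<N. a k * (z - 0) ^ k)"
        unfolding a_def by (intro sum.cong refl) simp
      finally show ?thesis .
    qed
    ultimately show ?thesis unfolding sums_def by simp
  qed
  define G where "G z = exp (- of_real v / 2 + z\<^sup>2 * of_real w / 2 + \<i> * z * of_real c)" for z :: complex
  \<comment> \<open>On the imaginary axis the two factors merge into the characteristic function of
    Y + t Z, whose law is known.\<close>
  have FG: "F (\<i> * of_real t) = G (\<i> * of_real t)" for t
  proof -
    have "F (\<i> * of_real t) = (CLINT \<omega>|M. iexp (1 * (Y \<omega> + t * Z \<omega>)))"
      unfolding F_def by (simp add: exp_add[symmetric] algebra_simps)
    also have "\<dots> = of_real (exp (- (1\<^sup>2 * (v + 2 * t * c + t\<^sup>2 * w) / 2)))"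
      by (rule centered_normal_char[OF YZ])
    also have "\<dots> = G (\<i> * of_real t)"
      unfolding G_def exp_of_real[symmetric]
      by (simp add: power_mult_distrib algebra_simps add_divide_distrib)
    finally show ?thesis .
  qed
  have "F z - G z = 0" for z
  proof -
    define R where "R = norm z + 2"
    have "F holomorphic_on ball 0 R"
      by (rule power_series_holomorphic) (use sums in simp)
    moreover have "G holomorphic_on ball 0 R"
      unfolding G_def by (intro holomorphic_intros) auto
    ultimately have hol: "(\<lambda>z. F z - G z) holomorphic_on ball 0 R"
      by (rule holomorphic_on_diff)
    \<comment> \<open>The points i/(n+1) accumulate at 0, inside the disc; agreement on them is all
      that the identity theorem asks for.\<close>
    let ?U = "(\<lambda>n. \<i> * of_real (1 / real (Suc n))) ` UNIV \<inter> ball 0 R"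
    have lim: "(0::complex) islimpt ?U"
      unfolding islimpt_sequential
    proof (intro exI conjI allI)
      let ?f = "\<lambda>n. \<i> * of_real (1 / real (Suc n))"
      show "?f n \<in> ?U - {0}" for n
      proof -
        have "norm (?f n) \<le> 1" by (simp add: norm_mult norm_divide del: of_nat_Suc)
        also have "1 < R" using norm_ge_zero[of z] unfolding R_def by linarith
        finally have "?f n \<in> ball 0 R" by simp
        moreover have "?f n \<noteq> 0" by (simp del: of_nat_Suc)
        ultimately show ?thesis by blast
      qed
      have "(\<lambda>n. \<i> * of_real (1 / real (Suc n))) \<longlonglongrightarrow> \<i> * of_real 0"
        by (intro tendsto_mult tendsto_const tendsto_of_real LIMSEQ_Suc[OF lim_1_over_n])
      then show "?f \<longlonglongrightarrow> 0" by simp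
    qed
    show ?thesis
    proof (rule analytic_continuation[OF hol _ _ _ _ lim])
      show "z \<in> ball 0 R" "(0::complex) \<in> ball 0 R" using norm_ge_zero[of z] by (auto simp: R_def intro: add_nonneg_pos)
      fix u assume "u \<in> ?U"
      then obtain n where "u = \<i> * of_real (1 / real (Suc n))" by blast
      then show "F u - G u = 0" using FG[of "1 / real (Suc n)"] by simp
    qed auto
  qed
  then have "F (of_real r) = G (of_real r)" by simp
  then show ?thesis unfolding F_def G_def by (simp add: algebra_simps)
qed

section \<open>Products of standard normal distributions\<close>

lemma nn_integral_std_normal:
  assumes [measurable]: "f \<in> borel_measurable borel"
  shows "(\<integral>\<^sup>+x. f x \<partial>std_normal_distribution) = (\<integral>\<^sup>+x. ennreal (std_normal_density x) * f x \<partial>lborel)"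
  by (subst nn_integral_density) auto

lemma std_normal_density_rotate:
  "std_normal_density ((u + w) / sqrt 2) * std_normal_density ((u - w) / sqrt 2)
    = std_normal_density u * std_normal_density w"
proof -
  have "((u + w) / sqrt 2)\<^sup>2 + ((u - w) / sqrt 2)\<^sup>2 = u\<^sup>2 + w\<^sup>2"
    by (simp add: power_divide) (simp add: power2_eq_square algebra_simps add_divide_distrib diff_divide_distrib)
  then have "- (((u + w) / sqrt 2)\<^sup>2) / 2 + - (((u - w) / sqrt 2)\<^sup>2) / 2 = - u\<^sup>2 / 2 + - w\<^sup>2 / 2"
    by linarith
  then have "exp (- (((u + w) / sqrt 2)\<^sup>2) / 2) * exp (- (((u - w) / sqrt 2)\<^sup>2) / 2)
      = exp (- u\<^sup>2 / 2) * exp (- w\<^sup>2 / 2)"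
    unfolding exp_add[symmetric] by simp
  then show ?thesis unfolding std_normal_density_def by (simp add: mult_ac)
qed

text \<open>The map is orthogonal, so the product density is invariant. It is carried out as two
  one-dimensional affine substitutions with Fubini in between: y is replaced by u = (x + y) / sqrt 2
  at fixed x, then x by w at fixed u. Their Jacobians sqrt 2 and 1 / sqrt 2 cancel.\<close>

lemma nn_integral_std_normal_rotate:
  fixes F :: "real \<Rightarrow> real \<Rightarrow> ennreal"
  assumes [measurable]: "case_prod F \<in> borel_measurable (borel \<Otimes>\<^sub>M borel)"
  shows "(\<integral>\<^sup>+x. \<integral>\<^sup>+y. F ((x + y) / sqrt 2) ((x - y) / sqrt 2) \<partial>std_normal_distribution \<partial>std_normal_distribution)
    = (\<integral>\<^sup>+x. \<integral>\<^sup>+y. F x y \<partial>std_normal_distribution \<partial>std_normal_distribution)"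
proof -
  let ?d = "\<lambda>x. ennreal (std_normal_density x)"
  have "(\<integral>\<^sup>+x. \<integral>\<^sup>+y. F ((x + y) / sqrt 2) ((x - y) / sqrt 2) \<partial>std_normal_distribution \<partial>std_normal_distribution)
      = (\<integral>\<^sup>+x. \<integral>\<^sup>+y. ?d x * (?d y * F ((x + y) / sqrt 2) ((x - y) / sqrt 2)) \<partial>lborel \<partial>lborel)"
    by (simp add: nn_integral_std_normal nn_integral_cmult)
  also have "\<dots> = (\<integral>\<^sup>+x. ennreal (sqrt 2) * (\<integral>\<^sup>+u. ?d x * (?d (- x + sqrt 2 * u) * F u (sqrt 2 * x - u)) \<partial>lborel) \<partial>lborel)"
  proof (intro nn_integral_cong)
    fix x :: real
    have "(x - (- x + sqrt 2 * u)) / sqrt 2 = sqrt 2 * x - u" for u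
      by (simp add: field_simps)
    then show "(\<integral>\<^sup>+y. ?d x * (?d y * F ((x + y) / sqrt 2) ((x - y) / sqrt 2)) \<partial>lborel)
        = ennreal (sqrt 2) * (\<integral>\<^sup>+u. ?d x * (?d (- x + sqrt 2 * u) * F u (sqrt 2 * x - u)) \<partial>lborel)"
      by (subst nn_integral_real_affine[where c="sqrt 2" and t="- x"]) auto
  qed
  also have "\<dots> = (\<integral>\<^sup>+x. \<integral>\<^sup>+u. ennreal (sqrt 2) * (?d x * (?d (- x + sqrt 2 * u) * F u (sqrt 2 * x - u))) \<partial>lborel \<partial>lborel)"
    by (simp add: nn_integral_cmult)
  also have "\<dots> = (\<integral>\<^sup>+u. \<integral>\<^sup>+x. ennreal (sqrt 2) * (?d x * (?d (- x + sqrt 2 * u) * F u (sqrt 2 * x - u))) \<partial>lborel \<partial>lborel)"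
    by (rule lborel_pair.Fubini') simp
  also have "\<dots> = (\<integral>\<^sup>+u. \<integral>\<^sup>+w. ?d u * (?d w * F u w) \<partial>lborel \<partial>lborel)"
  proof (rule nn_integral_cong)
    fix u :: real
    have 1: "sqrt 2 * (u / sqrt 2 + 1 / sqrt 2 * w) - u = w" for w
      by (simp add: field_simps)
    have 2: "- (u / sqrt 2 + 1 / sqrt 2 * w) + sqrt 2 * u = (u - w) / sqrt 2" for w
      by (simp add: field_simps)
    have 3: "u / sqrt 2 + 1 / sqrt 2 * w = (u + w) / sqrt 2" for w
      by (simp add: field_simps)
    have d: "?d ((u + w) / sqrt 2) * ?d ((u - w) / sqrt 2) = ?d u * ?d w" for w
      by (subst (1 2) ennreal_mult[symmetric]) (auto simp: std_normal_density_rotate)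
    have "(\<integral>\<^sup>+x. ennreal (sqrt 2) * (?d x * (?d (- x + sqrt 2 * u) * F u (sqrt 2 * x - u))) \<partial>lborel)
      = ennreal \<bar>1 / sqrt 2\<bar> * (\<integral>\<^sup>+w. ennreal (sqrt 2) * (?d (u / sqrt 2 + 1 / sqrt 2 * w) *
          (?d (- (u / sqrt 2 + 1 / sqrt 2 * w) + sqrt 2 * u) * F u (sqrt 2 * (u / sqrt 2 + 1 / sqrt 2 * w) - u))) \<partial>lborel)"
      by (rule nn_integral_real_affine) auto
    also have "\<dots> = ennreal (1 / sqrt 2) * (\<integral>\<^sup>+w. ennreal (sqrt 2) * (?d ((u + w) / sqrt 2) * (?d ((u - w) / sqrt 2) * F u w)) \<partial>lborel)"
      unfolding 1 2 unfolding 3 by simp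
    also have "\<dots> = ennreal (1 / sqrt 2) * (ennreal (sqrt 2) * (\<integral>\<^sup>+w. ?d ((u + w) / sqrt 2) * ?d ((u - w) / sqrt 2) * F u w \<partial>lborel))"
      by (subst nn_integral_cmult) (auto simp: mult.assoc)
    also have "\<dots> = ennreal (1 / sqrt 2) * ennreal (sqrt 2) * (\<integral>\<^sup>+w. ?d u * ?d w * F u w \<partial>lborel)"
      by (simp only: d mult.assoc)
    also have "ennreal (1 / sqrt 2) * ennreal (sqrt 2) = 1"
      by (subst ennreal_mult[symmetric]) auto
    finally show "(\<integral>\<^sup>+x. ennreal (sqrt 2) * (?d x * (?d (- x + sqrt 2 * u) * F u (sqrt 2 * x - u))) \<partial>lborel)
      = (\<integral>\<^sup>+w. ?d u * (?d w * F u w) \<partial>lborel)" by (simp add: mult.assoc)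
  qed
  also have "\<dots> = (\<integral>\<^sup>+x. \<integral>\<^sup>+y. F x y \<partial>std_normal_distribution \<partial>std_normal_distribution)"
    by (simp add: nn_integral_std_normal nn_integral_cmult)
  finally show ?thesis .
qed

abbreviation normal_product :: "'i set \<Rightarrow> ('i \<Rightarrow> real) measure" where
  "normal_product T \<equiv> PiM T (\<lambda>_. std_normal_distribution)"

interpretation std_normal: prob_space std_normal_distribution
  by (rule prob_space_std_normal)

interpretation std_normal_product: product_sigma_finite "\<lambda>_. std_normal_distribution" ..

lemma prob_space_normal_product: "prob_space (normal_product T)"
  by (rule prob_space_PiM) (rule prob_space_std_normal)

lemma sets_normal_product [measurable_cong]: "sets (normal_product T) = sets (PiM T (\<lambda>_. borel))"
  by (rule sets_PiM_cong) auto

lemma sigma_finite_normal_product: "sigma_finite_measure (normal_product T)"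
  using prob_space_normal_product by (rule prob_space_imp_sigma_finite)

text \<open>The orthogonal map acts on each pair (g i, h i) separately, so induction on T reduces
  the claim to the planar case.\<close>

lemma nn_integral_normal_product_rotate:
  fixes F :: "('i \<Rightarrow> real) \<Rightarrow> ('i \<Rightarrow> real) \<Rightarrow> ennreal"
  assumes "finite T"
    and "case_prod F \<in> borel_measurable (PiM T (\<lambda>_. borel) \<Otimes>\<^sub>M PiM T (\<lambda>_. borel))"
  shows "(\<integral>\<^sup>+g. \<integral>\<^sup>+h. F (\<lambda>i\<in>T. (g i + h i) / sqrt 2) (\<lambda>i\<in>T. (g i - h i) / sqrt 2)
      \<partial>normal_product T \<partial>normal_product T)
    = (\<integral>\<^sup>+g. \<integral>\<^sup>+h. F g h \<partial>normal_product T \<partial>normal_product T)"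
  using assms
proof (induction T arbitrary: F)
  case empty
  have *: "(\<integral>\<^sup>+g. \<integral>\<^sup>+h. G g h \<partial>normal_product {} \<partial>normal_product {}) = G (\<lambda>_. undefined) (\<lambda>_. undefined)"
    for G :: "('i \<Rightarrow> real) \<Rightarrow> ('i \<Rightarrow> real) \<Rightarrow> ennreal"
    by (subst (1 2) std_normal_product.nn_integral_empty) auto
  show ?case unfolding * by (simp add: restrict_def)
next
  case (insert i T)
  note [measurable] = insert.prems
  have upd [measurable]: "(\<lambda>x. (f x)(i := g x)) \<in> measurable N (PiM (insert i T) (\<lambda>_. borel))"
    if [measurable]: "f \<in> measurable N (PiM T (\<lambda>_. borel))" "g \<in> borel_measurable N"
    for N :: "'x measure" and f and g :: "'x \<Rightarrow> real"
    using measurable_fun_upd[of "insert i T" T i f N "\<lambda>_. borel" g] that by auto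
  let ?\<nu> = std_normal_distribution
  let ?R = "\<lambda>T g h. (\<lambda>i\<in>T. (g i + h i) / sqrt 2) :: 'i \<Rightarrow> real"
  let ?S = "\<lambda>T g h. (\<lambda>i\<in>T. (g i - h i) / sqrt 2) :: 'i \<Rightarrow> real"
  \<comment> \<open>Moves both integrals over coordinate i to the innermost place, where the planar
    case applies with all other coordinates fixed.\<close>
  have swap: "(\<integral>\<^sup>+g. \<integral>\<^sup>+h. G g h \<partial>normal_product (insert i T) \<partial>normal_product (insert i T))
      = (\<integral>\<^sup>+g. \<integral>\<^sup>+h. \<integral>\<^sup>+x. \<integral>\<^sup>+y. G (g(i := x)) (h(i := y)) \<partial>?\<nu> \<partial>?\<nu> \<partial>normal_product T \<partial>normal_product T)"
    if [measurable]: "case_prod G \<in> borel_measurable (PiM (insert i T) (\<lambda>_. borel) \<Otimes>\<^sub>M PiM (insert i T) (\<lambda>_. borel))"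
    for G :: "('i \<Rightarrow> real) \<Rightarrow> ('i \<Rightarrow> real) \<Rightarrow> ennreal"
  proof -
    interpret P: sigma_finite_measure "normal_product (insert i T)" by (rule sigma_finite_normal_product)
    interpret Q: sigma_finite_measure "normal_product T" by (rule sigma_finite_normal_product)
    have "(\<integral>\<^sup>+g. \<integral>\<^sup>+h. G g h \<partial>normal_product (insert i T) \<partial>normal_product (insert i T))
        = (\<integral>\<^sup>+g. \<integral>\<^sup>+x. \<integral>\<^sup>+h. G (g(i := x)) h \<partial>normal_product (insert i T) \<partial>?\<nu> \<partial>normal_product T)"
      using insert.hyps by (subst std_normal_product.product_nn_integral_insert) auto
    also have "\<dots> = (\<integral>\<^sup>+g. \<integral>\<^sup>+x. \<integral>\<^sup>+h. \<integral>\<^sup>+y. G (g(i := x)) (h(i := y)) \<partial>?\<nu> \<partial>normal_product T \<partial>?\<nu> \<partial>normal_product T)"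
    proof (intro nn_integral_cong)
      fix g x assume g: "g \<in> space (normal_product T)"
      then have "g(i := x) \<in> space (PiM (insert i T) (\<lambda>_. borel))"
        by (auto simp: space_PiM PiE_def extensional_def)
      then have "G (g(i := x)) \<in> borel_measurable (PiM (insert i T) (\<lambda>_. borel))" by measurable
      then show "(\<integral>\<^sup>+h. G (g(i := x)) h \<partial>normal_product (insert i T))
          = (\<integral>\<^sup>+h. \<integral>\<^sup>+y. G (g(i := x)) (h(i := y)) \<partial>?\<nu> \<partial>normal_product T)"
        using insert.hyps by (subst std_normal_product.product_nn_integral_insert) auto
    qed
    also have "\<dots> = (\<integral>\<^sup>+g. \<integral>\<^sup>+h. \<integral>\<^sup>+x. \<integral>\<^sup>+y. G (g(i := x)) (h(i := y)) \<partial>?\<nu> \<partial>?\<nu> \<partial>normal_product T \<partial>normal_product T)"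
    proof (intro nn_integral_cong pair_sigma_finite.Fubini')
      show "pair_sigma_finite (normal_product T) ?\<nu>"
        by (intro pair_sigma_finite.intro sigma_finite_normal_product) (rule std_normal.sigma_finite_measure_axioms)
      fix g assume "g \<in> space (normal_product T)"
      then have [measurable]: "g \<in> space (PiM T (\<lambda>_. borel))" by (simp add: space_PiM)
      show "(\<lambda>(h, x). \<integral>\<^sup>+y. G (g(i := x)) (h(i := y)) \<partial>?\<nu>) \<in> borel_measurable (normal_product T \<Otimes>\<^sub>M ?\<nu>)"
        by measurable
    qed
    finally show ?thesis .
  qed
  have rot_upd: "?R (insert i T) (g(i := x)) (h(i := y)) = (?R T g h)(i := (x + y) / sqrt 2)"
    "?S (insert i T) (g(i := x)) (h(i := y)) = (?S T g h)(i := (x - y) / sqrt 2)" for g h x y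
    using insert.hyps by (auto simp: restrict_def)
  let ?F = "\<lambda>g h. \<integral>\<^sup>+x. \<integral>\<^sup>+y. F (g(i := x)) (h(i := y)) \<partial>?\<nu> \<partial>?\<nu>"
  have meas: "(\<lambda>(g, h). F (?R (insert i T) g h) (?S (insert i T) g h))
      \<in> borel_measurable (PiM (insert i T) (\<lambda>_. borel) \<Otimes>\<^sub>M PiM (insert i T) (\<lambda>_. borel))"
    by measurable
  have "(\<integral>\<^sup>+g. \<integral>\<^sup>+h. F (?R (insert i T) g h) (?S (insert i T) g h) \<partial>normal_product (insert i T) \<partial>normal_product (insert i T))
     = (\<integral>\<^sup>+g. \<integral>\<^sup>+h. \<integral>\<^sup>+x. \<integral>\<^sup>+y. F ((?R T g h)(i := (x + y) / sqrt 2)) ((?S T g h)(i := (x - y) / sqrt 2))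
          \<partial>?\<nu> \<partial>?\<nu> \<partial>normal_product T \<partial>normal_product T)"
    unfolding swap[OF meas] rot_upd ..
  also have "\<dots> = (\<integral>\<^sup>+g. \<integral>\<^sup>+h. ?F (?R T g h) (?S T g h) \<partial>normal_product T \<partial>normal_product T)"
  proof (rule nn_integral_cong, rule nn_integral_cong)
    fix g h assume "g \<in> space (normal_product T)" "h \<in> space (normal_product T)"
    then have [measurable]: "?R T g h \<in> space (PiM T (\<lambda>_. borel))" "?S T g h \<in> space (PiM T (\<lambda>_. borel))"
      by (auto simp: space_PiM)
    show "(\<integral>\<^sup>+x. \<integral>\<^sup>+y. F ((?R T g h)(i := (x + y) / sqrt 2)) ((?S T g h)(i := (x - y) / sqrt 2)) \<partial>?\<nu> \<partial>?\<nu>)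
        = ?F (?R T g h) (?S T g h)"
      by (rule nn_integral_std_normal_rotate) measurable
  qed
  also have "\<dots> = (\<integral>\<^sup>+g. \<integral>\<^sup>+h. ?F g h \<partial>normal_product T \<partial>normal_product T)"
    by (rule insert.IH) measurable
  also have "\<dots> = (\<integral>\<^sup>+g. \<integral>\<^sup>+h. F g h \<partial>normal_product (insert i T) \<partial>normal_product (insert i T))"
    by (subst swap) measurable
  finally show ?case .
qed

section \<open>Quadratic forms of normal families\<close>

text \<open>Matrices are functions on a finite index set: the index may be a pair of time and
  coordinate, a time, or an element of a support set that varies.\<close>

definition bilin :: "'i set \<Rightarrow> ('i \<Rightarrow> 'i \<Rightarrow> real) \<Rightarrow> ('i \<Rightarrow> real) \<Rightarrow> ('i \<Rightarrow> real) \<Rightarrow> real" where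
  "bilin I R a b = (\<Sum>i\<in>I. \<Sum>j\<in>I. a i * b j * R i j)"

text \<open>Joint normality in the Cramer-Wold form. Singular R is allowed, and positive
  semidefiniteness is implicit, because the form of R is the variance of a linear
  combination.\<close>

definition normal_family :: "'a measure \<Rightarrow> 'i set \<Rightarrow> ('i \<Rightarrow> 'i \<Rightarrow> real) \<Rightarrow> ('i \<Rightarrow> 'a \<Rightarrow> real) \<Rightarrow> bool" where
  "normal_family M I R Y \<longleftrightarrow> prob_space M \<and> finite I \<and> (\<forall>i\<in>I. Y i \<in> borel_measurable M) \<and>
     (\<forall>i\<in>I. \<forall>j\<in>I. R i j = R j i) \<and>
     (\<forall>a. centered_normal M (\<lambda>\<omega>. \<Sum>i\<in>I. a i * Y i \<omega>) (bilin I R a a))"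

lemma normal_family_combination:
  "normal_family M I R Y \<Longrightarrow> centered_normal M (\<lambda>\<omega>. \<Sum>i\<in>I. a i * Y i \<omega>) (bilin I R a a)"
  by (simp add: normal_family_def)

section \<open>Exponential moments of independent standard normal variables\<close>

lemma nn_integral_normal_product_exp:
  assumes "finite T"
  shows "(\<integral>\<^sup>+g. ennreal (exp (r * (\<Sum>t\<in>T. g t * y t))) \<partial>normal_product T)
    = ennreal (exp (r\<^sup>2 / 2 * (\<Sum>t\<in>T. (y t)\<^sup>2)))"
proof -
  have "(\<integral>\<^sup>+g. ennreal (exp (r * (\<Sum>t\<in>T. g t * y t))) \<partial>normal_product T)
      = (\<integral>\<^sup>+g. (\<Prod>t\<in>T. ennreal (exp ((r * y t) * g t))) \<partial>normal_product T)"
    using assms by (simp add: prod_ennreal exp_sum[symmetric] sum_distrib_left mult_ac)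
  also have "\<dots> = (\<Prod>t\<in>T. \<integral>\<^sup>+x. ennreal (exp ((r * y t) * x)) \<partial>std_normal_distribution)"
    using assms by (intro std_normal_product.product_nn_integral_prod) auto
  also have "\<dots> = ennreal (exp (r\<^sup>2 / 2 * (\<Sum>t\<in>T. (y t)\<^sup>2)))"
    using assms
    by (simp only: nn_integral_std_normal_exp) (simp add: prod_ennreal exp_sum[symmetric] sum_distrib_left power_mult_distrib mult_ac)
  finally show ?thesis .
qed

lemma nn_integral_normal_product_exp_square:
  assumes "finite T" "k < 1"
  shows "(\<integral>\<^sup>+g. ennreal (exp (k / 2 * (\<Sum>t\<in>T. (g t)\<^sup>2))) \<partial>normal_product T)
    = ennreal ((1 / sqrt (1 - k)) ^ card T)"
proof -
  have "(\<integral>\<^sup>+g. ennreal (exp (k / 2 * (\<Sum>t\<in>T. (g t)\<^sup>2))) \<partial>normal_product T)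
      = (\<integral>\<^sup>+g. (\<Prod>t\<in>T. ennreal (exp (k * (g t)\<^sup>2 / 2))) \<partial>normal_product T)"
    using assms by (simp add: prod_ennreal exp_sum[symmetric] sum_distrib_left mult_ac)
  also have "\<dots> = (\<Prod>t\<in>T. \<integral>\<^sup>+x. ennreal (exp (k * x\<^sup>2 / 2)) \<partial>std_normal_distribution)"
    using assms by (intro std_normal_product.product_nn_integral_prod) auto
  also have "\<dots> = ennreal ((1 / sqrt (1 - k)) ^ card T)"
    using assms by (simp only: nn_integral_std_normal_exp_square prod_constant) (simp add: ennreal_power)
  finally show ?thesis .
qed

lemma integral_normal_product_iexp:
  assumes "finite T"
  shows "(CLINT g|normal_product T. iexp (r * (\<Sum>t\<in>T. g t * y t)))
    = of_real (exp (- (r\<^sup>2 / 2 * (\<Sum>t\<in>T. (y t)\<^sup>2))))"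
proof -
  have "(CLINT g|normal_product T. iexp (r * (\<Sum>t\<in>T. g t * y t)))
      = (CLINT g|normal_product T. (\<Prod>t\<in>T. iexp ((r * y t) * g t)))"
    using assms by (simp add: exp_sum[symmetric] sum_distrib_left mult_ac)
  also have "\<dots> = (\<Prod>t\<in>T. CLINT x|std_normal_distribution. iexp ((r * y t) * x))"
    using assms by (intro std_normal_product.product_integral_prod std_normal.integrable_iexp) auto
  also have "\<dots> = (\<Prod>t\<in>T. of_real (exp (- (r * y t)\<^sup>2 / 2)))"
    by (intro prod.cong refl) (simp only: char_def[symmetric] char_std_normal_distribution)
  also have "\<dots> = of_real (exp (- (r\<^sup>2 / 2 * (\<Sum>t\<in>T. (y t)\<^sup>2))))"
    using assms
    by (subst of_real_prod[symmetric])
      (simp add: exp_sum[symmetric] sum_distrib_left power_mult_distrib mult_ac sum_negf)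
  finally show ?thesis .
qed

lemma bilin_cmult: "bilin I R (\<lambda>i. c * a i) (\<lambda>i. c * a i) = c\<^sup>2 * bilin I R a a"
  unfolding bilin_def sum_distrib_left by (simp add: power2_eq_square mult_ac)

text \<open>The purpose of the orthogonal map: a difference of two quadratic forms turns into a
  bilinear form, which for fixed g is linear in h and can be integrated explicitly.\<close>

lemma bilin_polar:
  assumes "\<And>i j. i \<in> I \<Longrightarrow> j \<in> I \<Longrightarrow> R i j = R j i"
  shows "bilin I R (\<lambda>i. (g i + h i) / sqrt 2) (\<lambda>i. (g i + h i) / sqrt 2)
       - bilin I R (\<lambda>i. (g i - h i) / sqrt 2) (\<lambda>i. (g i - h i) / sqrt 2) = 2 * bilin I R g h"
proof -
  have "bilin I R (\<lambda>i. (g i + h i) / sqrt 2) (\<lambda>i. (g i + h i) / sqrt 2)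
       - bilin I R (\<lambda>i. (g i - h i) / sqrt 2) (\<lambda>i. (g i - h i) / sqrt 2)
     = (\<Sum>i\<in>I. \<Sum>j\<in>I. g i * h j * R i j + h i * g j * R i j)"
    unfolding bilin_def sum_subtractf[symmetric]
    by (intro sum.cong refl) (simp add: field_simps)
  also have "\<dots> = bilin I R g h + bilin I R h g"
    by (simp add: bilin_def sum.distrib)
  also have "bilin I R h g = bilin I R g h"
    unfolding bilin_def
    by (subst sum.swap) (intro sum.cong refl, simp add: assms mult_ac)
  finally show ?thesis by simp
qed

lemma bilin_sum_right: "bilin I R g h = (\<Sum>j\<in>I. h j * (\<Sum>i\<in>I. R i j * g i))"
  unfolding bilin_def by (subst sum.swap) (simp add: sum_distrib_left mult_ac)

text \<open>Cauchy-Schwarz after splitting the weight as sgn(w) sqrt |w| times sqrt |w|.\<close>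

lemma weighted_sum_squared_le:
  fixes w g :: "'i \<Rightarrow> real"
  assumes "finite I"
  shows "(\<Sum>i\<in>I. w i * g i)\<^sup>2 \<le> (\<Sum>i\<in>I. \<bar>w i\<bar>) * (\<Sum>i\<in>I. \<bar>w i\<bar> * (g i)\<^sup>2)"
proof -
  have "(\<Sum>i\<in>I. w i * g i)\<^sup>2 = (\<Sum>i\<in>I. (sgn (w i) * sqrt \<bar>w i\<bar>) * (sqrt \<bar>w i\<bar> * g i))\<^sup>2"
    by (simp add: mult.assoc[symmetric]) (simp add: mult.assoc sgn_mult_abs)
  also have "\<dots> \<le> (\<Sum>i\<in>I. (sgn (w i) * sqrt \<bar>w i\<bar>)\<^sup>2) * (\<Sum>i\<in>I. (sqrt \<bar>w i\<bar> * g i)\<^sup>2)"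
    by (rule Cauchy_Schwarz_ineq_sum)
  also have "\<dots> = (\<Sum>i\<in>I. \<bar>w i\<bar>) * (\<Sum>i\<in>I. \<bar>w i\<bar> * (g i)\<^sup>2)"
    by (intro arg_cong2[where f="(*)"] sum.cong refl) (auto simp: power_mult_distrib sgn_real_def)
  finally show ?thesis .
qed

text \<open>The Schur test: the largest absolute row sum K bounds the operator norm. Symmetry turns
  the row bound into the column bound, and each of them contributes one factor K.\<close>

lemma sum_matrix_vector_squared_le:
  fixes R :: "'i \<Rightarrow> 'i \<Rightarrow> real"
  assumes fin: "finite I" and sym: "\<And>i j. i \<in> I \<Longrightarrow> j \<in> I \<Longrightarrow> R i j = R j i"
    and row: "\<And>i. i \<in> I \<Longrightarrow> (\<Sum>j\<in>I. \<bar>R i j\<bar>) \<le> K"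
  shows "(\<Sum>j\<in>I. (\<Sum>i\<in>I. R i j * g i)\<^sup>2) \<le> K\<^sup>2 * (\<Sum>i\<in>I. (g i)\<^sup>2)"
proof (cases "I = {}")
  case False
  then obtain i where "i \<in> I" by auto
  then have K: "0 \<le> K" using row[of i] sum_nonneg[of I "\<lambda>j. \<bar>R i j\<bar>"] by (meson abs_ge_zero order_trans)
  have col: "(\<Sum>i\<in>I. \<bar>R i j\<bar>) \<le> K" if "j \<in> I" for j
    using row[OF that] sym[OF that] by (simp cong: sum.cong)
  have "(\<Sum>j\<in>I. (\<Sum>i\<in>I. R i j * g i)\<^sup>2) \<le> (\<Sum>j\<in>I. K * (\<Sum>i\<in>I. \<bar>R i j\<bar> * (g i)\<^sup>2))"
    by (intro sum_mono order_trans[OF weighted_sum_squared_le[OF fin]] mult_right_mono col sum_nonneg) auto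
  also have "\<dots> = K * (\<Sum>i\<in>I. (\<Sum>j\<in>I. \<bar>R i j\<bar>) * (g i)\<^sup>2)"
    unfolding sum_distrib_left[symmetric] by (subst sum.swap) (simp add: sum_distrib_right)
  also have "\<dots> \<le> K * (\<Sum>i\<in>I. K * (g i)\<^sup>2)"
    by (intro mult_left_mono sum_mono mult_right_mono row K) auto
  also have "\<dots> = K\<^sup>2 * (\<Sum>i\<in>I. (g i)\<^sup>2)"
    by (simp add: sum_distrib_left power2_eq_square mult_ac)
  finally show ?thesis .
qed simp

text \<open>For k at most 1/2 one has 1 \<le> (1 - k) (1 + 2 k) \<le> (1 - k) exp(2 k); take square
  roots.\<close>

lemma inverse_sqrt_le_exp:
  assumes "0 \<le> k" "k \<le> 1 / 2"
  shows "1 / sqrt (1 - k) \<le> exp (k :: real)"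
proof -
  have "1 \<le> (1 - k) * (1 + 2 * k)"
  proof -
    have "k * (2 * k) \<le> k * 1" using assms by (intro mult_left_mono) auto
    then show ?thesis by (simp add: algebra_simps)
  qed
  also have "\<dots> \<le> (1 - k) * exp (2 * k)"
    using assms by (intro mult_left_mono exp_ge_add_one_self) auto
  finally have "1 \<le> sqrt ((1 - k) * exp (2 * k))" by simp
  also have "\<dots> = sqrt (1 - k) * exp k"
    by (simp add: real_sqrt_mult exp_double)
  finally show ?thesis using assms by (simp add: field_simps)
qed

lemma ennreal_integral_le_nn_integral:
  assumes "integrable M f"
  shows "ennreal (\<integral>x. f x \<partial>M) \<le> (\<integral>\<^sup>+x. ennreal (f x) \<partial>M)"
proof -
  have "(\<integral>x. f x \<partial>M) \<le> (\<integral>x. max 0 (f x) \<partial>M)"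
    by (intro integral_mono integrable_max assms) auto
  then have "ennreal (\<integral>x. f x \<partial>M) \<le> ennreal (\<integral>x. max 0 (f x) \<partial>M)"
    by (rule ennreal_leI)
  also have "\<dots> = (\<integral>\<^sup>+x. ennreal (max 0 (f x)) \<partial>M)"
    using assms by (intro nn_integral_eq_integral[symmetric] integrable_max) auto
  also have "\<dots> = (\<integral>\<^sup>+x. ennreal (f x) \<partial>M)" 
    by (intro nn_integral_cong) (auto simp: max_def ennreal_neg)
  finally show ?thesis .
qed

text \<open>Jensen's inequality by the tangent of exp at the mean. With a nonnegative integral on
  the right, an infinite exponential moment needs no special treatment.\<close>

lemma (in prob_space) exp_mean_le_nn_integral_exp:
  assumes "integrable M f"
  shows "ennreal (exp (c * (\<integral>x. f x \<partial>M))) \<le> (\<integral>\<^sup>+x. ennreal (exp (c * f x)) \<partial>M)"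
proof -
  define m where "m = (\<integral>x. f x \<partial>M)"
  have "(\<integral>x. exp (c * m) * (1 + c * (f x - m)) \<partial>M) = exp (c * m)"
    using assms by (simp add: m_def prob_space)
  then have "ennreal (exp (c * m)) = ennreal (\<integral>x. exp (c * m) * (1 + c * (f x - m)) \<partial>M)"
    by simp
  also have "\<dots> \<le> (\<integral>\<^sup>+x. ennreal (exp (c * m) * (1 + c * (f x - m))) \<partial>M)"
    using assms by (intro ennreal_integral_le_nn_integral) auto
  also have "\<dots> \<le> (\<integral>\<^sup>+x. ennreal (exp (c * f x)) \<partial>M)"
  proof (intro nn_integral_mono ennreal_leI)
    fix x
    have "exp (c * m) * (1 + c * (f x - m)) \<le> exp (c * m) * exp (c * (f x - m))"
      by (intro mult_left_mono exp_ge_add_one_self) auto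
    also have "\<dots> = exp (c * f x)" by (simp add: exp_add[symmetric] algebra_simps)
    finally show "exp (c * m) * (1 + c * (f x - m)) \<le> exp (c * f x)" .
  qed
  finally show ?thesis unfolding m_def .
qed

text \<open>The square in the exponent is linearised by an independent standard normal vector, then the
  order of integration is exchanged.\<close>

lemma normal_family_nn_exp_square:
  assumes Y: "normal_family M I R Y" and s: "0 \<le> s"
  shows "(\<integral>\<^sup>+\<omega>. ennreal (exp (s * (\<Sum>i\<in>I. (Y i \<omega>)\<^sup>2))) \<partial>M)
    = (\<integral>\<^sup>+g. ennreal (exp (s * bilin I R g g)) \<partial>normal_product I)"
proof -
  have fin: "finite I" and [measurable]: "\<And>i. i \<in> I \<Longrightarrow> Y i \<in> borel_measurable M"
    using Y by (auto simp: normal_family_def)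
  interpret M: prob_space M using Y by (simp add: normal_family_def)
  interpret N: prob_space "normal_product I" by (rule prob_space_normal_product)
  interpret pair_sigma_finite M "normal_product I" ..
  define r where "r = sqrt (2 * s)"
  have r: "r\<^sup>2 = 2 * s" using s by (simp add: r_def)
  have "(\<integral>\<^sup>+\<omega>. ennreal (exp (s * (\<Sum>i\<in>I. (Y i \<omega>)\<^sup>2))) \<partial>M)
      = (\<integral>\<^sup>+\<omega>. \<integral>\<^sup>+g. ennreal (exp (r * (\<Sum>i\<in>I. g i * Y i \<omega>))) \<partial>normal_product I \<partial>M)"
    by (simp add: nn_integral_normal_product_exp[OF fin] r)
  also have "\<dots> = (\<integral>\<^sup>+g. \<integral>\<^sup>+\<omega>. ennreal (exp (r * (\<Sum>i\<in>I. g i * Y i \<omega>))) \<partial>M \<partial>normal_product I)"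
    by (rule Fubini'[symmetric]) measurable
  also have "\<dots> = (\<integral>\<^sup>+g. ennreal (exp (s * bilin I R g g)) \<partial>normal_product I)"
  proof (rule nn_integral_cong)
    fix g
    have "centered_normal M (\<lambda>\<omega>. \<Sum>i\<in>I. g i * Y i \<omega>) (bilin I R g g)"
      using Y by (simp add: normal_family_def)
    from centered_normal_nn_exp[OF this, of r]
    show "(\<integral>\<^sup>+\<omega>. ennreal (exp (r * (\<Sum>i\<in>I. g i * Y i \<omega>))) \<partial>M) = ennreal (exp (s * bilin I R g g))"
      by (simp add: r)
  qed
  finally show ?thesis .
qed

lemma bilin_normal_family_nonneg:
  assumes "normal_family M I R Y"
  shows "0 \<le> bilin I R a a"
  using assms centered_normal_nonneg unfolding normal_family_def by blast

text \<open>The negative sign is obtained with an imaginary linear exponent: exp(-s y^2) is a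
  characteristic function of the auxiliary normal vector. The integrand then has modulus 1, so
  Fubini for complex integrals applies at once.\<close>

lemma normal_family_nn_exp_minus_square:
  assumes Y: "normal_family M I R Y" and s: "0 \<le> s"
  shows "(\<integral>\<^sup>+\<omega>. ennreal (exp (- s * (\<Sum>i\<in>I. (Y i \<omega>)\<^sup>2))) \<partial>M)
    = (\<integral>\<^sup>+g. ennreal (exp (- s * bilin I R g g)) \<partial>normal_product I)"
proof -
  have fin: "finite I" and [measurable]: "\<And>i. i \<in> I \<Longrightarrow> Y i \<in> borel_measurable M"
    using Y by (auto simp: normal_family_def)
  interpret M: prob_space M using Y by (simp add: normal_family_def)
  interpret N: prob_space "normal_product I" by (rule prob_space_normal_product)
  interpret pair_sigma_finite M "normal_product I" ..
  interpret P: pair_prob_space M "normal_product I" ..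
  define r where "r = sqrt (2 * s)"
  have r: "r\<^sup>2 = 2 * s" using s by (simp add: r_def)
  have bm [measurable]: "(\<lambda>g. bilin I R g g) \<in> borel_measurable (normal_product I)"
    unfolding bilin_def by measurable
  have i1: "integrable M (\<lambda>\<omega>. exp (- s * (\<Sum>i\<in>I. (Y i \<omega>)\<^sup>2)))"
    by (rule M.integrable_const_bound[where B=1]) (use s in \<open>auto intro!: sum_nonneg mult_nonneg_nonneg\<close>)
  have i2: "integrable (normal_product I) (\<lambda>g. exp (- s * bilin I R g g))"
    by (rule N.integrable_const_bound[where B=1])
      (use s bilin_normal_family_nonneg[OF Y] in \<open>auto intro!: mult_nonneg_nonneg\<close>)
  have "complex_of_real (\<integral>\<omega>. exp (- s * (\<Sum>i\<in>I. (Y i \<omega>)\<^sup>2)) \<partial>M)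
      = (CLINT \<omega>|M. CLINT g|normal_product I. iexp (r * (\<Sum>i\<in>I. g i * Y i \<omega>)))"
    by (simp add: integral_normal_product_iexp[OF fin] r del: of_real_mult of_real_sum)
  also have "\<dots> = (CLINT g|normal_product I. CLINT \<omega>|M. iexp (r * (\<Sum>i\<in>I. g i * Y i \<omega>)))"
  proof (rule Fubini_integral[symmetric])
    show "integrable (M \<Otimes>\<^sub>M normal_product I) (\<lambda>(\<omega>, g). iexp (r * (\<Sum>i\<in>I. g i * Y i \<omega>)))"
      unfolding split_beta' by (rule P.integrable_iexp) measurable
  qed
  also have "\<dots> = (CLINT g|normal_product I. of_real (exp (- s * bilin I R g g)))"
  proof (rule Bochner_Integration.integral_cong[OF refl])
    fix g
    have "centered_normal M (\<lambda>\<omega>. \<Sum>i\<in>I. g i * Y i \<omega>) (bilin I R g g)"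
      using Y by (simp add: normal_family_def)
    from centered_normal_char[OF this, of r]
    show "(CLINT \<omega>|M. iexp (r * (\<Sum>i\<in>I. g i * Y i \<omega>))) = of_real (exp (- s * bilin I R g g))"
      by (simp add: r del: of_real_mult of_real_sum)
  qed
  also have "\<dots> = of_real (\<integral>g. exp (- s * bilin I R g g) \<partial>normal_product I)"
    by (rule integral_complex_of_real)
  finally have "(\<integral>\<omega>. exp (- s * (\<Sum>i\<in>I. (Y i \<omega>)\<^sup>2)) \<partial>M) = (\<integral>g. exp (- s * bilin I R g g) \<partial>normal_product I)"
    using of_real_eq_iff by blast
  then show ?thesis
    using i1 i2 by (simp add: nn_integral_eq_integral)
qed

text \<open>Both moments become integrals over independent standard normal vectors g and h with
  exponent s (R(g,g) - R(h,h)). After the orthogonal change of variables the exponent is 2 s R(g,h);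
  integrating out h leaves exp(2 s^2 |R g|^2). The Schur test bounds this by exp(k |g|^2 / 2) with k
  = 4 s^2 K^2, whose integral is a product of one-dimensional ones. The trace of R, which would
  appear in either moment alone, cancels.\<close>

lemma normal_family_exp_product_le:
  assumes Y: "normal_family M I R Y" and s: "0 \<le> s"
    and row: "\<And>i. i \<in> I \<Longrightarrow> (\<Sum>j\<in>I. \<bar>R i j\<bar>) \<le> K" and sK: "4 * s\<^sup>2 * K\<^sup>2 \<le> 1 / 2"
  shows "(\<integral>\<^sup>+\<omega>. ennreal (exp (s * (\<Sum>i\<in>I. (Y i \<omega>)\<^sup>2))) \<partial>M) *
    (\<integral>\<^sup>+\<omega>. ennreal (exp (- s * (\<Sum>i\<in>I. (Y i \<omega>)\<^sup>2))) \<partial>M) \<le> ennreal (exp (4 * s\<^sup>2 * K\<^sup>2 * card I))"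
proof -
  have fin: "finite I" using Y by (simp add: normal_family_def)
  have sym: "\<And>i j. i \<in> I \<Longrightarrow> j \<in> I \<Longrightarrow> R i j = R j i" using Y unfolding normal_family_def by blast
  have [measurable]: "(\<lambda>g. bilin I R g g) \<in> borel_measurable (normal_product I)"
    unfolding bilin_def by measurable
  let ?N = "normal_product I"
  define F where "F g h = ennreal (exp (s * bilin I R g g)) * ennreal (exp (- s * bilin I R h h))" for g h
  have "(\<integral>\<^sup>+\<omega>. ennreal (exp (s * (\<Sum>i\<in>I. (Y i \<omega>)\<^sup>2))) \<partial>M) * (\<integral>\<^sup>+\<omega>. ennreal (exp (- s * (\<Sum>i\<in>I. (Y i \<omega>)\<^sup>2))) \<partial>M)
      = (\<integral>\<^sup>+g. \<integral>\<^sup>+h. F g h \<partial>?N \<partial>?N)"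
    unfolding normal_family_nn_exp_square[OF Y s] normal_family_nn_exp_minus_square[OF Y s] F_def
    by (simp add: nn_integral_cmult nn_integral_multc)
  also have "\<dots> = (\<integral>\<^sup>+g. \<integral>\<^sup>+h. F (\<lambda>i\<in>I. (g i + h i) / sqrt 2) (\<lambda>i\<in>I. (g i - h i) / sqrt 2) \<partial>?N \<partial>?N)"
    by (rule nn_integral_normal_product_rotate[OF fin, symmetric]) (unfold F_def bilin_def, measurable)
  also have "\<dots> = (\<integral>\<^sup>+g. \<integral>\<^sup>+h. ennreal (exp (2 * s * (\<Sum>j\<in>I. h j * (\<Sum>i\<in>I. R i j * g i)))) \<partial>?N \<partial>?N)"
  proof -
    have restr: "bilin I R (restrict a I) (restrict a I) = bilin I R a a" for a
      unfolding bilin_def by (intro sum.cong) auto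
    have e: "s * bilin I R (\<lambda>i. (g i + h i) / sqrt 2) (\<lambda>i. (g i + h i) / sqrt 2)
        + - s * bilin I R (\<lambda>i. (g i - h i) / sqrt 2) (\<lambda>i. (g i - h i) / sqrt 2)
        = 2 * s * (\<Sum>j\<in>I. h j * (\<Sum>i\<in>I. R i j * g i))" for g h
    proof -
      have "s * (bilin I R (\<lambda>i. (g i + h i) / sqrt 2) (\<lambda>i. (g i + h i) / sqrt 2)
        - bilin I R (\<lambda>i. (g i - h i) / sqrt 2) (\<lambda>i. (g i - h i) / sqrt 2)) = s * (2 * bilin I R g h)"
        using bilin_polar[of I R g h, OF sym] by simp
      then show ?thesis unfolding bilin_sum_right[of I R g h] by (simp add: algebra_simps)
    qed
    show ?thesis
      unfolding F_def restr ennreal_mult'[symmetric, OF exp_ge_zero] exp_add[symmetric] e ..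
  qed
  also have "\<dots> = (\<integral>\<^sup>+g. ennreal (exp ((2 * s)\<^sup>2 / 2 * (\<Sum>j\<in>I. (\<Sum>i\<in>I. R i j * g i)\<^sup>2))) \<partial>?N)"
    by (simp only: nn_integral_normal_product_exp[OF fin])
  also have "\<dots> \<le> (\<integral>\<^sup>+g. ennreal (exp ((4 * s\<^sup>2 * K\<^sup>2) / 2 * (\<Sum>i\<in>I. (g i)\<^sup>2))) \<partial>?N)"
  proof (intro nn_integral_mono ennreal_leI)
    fix g
    have "2 * s\<^sup>2 * (\<Sum>j\<in>I. (\<Sum>i\<in>I. R i j * g i)\<^sup>2) \<le> 2 * s\<^sup>2 * (K\<^sup>2 * (\<Sum>i\<in>I. (g i)\<^sup>2))"
      by (intro mult_left_mono sum_matrix_vector_squared_le fin sym row) auto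
    then show "exp ((2 * s)\<^sup>2 / 2 * (\<Sum>j\<in>I. (\<Sum>i\<in>I. R i j * g i)\<^sup>2)) \<le> exp ((4 * s\<^sup>2 * K\<^sup>2) / 2 * (\<Sum>i\<in>I. (g i)\<^sup>2))"
      by (simp add: power_mult_distrib mult_ac)
  qed
  also have "\<dots> = ennreal ((1 / sqrt (1 - 4 * s\<^sup>2 * K\<^sup>2)) ^ card I)"
    using sK by (intro nn_integral_normal_product_exp_square fin) simp
  also have "\<dots> \<le> ennreal (exp (4 * s\<^sup>2 * K\<^sup>2) ^ card I)"
    using sK by (intro ennreal_leI power_mono inverse_sqrt_le_exp) auto
  also have "exp (4 * s\<^sup>2 * K\<^sup>2) ^ card I = exp (4 * s\<^sup>2 * K\<^sup>2 * card I)"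
    by (simp add: exp_of_nat_mult[symmetric] mult_ac)
  finally show ?thesis .
qed

lemma (in prob_space) chernoff_nn:
  assumes [measurable]: "f \<in> borel_measurable M" and s: "0 < s"
  shows "emeasure M {\<omega> \<in> space M. x \<le> f \<omega>} \<le> ennreal (exp (- s * x)) * (\<integral>\<^sup>+\<omega>. ennreal (exp (s * f \<omega>)) \<partial>M)"
proof -
  have "emeasure M {\<omega> \<in> space M. x \<le> f \<omega>} = (\<integral>\<^sup>+\<omega>. indicator {\<omega> \<in> space M. x \<le> f \<omega>} \<omega> \<partial>M)"
    by simp
  also have "\<dots> \<le> (\<integral>\<^sup>+\<omega>. ennreal (exp (- s * x)) * ennreal (exp (s * f \<omega>)) \<partial>M)"
    using s by (intro nn_integral_mono) (auto simp: ennreal_mult[symmetric] exp_add[symmetric] split: split_indicator)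
  also have "\<dots> = ennreal (exp (- s * x)) * (\<integral>\<^sup>+\<omega>. ennreal (exp (s * f \<omega>)) \<partial>M)"
    by (rule nn_integral_cmult) auto
  finally show ?thesis .
qed

lemma bilin_unit:
  assumes "finite I" "i \<in> I" "j \<in> I"
  shows "bilin I R (\<lambda>k. if k = i then 1 else 0) (\<lambda>k. if k = j then 1 else 0) = R i j"
proof -
  have "(\<Sum>l\<in>I. (if k = i then 1 else 0) * (if l = j then 1 else 0) * R k l) = (if k = i then R k j else 0)" for k
  proof (cases "k = i")
    case True
    have "(\<Sum>l\<in>I. (if l = j then 1 else 0) * R k l) = (\<Sum>l\<in>I. if l = j then R k l else 0)"
      by (intro sum.cong) auto
    with True assms show ?thesis by simp
  qed simp
  then show ?thesis using assms by (simp add: bilin_def)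
qed

lemma normal_family_component:
  assumes Y: "normal_family M I R Y" and i: "i \<in> I"
  shows "centered_normal M (Y i) (R i i)"
proof -
  have fin: "finite I" using Y by (simp add: normal_family_def)
  have "centered_normal M (\<lambda>\<omega>. \<Sum>j\<in>I. (if j = i then 1 else 0) * Y j \<omega>)
      (bilin I R (\<lambda>j. if j = i then 1 else 0) (\<lambda>j. if j = i then 1 else 0))"
    by (rule normal_family_combination[OF Y])
  also have "(\<lambda>\<omega>. \<Sum>j\<in>I. (if j = i then 1 else 0) * Y j \<omega>) = Y i"
  proof
    fix \<omega>
    have "(\<Sum>j\<in>I. (if j = i then 1 else 0) * Y j \<omega>) = (\<Sum>j\<in>I. if j = i then Y j \<omega> else 0)"
      by (intro sum.cong) auto
    then show "(\<Sum>j\<in>I. (if j = i then 1 else 0) * Y j \<omega>) = Y i \<omega>" using fin i by simp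
  qed
  finally show ?thesis using bilin_unit[OF fin i i, of R] by simp
qed

text \<open>A form of the Hanson--Wright inequality. Jensen's inequality bounds the centring factor by the
  exponential moment of opposite sign, and the product of the two moments was bounded by rotating a
  pair of independent normal vectors, so that \<open>R\<close> need not be diagonalised.\<close>

lemma normal_family_square_concentration:
  fixes Y :: "'i \<Rightarrow> 'a \<Rightarrow> real" and R :: "'i \<Rightarrow> 'i \<Rightarrow> real" and K z :: real
  assumes Y: "normal_family M I R Y" and K: "0 < K"
    and row: "\<And>i. i \<in> I \<Longrightarrow> (\<Sum>j\<in>I. \<bar>R i j\<bar>) \<le> K" and z: "0 < z" "z \<le> 1"
  shows "measure M {\<omega> \<in> space M. card I * K * z \<le> \<bar>(\<Sum>i\<in>I. (Y i \<omega>)\<^sup>2) - (\<Sum>i\<in>I. R i i)\<bar>}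
    \<le> 2 * exp (- (card I * z\<^sup>2 / 16))"
proof -
  have fin: "finite I" and Ym [measurable]: "\<And>i. i \<in> I \<Longrightarrow> Y i \<in> borel_measurable M"
    using Y by (auto simp: normal_family_def)
  interpret prob_space M using Y by (simp add: normal_family_def)
  define Q where "Q \<omega> = (\<Sum>i\<in>I. (Y i \<omega>)\<^sup>2)" for \<omega>
  have [measurable]: "Q \<in> borel_measurable M" unfolding Q_def by measurable
  note comp = normal_family_component[OF Y]
  have Qi: "integrable M Q"
    unfolding Q_def by (intro Bochner_Integration.integrable_sum centered_normal_square(1)[OF comp])
  define m where "m = (\<Sum>i\<in>I. R i i)"
  have Qm: "(\<integral>\<omega>. Q \<omega> \<partial>M) = m"
    unfolding Q_def m_def
    by (subst Bochner_Integration.integral_sum) (auto intro!: sum.cong centered_normal_square[OF comp])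
  \<comment> \<open>With this s the product of the two moments is at most exp(card I * z^2 / 16),
    while the Chernoff factor contributes exp(- card I * z^2 / 8); half of the exponent survives.
    Since z \<le> 1, also 4 s^2 K^2 = z^2 / 16 \<le> 1/2.\<close>
  define s where "s = z / (8 * K)"
  have s: "0 < s" using z K by (simp add: s_def)
  have sK: "s * K = z / 8" using K by (simp add: s_def)
  have sK2: "s\<^sup>2 * K\<^sup>2 = z\<^sup>2 / 64"
    unfolding power_mult_distrib[symmetric] sK by (simp add: power_divide)
  have z2: "z\<^sup>2 \<le> 1" using z by (simp add: power_le_one)
  define A where "A = (\<integral>\<^sup>+\<omega>. ennreal (exp (s * Q \<omega>)) \<partial>M)"
  define B where "B = (\<integral>\<^sup>+\<omega>. ennreal (exp (- s * Q \<omega>)) \<partial>M)"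
  have AB: "A * B \<le> ennreal (exp (card I * z\<^sup>2 / 16))"
  proof -
    have "A * B \<le> ennreal (exp (4 * s\<^sup>2 * K\<^sup>2 * card I))"
      unfolding A_def B_def Q_def
      by (rule normal_family_exp_product_le[OF Y _ row]) (use s sK2 z2 in auto)
    also have "4 * s\<^sup>2 * K\<^sup>2 * card I = card I * z\<^sup>2 / 16"
      using sK2 by (simp add: mult.assoc)
    finally show ?thesis .
  qed
  define x where "x = card I * K * z"
  have sx: "s * x = card I * z\<^sup>2 / 8"
  proof -
    have "s * x = card I * (s * K) * z" by (simp add: x_def mult_ac)
    then show ?thesis by (simp add: sK power2_eq_square)
  qed
  have fin_e: "ennreal (exp (- s * x)) * ennreal (exp (card I * z\<^sup>2 / 16)) = ennreal (exp (- (card I * z\<^sup>2 / 16)))"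
    by (simp add: ennreal_mult[symmetric] exp_add[symmetric] sx)
  have up: "emeasure M {\<omega> \<in> space M. x \<le> Q \<omega> - m} \<le> ennreal (exp (- (card I * z\<^sup>2 / 16)))"
  proof -
    have "emeasure M {\<omega> \<in> space M. x \<le> Q \<omega> - m} = emeasure M {\<omega> \<in> space M. x + m \<le> Q \<omega>}"
      by (rule arg_cong[where f="emeasure M"]) auto
    also have "\<dots> \<le> ennreal (exp (- s * (x + m))) * A"
      unfolding A_def by (rule chernoff_nn) (use s in auto)
    also have "\<dots> = ennreal (exp (- s * x)) * (A * ennreal (exp (- s * m)))"
      by (simp add: ennreal_mult[symmetric] exp_add[symmetric] mult_ac algebra_simps)
    also have "\<dots> \<le> ennreal (exp (- s * x)) * (A * B)"
      unfolding B_def Qm[symmetric] by (intro mult_left_mono exp_mean_le_nn_integral_exp Qi) auto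
    also have "\<dots> \<le> ennreal (exp (- s * x)) * ennreal (exp (card I * z\<^sup>2 / 16))"
      by (intro mult_left_mono AB) auto
    finally show ?thesis unfolding fin_e .
  qed
  have lo: "emeasure M {\<omega> \<in> space M. x \<le> m - Q \<omega>} \<le> ennreal (exp (- (card I * z\<^sup>2 / 16)))"
  proof -
    have "emeasure M {\<omega> \<in> space M. x \<le> m - Q \<omega>} = emeasure M {\<omega> \<in> space M. x - m \<le> - Q \<omega>}"
      by (rule arg_cong[where f="emeasure M"]) auto
    also have "\<dots> \<le> ennreal (exp (- s * (x - m))) * (\<integral>\<^sup>+\<omega>. ennreal (exp (s * - Q \<omega>)) \<partial>M)"
      by (rule chernoff_nn) (use s in auto)
    also have "\<dots> = ennreal (exp (- s * x)) * (ennreal (exp (s * m)) * B)"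
      unfolding B_def mult.assoc[symmetric]
      by (subst ennreal_mult[symmetric]) (auto simp: exp_add[symmetric] algebra_simps)
    also have "\<dots> \<le> ennreal (exp (- s * x)) * (A * B)"
      unfolding A_def Qm[symmetric] by (intro mult_left_mono mult_right_mono exp_mean_le_nn_integral_exp Qi) auto
    also have "\<dots> \<le> ennreal (exp (- s * x)) * ennreal (exp (card I * z\<^sup>2 / 16))"
      by (intro mult_left_mono AB) auto
    finally show ?thesis unfolding fin_e .
  qed
  have "measure M {\<omega> \<in> space M. x \<le> \<bar>Q \<omega> - m\<bar>}
      \<le> measure M ({\<omega> \<in> space M. x \<le> Q \<omega> - m} \<union> {\<omega> \<in> space M. x \<le> m - Q \<omega>})"
    by (intro finite_measure_mono) auto
  also have "\<dots> \<le> measure M {\<omega> \<in> space M. x \<le> Q \<omega> - m} + measure M {\<omega> \<in> space M. x \<le> m - Q \<omega>}"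
    by (rule measure_Un_le) auto
  also have "\<dots> \<le> exp (- (card I * z\<^sup>2 / 16)) + exp (- (card I * z\<^sup>2 / 16))"
    using up lo by (intro add_mono) (simp_all add: emeasure_eq_measure)
  finally show ?thesis unfolding x_def m_def Q_def by simp
qed

section \<open>Rescaling a normal family by a change of measure\<close>

lemma normal_density_char:
  assumes "0 < \<tau>"
  shows "(CLINT x|lborel. normal_density 0 \<tau> x *\<^sub>R iexp (\<alpha> * x)) = of_real (exp (- (\<alpha>\<^sup>2 * \<tau>\<^sup>2 / 2)))"
proof -
  have d: "\<tau> * normal_density 0 \<tau> (\<tau> * y) = std_normal_density y" for y
    using assms by (simp add: normal_density_def power_mult_distrib real_sqrt_mult)
  have "(CLINT x|lborel. normal_density 0 \<tau> x *\<^sub>R iexp (\<alpha> * x))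
      = \<bar>\<tau>\<bar> *\<^sub>R (CLINT y|lborel. normal_density 0 \<tau> (0 + \<tau> * y) *\<^sub>R iexp (\<alpha> * (0 + \<tau> * y)))"
    using assms by (intro lborel_integral_real_affine) simp
  also have "\<dots> = (CLINT y|lborel. (\<tau> * normal_density 0 \<tau> (\<tau> * y)) *\<^sub>R iexp (\<alpha> * \<tau> * y))"
    using assms by (simp add: mult.assoc flip: integral_scaleR_right)
  also have "\<dots> = (CLINT y|lborel. std_normal_density y *\<^sub>R iexp (\<alpha> * \<tau> * y))"
    unfolding d ..
  also have "\<dots> = char std_normal_distribution (\<alpha> * \<tau>)"
    unfolding char_def by (subst integral_density) auto
  finally show ?thesis
    by (simp add: char_std_normal_distribution power_mult_distrib)
qed

lemma std_normal_exp_square_char: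
  assumes "k < 1"
  shows "(CLINT x|std_normal_distribution. of_real (exp (k * x\<^sup>2 / 2)) * iexp (\<alpha> * x))
    = of_real (1 / sqrt (1 - k) * exp (- (\<alpha>\<^sup>2 / (2 * (1 - k)))))"
proof -
  have "(CLINT x|std_normal_distribution. of_real (exp (k * x\<^sup>2 / 2)) * iexp (\<alpha> * x))
      = (CLINT x|lborel. std_normal_density x *\<^sub>R (of_real (exp (k * x\<^sup>2 / 2)) * iexp (\<alpha> * x)))"
    by (subst integral_density) auto
  also have "\<dots> = (CLINT x|lborel. (1 / sqrt (1 - k)) *\<^sub>R (normal_density 0 (1 / sqrt (1 - k)) x *\<^sub>R iexp (\<alpha> * x)))"
  proof (rule Bochner_Integration.integral_cong[OF refl])
    fix x :: real
    have "std_normal_density x *\<^sub>R (complex_of_real (exp (k * x\<^sup>2 / 2)) * iexp (\<alpha> * x))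
        = (std_normal_density x * exp (k * x\<^sup>2 / 2)) *\<^sub>R iexp (\<alpha> * x)"
      by (simp add: scaleR_conv_of_real)
    then show "std_normal_density x *\<^sub>R (complex_of_real (exp (k * x\<^sup>2 / 2)) * iexp (\<alpha> * x))
        = (1 / sqrt (1 - k)) *\<^sub>R (normal_density 0 (1 / sqrt (1 - k)) x *\<^sub>R iexp (\<alpha> * x))"
      unfolding std_normal_density_exp_square[OF assms] by simp
  qed
  also have "\<dots> = (1 / sqrt (1 - k)) *\<^sub>R of_real (exp (- (\<alpha>\<^sup>2 * (1 / sqrt (1 - k))\<^sup>2 / 2)))"
    using assms by (subst integral_scaleR_right) (subst normal_density_char, auto)
  also have "\<alpha>\<^sup>2 * (1 / sqrt (1 - k))\<^sup>2 / 2 = \<alpha>\<^sup>2 / (2 * (1 - k))"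
    using assms by (simp add: power_divide)
  finally show ?thesis by (simp add: scaleR_conv_of_real)
qed

lemma integral_std_normal_exp:
  "integrable std_normal_distribution (\<lambda>x. exp (r * x))"
  "(\<integral>x. exp (r * x) \<partial>std_normal_distribution) = exp (r\<^sup>2 / 2)"
proof -
  show "integrable std_normal_distribution (\<lambda>x. exp (r * x))"
    by (rule integrableI_bounded) (auto simp: nn_integral_std_normal_exp)
  show "(\<integral>x. exp (r * x) \<partial>std_normal_distribution) = exp (r\<^sup>2 / 2)"
    by (subst integral_eq_nn_integral) (auto simp: nn_integral_std_normal_exp)
qed

section \<open>Rank-one enlargement of the covariance\<close>

definition matvec :: "'i set \<Rightarrow> ('i \<Rightarrow> 'i \<Rightarrow> real) \<Rightarrow> ('i \<Rightarrow> real) \<Rightarrow> 'i \<Rightarrow> real" where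
  "matvec I R z i = (\<Sum>j\<in>I. R i j * z j)"

lemma bilin_matvec: "bilin I R a b = (\<Sum>i\<in>I. a i * matvec I R b i)"
  unfolding bilin_def matvec_def by (simp add: sum_distrib_left mult_ac)

lemma bilin_sym:
  assumes "\<And>i j. i \<in> I \<Longrightarrow> j \<in> I \<Longrightarrow> R i j = R j i"
  shows "bilin I R a b = bilin I R b a"
  unfolding bilin_def
  by (subst sum.swap) (intro sum.cong refl, simp add: assms mult_ac)

lemma bilin_add: "bilin I R (\<lambda>i. a i + t * b i) (\<lambda>i. a i + t * b i)
    = bilin I R a a + t * bilin I R a b + t * bilin I R b a + t\<^sup>2 * bilin I R b b"
  unfolding bilin_def sum_distrib_left sum.distrib[symmetric]
  by (intro sum.cong refl) (simp add: algebra_simps power2_eq_square)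

lemma bilin_cong:
  "(\<And>i. i \<in> I \<Longrightarrow> a i = a' i) \<Longrightarrow> (\<And>i. i \<in> I \<Longrightarrow> b i = b' i) \<Longrightarrow>
    (\<And>i j. i \<in> I \<Longrightarrow> j \<in> I \<Longrightarrow> R i j = R' i j) \<Longrightarrow> bilin I R a b = bilin I R' a' b'"
  unfolding bilin_def by (intro sum.cong refl) simp

lemma bilin_rank_one_update:
  assumes "finite I"
  shows "bilin I (\<lambda>i j. R i j + b * (p i * q j)) a c = bilin I R a c + b * ((\<Sum>i\<in>I. a i * p i) * (\<Sum>j\<in>I. c j * q j))"
proof -
  have "bilin I (\<lambda>i j. R i j + b * (p i * q j)) a c
      = (\<Sum>i\<in>I. \<Sum>j\<in>I. a i * c j * R i j + b * ((a i * p i) * (c j * q j)))"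
    unfolding bilin_def by (intro sum.cong refl) (simp add: algebra_simps)
  also have "\<dots> = bilin I R a c + b * (\<Sum>i\<in>I. \<Sum>j\<in>I. (a i * p i) * (c j * q j))"
    unfolding bilin_def by (simp add: sum.distrib sum_distrib_left)
  finally show ?thesis by (simp add: sum_product)
qed

lemma normal_family_cong:
  assumes "normal_family M I R X" "\<And>i j. i \<in> I \<Longrightarrow> j \<in> I \<Longrightarrow> R i j = R' i j"
  shows "normal_family M I R' X"
proof -
  have "bilin I R a a = bilin I R' a a" for a by (intro bilin_cong assms) auto
  then show ?thesis using assms unfolding normal_family_def by simp
qed

text \<open>Let Z be the combination of X with coefficients z, a standard normal variable by
  hypothesis. The density sqrt(1 - k) exp(k Z^2 / 2) raises the variance of Z from 1 to 1 / (1 - k)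
  and leaves the part of X uncorrelated with Z alone. The covariance of X with Z is R z, so R gains
  the rank-one term with factor 1 / (1 - k) - 1 = k / (1 - k). Null sets of M remain null for
  Q.\<close>

lemma normal_family_tilt:
  fixes X :: "'i \<Rightarrow> 'a \<Rightarrow> real"
  assumes X: "normal_family M I R X" and z: "bilin I R z z = 1" and k: "0 \<le> k" "k < 1"
  shows "\<exists>Q. sets Q = sets M \<and> absolutely_continuous M Q \<and>
    normal_family Q I (\<lambda>i j. R i j + k / (1 - k) * (matvec I R z i * matvec I R z j)) X"
proof -
  have fin: "finite I" and Xm [measurable]: "\<And>i. i \<in> I \<Longrightarrow> X i \<in> borel_measurable M"
    using X by (auto simp: normal_family_def)
  have sym: "\<And>i j. i \<in> I \<Longrightarrow> j \<in> I \<Longrightarrow> R i j = R j i" using X unfolding normal_family_def by blast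
  interpret M: prob_space M using X by (simp add: normal_family_def)
  interpret pair_sigma_finite M std_normal_distribution ..
  define Z where "Z \<omega> = (\<Sum>i\<in>I. z i * X i \<omega>)" for \<omega>
  have [measurable]: "Z \<in> borel_measurable M" unfolding Z_def by measurable
  have Z: "centered_normal M Z 1"
    using normal_family_combination[OF X, of z] z unfolding Z_def by simp
  define q where "q \<omega> = sqrt (1 - k) * exp (k / 2 * (Z \<omega>)\<^sup>2)" for \<omega>
  have q0: "0 \<le> q \<omega>" for \<omega> using k by (simp add: q_def)
  have [measurable]: "q \<in> borel_measurable M" unfolding q_def by measurable
  define Q where "Q = density M (\<lambda>\<omega>. ennreal (q \<omega>))"
  have nnZ: "(\<integral>\<^sup>+\<omega>. ennreal (exp (k / 2 * (Z \<omega>)\<^sup>2)) \<partial>M) = ennreal (1 / sqrt (1 - k))"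
    using centered_normal_nn_integral[OF Z, of "\<lambda>x. ennreal (exp (k / 2 * x\<^sup>2))"]
      nn_integral_std_normal_exp_square[OF k(2)] by simp
  have Qp: "prob_space Q"
  proof
    have "emeasure Q (space Q) = (\<integral>\<^sup>+\<omega>. ennreal (sqrt (1 - k)) * ennreal (exp (k / 2 * (Z \<omega>)\<^sup>2)) \<partial>M)"
      unfolding Q_def using k by (simp add: emeasure_density q_def ennreal_mult cong: nn_integral_cong)
    also have "\<dots> = ennreal (sqrt (1 - k)) * ennreal (1 / sqrt (1 - k))"
      unfolding nnZ[symmetric] by (rule nn_integral_cmult) measurable
    also have "\<dots> = 1" using k by (simp add: ennreal_mult[symmetric])
    finally show "emeasure Q (space Q) = 1" .
  qed
  have sQ [measurable_cong]: "sets Q = sets M" unfolding Q_def by simp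
  let ?p = "matvec I R z"
  have comb: "centered_normal Q (\<lambda>\<omega>. \<Sum>i\<in>I. a i * X i \<omega>) (bilin I R a a + k / (1 - k) * (bilin I R a z)\<^sup>2)" for a
  proof (rule centered_normalI_char[OF Qp])
    define Y where "Y \<omega> = (\<Sum>i\<in>I. a i * X i \<omega>)" for \<omega>
    have [measurable]: "Y \<in> borel_measurable M" unfolding Y_def by measurable
    show "(\<lambda>\<omega>. \<Sum>i\<in>I. a i * X i \<omega>) \<in> borel_measurable Q" by measurable
    show "0 \<le> bilin I R a a + k / (1 - k) * (bilin I R a z)\<^sup>2"
      using bilin_normal_family_nonneg[OF X] k by (intro add_nonneg_nonneg mult_nonneg_nonneg) auto
    fix t
    define v where "v = bilin I R a a"
    define c where "c = bilin I R a z"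
    have YZ: "centered_normal M (\<lambda>\<omega>. t * Y \<omega> + u * Z \<omega>) (t\<^sup>2 * v + 2 * u * (t * c) + u\<^sup>2 * 1)" for u
    proof -
      have "centered_normal M (\<lambda>\<omega>. \<Sum>i\<in>I. (t * a i + u * z i) * X i \<omega>)
          (bilin I R (\<lambda>i. t * a i + u * z i) (\<lambda>i. t * a i + u * z i))"
        by (rule normal_family_combination[OF X])
      also have "(\<lambda>\<omega>. \<Sum>i\<in>I. (t * a i + u * z i) * X i \<omega>) = (\<lambda>\<omega>. t * Y \<omega> + u * Z \<omega>)"
        unfolding Y_def Z_def fun_eq_iff sum_distrib_left sum.distrib[symmetric]
        by (intro allI sum.cong refl) (simp add: algebra_simps)
      also have "bilin I R (\<lambda>i. t * a i + u * z i) (\<lambda>i. t * a i + u * z i) = t\<^sup>2 * v + 2 * u * (t * c) + u\<^sup>2 * 1"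
      proof -
        have "bilin I R (\<lambda>i. t * a i) z = t * c"
          unfolding c_def by (simp add: bilin_def sum_distrib_left mult_ac)
        moreover have "bilin I R z (\<lambda>i. t * a i) = bilin I R (\<lambda>i. t * a i) z"
          by (rule bilin_sym[OF sym])
        ultimately show ?thesis
          unfolding bilin_add bilin_cmult z v_def by (simp add: algebra_simps)
      qed
      finally show ?thesis .
    qed
    have mixed: "(CLINT \<omega>|M. iexp (t * Y \<omega>) * exp (of_real (r * Z \<omega>)))
        = exp (of_real (- (t\<^sup>2 * v) / 2 + r\<^sup>2 * 1 / 2) + \<i> * of_real (r * (t * c)))" for r
      by (rule joint_normal_mixed_exp[OF M.prob_space_axioms YZ Z])
    have sk: "(sqrt k)\<^sup>2 = k" using k by simp
    have "(CLINT \<omega>|Q. iexp (t * Y \<omega>)) = (CLINT \<omega>|M. q \<omega> *\<^sub>R iexp (t * Y \<omega>))"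
      unfolding Q_def using q0 by (intro integral_density) auto
    \<comment> \<open>The squared exponent is an average of exp(sqrt k * g * Z) over an independent
      standard normal g. After Fubini, \<open>mixed\<close> applies with r = sqrt k * g, and only a
      one-dimensional Gaussian integral in g remains.\<close>
    also have "\<dots> = (CLINT \<omega>|M. sqrt (1 - k) *\<^sub>R (CLINT g|std_normal_distribution. iexp (t * Y \<omega>) * exp (of_real (sqrt k * g * Z \<omega>))))"
    proof (rule Bochner_Integration.integral_cong[OF refl])
      fix \<omega>
      have "(CLINT g|std_normal_distribution. iexp (t * Y \<omega>) * exp (of_real (sqrt k * g * Z \<omega>)))
          = (CLINT g|std_normal_distribution. iexp (t * Y \<omega>) * of_real (exp (sqrt k * Z \<omega> * g)))"
        by (simp add: exp_of_real[symmetric] mult_ac)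
      also have "\<dots> = iexp (t * Y \<omega>) * of_real (\<integral>g. exp (sqrt k * Z \<omega> * g) \<partial>std_normal_distribution)"
        by (subst integral_mult_right_zero, subst integral_complex_of_real, rule refl)
      also have "\<dots> = iexp (t * Y \<omega>) * of_real (exp (k / 2 * (Z \<omega>)\<^sup>2))"
        unfolding integral_std_normal_exp(2) by (simp add: power_mult_distrib sk)
      finally show "q \<omega> *\<^sub>R iexp (t * Y \<omega>)
          = sqrt (1 - k) *\<^sub>R (CLINT g|std_normal_distribution. iexp (t * Y \<omega>) * exp (of_real (sqrt k * g * Z \<omega>)))"
        by (simp add: q_def scaleR_conv_of_real mult_ac)
    qed
    also have "\<dots> = sqrt (1 - k) *\<^sub>R (CLINT \<omega>|M. CLINT g|std_normal_distribution. iexp (t * Y \<omega>) * exp (of_real (sqrt k * g * Z \<omega>)))"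
      by (rule integral_scaleR_right)
    also have "(CLINT \<omega>|M. CLINT g|std_normal_distribution. iexp (t * Y \<omega>) * exp (of_real (sqrt k * g * Z \<omega>)))
        = (CLINT g|std_normal_distribution. CLINT \<omega>|M. iexp (t * Y \<omega>) * exp (of_real (sqrt k * g * Z \<omega>)))"
    \<comment> \<open>The absolute double integral equals the mean of exp(k Z^2 / 2), which is
      finite because k < 1.\<close>
    proof (rule Fubini_integral[symmetric])
      have "(\<integral>\<^sup>+\<omega>. \<integral>\<^sup>+g. ennreal (exp (sqrt k * g * Z \<omega>)) \<partial>std_normal_distribution \<partial>M)
          = (\<integral>\<^sup>+\<omega>. ennreal (exp (k / 2 * (Z \<omega>)\<^sup>2)) \<partial>M)"
        using nn_integral_std_normal_exp[of "sqrt k * Z _"] by (simp add: mult_ac power_mult_distrib sk)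
      then have "(\<integral>\<^sup>+x. ennreal (exp (sqrt k * snd x * Z (fst x))) \<partial>(M \<Otimes>\<^sub>M std_normal_distribution)) < \<infinity>"
        using nnZ by (subst std_normal.nn_integral_fst[symmetric]) auto
      then show "integrable (M \<Otimes>\<^sub>M std_normal_distribution) (\<lambda>(\<omega>, g). iexp (t * Y \<omega>) * exp (of_real (sqrt k * g * Z \<omega>)))"
        by (intro integrableI_bounded) (auto simp: split_beta' norm_mult)
    qed
    also have "\<dots> = (CLINT g|std_normal_distribution. of_real (exp (- (t\<^sup>2 * v / 2))) * (of_real (exp (k * g\<^sup>2 / 2)) * iexp (sqrt k * t * c * g)))"
    proof (rule Bochner_Integration.integral_cong[OF refl])
      fix g :: real
      show "(CLINT \<omega>|M. iexp (t * Y \<omega>) * exp (of_real (sqrt k * g * Z \<omega>)))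
        = of_real (exp (- (t\<^sup>2 * v / 2))) * (of_real (exp (k * g\<^sup>2 / 2)) * iexp (sqrt k * t * c * g))"
        by (subst mixed, unfold exp_of_real[symmetric] exp_add[symmetric], rule arg_cong[where f=exp])
          (simp add: power_mult_distrib sk mult_ac flip: of_real_power)
    qed
    also have "\<dots> = of_real (exp (- (t\<^sup>2 * v / 2))) * of_real (1 / sqrt (1 - k) * exp (- ((sqrt k * t * c)\<^sup>2 / (2 * (1 - k)))))"
      by (subst integral_mult_right_zero) (simp only: std_normal_exp_square_char[OF k(2)])
    also have "sqrt (1 - k) *\<^sub>R \<dots> = of_real (exp (- (t\<^sup>2 * v / 2)) * exp (- ((sqrt k * t * c)\<^sup>2 / (2 * (1 - k)))))"
      using k by (simp add: scaleR_conv_of_real)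
    also have "exp (- (t\<^sup>2 * v / 2)) * exp (- ((sqrt k * t * c)\<^sup>2 / (2 * (1 - k))))
        = exp (- (t\<^sup>2 * (v + k / (1 - k) * c\<^sup>2) / 2))"
      unfolding exp_add[symmetric] using k by (simp add: power_mult_distrib field_simps)
    finally show "(CLINT \<omega>|Q. iexp (t * (\<Sum>i\<in>I. a i * X i \<omega>)))
        = of_real (exp (- (t\<^sup>2 * (bilin I R a a + k / (1 - k) * (bilin I R a z)\<^sup>2) / 2)))"
      unfolding Y_def v_def c_def .
  qed
  have "bilin I (\<lambda>i j. R i j + k / (1 - k) * (?p i * ?p j)) a a = bilin I R a a + k / (1 - k) * (bilin I R a z)\<^sup>2" for a
    unfolding bilin_rank_one_update[OF fin] bilin_matvec[of I R a z] by (simp add: power2_eq_square)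
  with comb have "normal_family Q I (\<lambda>i j. R i j + k / (1 - k) * (?p i * ?p j)) X"
    using Qp fin sym unfolding normal_family_def by (auto simp: mult.commute)
  moreover have "absolutely_continuous M Q"
    unfolding Q_def by (rule absolutely_continuousI_density) auto
  ultimately show ?thesis using sQ by blast
qed

text \<open>If the cross term were not zero, the form at a + t r would be affine in t with nonzero
  slope and so negative somewhere; the chosen t gives the value -1.\<close>

lemma psd_bilin_zero:
  assumes sym: "\<And>i j. i \<in> I \<Longrightarrow> j \<in> I \<Longrightarrow> R i j = R j i" and psd: "\<And>a. 0 \<le> bilin I R a a"
    and r: "bilin I R r r = 0"
  shows "bilin I R a r = 0"
proof (rule ccontr)
  assume n: "bilin I R a r \<noteq> 0"
  define t where "t = - (bilin I R a a + 1) / (2 * bilin I R a r)"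
  have "bilin I R (\<lambda>i. a i + t * r i) (\<lambda>i. a i + t * r i) = bilin I R a a + 2 * t * bilin I R a r"
    using bilin_sym[of I R r a, OF sym] by (simp add: bilin_add r)
  also have "\<dots> = - 1" using n by (simp add: t_def field_simps)
  finally show False using psd[of "\<lambda>i. a i + t * r i"] by simp
qed

lemma bilin_unit_left:
  assumes "finite I" "i \<in> I"
  shows "bilin I R (\<lambda>k. if k = i then 1 else 0) b = matvec I R b i"
proof -
  have "(\<Sum>k\<in>I. (if k = i then 1 else 0) * matvec I R b k) = (\<Sum>k\<in>I. if k = i then matvec I R b k else 0)"
    by (intro sum.cong) auto
  then show ?thesis using assms unfolding bilin_matvec by simp
qed

text \<open>Gram-Schmidt applied to the unit vectors, in the semi-inner product given by R. The
  result is a factorisation of R into rank-one terms (R z)(R z)^T. A residual of zero norm lies in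
  the kernel of R, so a singular R merely produces fewer vectors. The induction adds one column of
  the representation at a time.\<close>

lemma psd_gram_schmidt:
  assumes fin: "finite I" and sym: "\<And>i j. i \<in> I \<Longrightarrow> j \<in> I \<Longrightarrow> R i j = R j i"
    and psd: "\<And>a. 0 \<le> bilin I R a a" and J: "J \<subseteq> I"
  shows "\<exists>(m::nat) z. (\<forall>k<m. \<forall>l<m. bilin I R (z k) (z l) = (if k = l then 1 else 0)) \<and>
    (\<forall>i\<in>I. \<forall>j\<in>J. R i j = (\<Sum>k<m. matvec I R (z k) i * matvec I R (z k) j))"
  using finite_subset[OF J fin] J
proof (induction J rule: finite_induct)
  case empty
  show ?case by (rule exI[of _ 0]) auto
next
  case (insert j J)
  then have "\<exists>(m::nat) z. (\<forall>k<m. \<forall>l<m. bilin I R (z k) (z l) = (if k = l then 1 else 0)) \<and>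
    (\<forall>i\<in>I. \<forall>j\<in>J. R i j = (\<Sum>k<m. matvec I R (z k) i * matvec I R (z k) j))" by auto
  then obtain m :: nat and z where "\<forall>k<m. \<forall>l<m. bilin I R (z k) (z l) = (if k = l then 1 else 0)"
    and "\<forall>i\<in>I. \<forall>j\<in>J. R i j = (\<Sum>k<m. matvec I R (z k) i * matvec I R (z k) j)"
    by blast
  then have orth: "\<And>k l. k < m \<Longrightarrow> l < m \<Longrightarrow> bilin I R (z k) (z l) = (if k = l then 1 else 0)"
    and rep: "\<And>i j. i \<in> I \<Longrightarrow> j \<in> J \<Longrightarrow> R i j = (\<Sum>k<m. matvec I R (z k) i * matvec I R (z k) j)"
    by auto
  have jI: "j \<in> I" and JI: "J \<subseteq> I" using insert.prems by auto
  let ?A = "matvec I R"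
  define e where "e i = (if i = j then 1 else 0 :: real)" for i
  \<comment> \<open>The residual of the unit vector at j; its R-inner product with
    \<open>z k\<close> is the entry of R z_k at j.\<close>
  define r where "r i = e i - (\<Sum>k<m. ?A (z k) j * z k i)" for i
  have Ae: "?A e i = R i j" if "i \<in> I" for i
  proof -
    have "(\<Sum>l\<in>I. R i l * e l) = (\<Sum>l\<in>I. if l = j then R i l else 0)"
      unfolding e_def by (intro sum.cong) auto
    then show ?thesis using fin jI unfolding matvec_def by simp
  qed
  have Ar: "?A r i = R i j - (\<Sum>k<m. ?A (z k) j * ?A (z k) i)" if "i \<in> I" for i
  proof -
    have "?A r i = ?A e i - (\<Sum>l\<in>I. \<Sum>k<m. R i l * (?A (z k) j * z k l))"
      unfolding r_def matvec_def[of I R "\<lambda>i. e i - _ i"] matvec_def[of I R e]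
      by (simp add: right_diff_distrib sum_subtractf sum_distrib_left)
    also have "(\<Sum>l\<in>I. \<Sum>k<m. R i l * (?A (z k) j * z k l)) = (\<Sum>k<m. ?A (z k) j * ?A (z k) i)"
      by (subst sum.swap, intro sum.cong refl) (simp add: matvec_def[of I R _ i] sum_distrib_left mult_ac)
    finally show ?thesis using Ae[OF that] by simp
  qed
  have br: "bilin I R b r = ?A b j - (\<Sum>k<m. ?A (z k) j * bilin I R b (z k))" for b
  proof -
    have "bilin I R b r = (\<Sum>i\<in>I. b i * R i j - (\<Sum>k<m. ?A (z k) j * (b i * ?A (z k) i)))"
      unfolding bilin_matvec[of I R b r]
      by (intro sum.cong refl) (simp add: Ar right_diff_distrib sum_distrib_left mult_ac)
    also have "\<dots> = (\<Sum>i\<in>I. b i * R i j) - (\<Sum>k<m. ?A (z k) j * bilin I R b (z k))"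
      unfolding sum_subtractf bilin_matvec sum_distrib_left by (subst (2) sum.swap) simp
    also have "(\<Sum>i\<in>I. b i * R i j) = ?A b j"
      unfolding matvec_def using sym jI by (intro sum.cong refl) (simp add: mult.commute)
    finally show ?thesis .
  qed
  have zr: "bilin I R (z l) r = 0" if l: "l < m" for l
  proof -
    have "(\<Sum>k<m. ?A (z k) j * bilin I R (z l) (z k)) = (\<Sum>k<m. if k = l then ?A (z k) j else 0)"
      using l by (intro sum.cong refl) (auto simp: orth)
    then show ?thesis using l unfolding br by simp
  qed
  define q where "q = bilin I R r r"
  have q0: "0 \<le> q" unfolding q_def by (rule psd)
  have qr: "q = ?A r j"
  proof -
    have "bilin I R r (z k) = 0" if "k < m" for k
      using zr[OF that] bilin_sym[of I R r "z k", OF sym] by simp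
    then show ?thesis unfolding q_def br[of r] by simp
  qed
  show ?case
  proof (cases "q = 0")
    case True
    have "R i j = (\<Sum>k<m. ?A (z k) i * ?A (z k) j)" if i: "i \<in> I" for i
    proof -
      have "?A r i = 0"
        using psd_bilin_zero[OF sym psd, of r "\<lambda>k. if k = i then 1 else 0"] True bilin_unit_left[OF fin i]
        unfolding q_def by simp
      with Ar[OF i] show ?thesis by (simp add: mult.commute)
    qed
    with rep orth show ?thesis by (intro exI[of _ m] exI[of _ z]) auto
  next
    case False
    then have qp: "0 < q" using q0 by simp
    define zm where "zm i = 1 / sqrt q * r i" for i
    have Azm: "?A zm i = ?A r i / sqrt q" for i
      unfolding matvec_def zm_def by (simp add: sum_divide_distrib)
    have zz: "bilin I R zm zm = 1"
      unfolding zm_def bilin_cmult q_def[symmetric] using qp by (simp add: power_divide)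
    have bz: "bilin I R (z l) zm = 0" if "l < m" for l
    proof -
      have "bilin I R (z l) zm = bilin I R (z l) r / sqrt q"
        unfolding bilin_matvec Azm by (simp add: sum_divide_distrib)
      then show ?thesis using zr[OF that] by simp
    qed
    define z' where "z' = z(m := zm)"
    have "bilin I R (z' k) (z' l) = (if k = l then 1 else 0)" if "k < Suc m" "l < Suc m" for k l
      using that orth[of k l] zz bz[of l] bz[of k] bilin_sym[of I R zm "z l", OF sym]
      unfolding z'_def by (auto simp: less_Suc_eq)
    moreover have "R i j' = (\<Sum>k<Suc m. ?A (z' k) i * ?A (z' k) j')" if i: "i \<in> I" and j': "j' \<in> insert j J" for i j'
    proof -
      have s: "(\<Sum>k<Suc m. ?A (z' k) i * ?A (z' k) j') = (\<Sum>k<m. ?A (z k) i * ?A (z k) j') + ?A r i * ?A r j' / q"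
        unfolding z'_def using qp by (simp add: Azm field_simps)
      show ?thesis
      proof (cases "j' = j")
        case True
        then show ?thesis unfolding s using qp Ar[OF i] qr by (simp add: mult.commute)
      next
        case False
        then have j'J: "j' \<in> J" "j' \<in> I" using j' JI by auto
        \<comment> \<open>Columns treated before are already represented exactly, so the new
          rank-one term vanishes on them.\<close>
        have "?A r j' = 0"
          using Ar[OF j'J(2)] rep[OF jI j'J(1)] sym[OF jI j'J(2)] by (simp add: mult.commute)
        then show ?thesis unfolding s using rep[OF i j'J(1)] by simp
      qed
    qed
    ultimately show ?thesis by (intro exI[of _ "Suc m"] exI[of _ z']) blast
  qed
qed

text \<open>Enlarging the variance along an orthonormal system of directions, one at a time.\<close>

lemma normal_family_scale:
  fixes X :: "'i \<Rightarrow> 'a \<Rightarrow> real"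
  assumes X: "normal_family M I R X" and k: "0 \<le> k" "k < 1"
  shows "\<exists>Q. sets Q = sets M \<and> absolutely_continuous M Q \<and>
    normal_family Q I (\<lambda>i j. 1 / (1 - k) * R i j) X"
proof -
  have fin: "finite I" using X by (simp add: normal_family_def)
  have sym: "\<And>i j. i \<in> I \<Longrightarrow> j \<in> I \<Longrightarrow> R i j = R j i" using X unfolding normal_family_def by blast
  let ?A = "matvec I R"
  obtain m :: nat and z where orth: "\<And>k l. k < m \<Longrightarrow> l < m \<Longrightarrow> bilin I R (z k) (z l) = (if k = l then 1 else 0)"
    and rep: "\<And>i j. i \<in> I \<Longrightarrow> j \<in> I \<Longrightarrow> R i j = (\<Sum>k<m. ?A (z k) i * ?A (z k) j)"
    using psd_gram_schmidt[OF fin sym bilin_normal_family_nonneg[OF X] order_refl] by blast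
  \<comment> \<open>Chosen so that 1 + b = 1 / (1 - k): each direction has its unit variance raised
    to 1 / (1 - k).\<close>
  define b where "b = k / (1 - k)"
  have "\<exists>Q. sets Q = sets M \<and> absolutely_continuous M Q \<and>
      normal_family Q I (\<lambda>i j. R i j + b * (\<Sum>l<n. ?A (z l) i * ?A (z l) j)) X" if "n \<le> m" for n
    using that
  proof (induction n)
    case 0
    then show ?case using X by (intro exI[of _ M]) (auto simp: absolutely_continuous_def)
  next
    case (Suc n)
    define R' where "R' i j = R i j + b * (\<Sum>l<n. ?A (z l) i * ?A (z l) j)" for i j
    obtain Q where Q: "sets Q = sets M" "absolutely_continuous M Q" "normal_family Q I R' X"
      using Suc unfolding R'_def by auto
    have zn: "(\<Sum>j\<in>I. ?A (z l) j * z n j) = 0" if "l < n" for l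
    proof -
      have "(\<Sum>j\<in>I. ?A (z l) j * z n j) = bilin I R (z n) (z l)"
        unfolding bilin_matvec by (simp add: mult.commute)
      also have "\<dots> = 0" using orth[of n l] that Suc.prems by simp
      finally show ?thesis .
    qed
    \<comment> \<open>The directions used so far are R-orthogonal to \<open>z n\<close>, so the
      earlier updates change neither the image of \<open>z n\<close> nor its norm. Every tilt is
      thus made in the original direction.\<close>
    have A': "matvec I R' (z n) i = ?A (z n) i" for i
    proof -
      have "matvec I R' (z n) i = ?A (z n) i + b * (\<Sum>l<n. ?A (z l) i * (\<Sum>j\<in>I. ?A (z l) j * z n j))"
      proof -
        have "matvec I R' (z n) i = ?A (z n) i + (\<Sum>j\<in>I. \<Sum>l<n. b * (?A (z l) i * (?A (z l) j * z n j)))"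
          unfolding matvec_def[of I R'] R'_def matvec_def[of I R "z n"] sum.distrib[symmetric]
          by (intro sum.cong refl) (simp add: distrib_right sum_distrib_left sum_distrib_right mult.assoc)
        also have "(\<Sum>j\<in>I. \<Sum>l<n. b * (?A (z l) i * (?A (z l) j * z n j)))
            = b * (\<Sum>l<n. ?A (z l) i * (\<Sum>j\<in>I. ?A (z l) j * z n j))"
          by (subst sum.swap) (simp add: sum_distrib_left)
        finally show ?thesis .
      qed
      also have "\<dots> = ?A (z n) i" by (simp add: zn)
      finally show ?thesis .
    qed
    have "bilin I R' (z n) (z n) = bilin I R (z n) (z n)"
      unfolding bilin_matvec A' ..
    then have "bilin I R' (z n) (z n) = 1" using orth[of n n] Suc.prems by simp
    from normal_family_tilt[OF Q(3) this k] obtain Q' where Q': "sets Q' = sets Q" "absolutely_continuous Q Q'"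
      "normal_family Q' I (\<lambda>i j. R' i j + b * (?A (z n) i * ?A (z n) j)) X"
      unfolding A' b_def by blast
    then have "normal_family Q' I (\<lambda>i j. R i j + b * (\<Sum>l<Suc n. ?A (z l) i * ?A (z l) j)) X"
      by (simp add: R'_def algebra_simps)
    moreover have "absolutely_continuous M Q'"
      using Q(2) Q'(2) unfolding absolutely_continuous_def by blast
    ultimately show ?case using Q(1) Q'(1) by (intro exI[of _ Q']) simp
  qed
  from this[OF order_refl] obtain Q where Q: "sets Q = sets M" "absolutely_continuous M Q"
    "normal_family Q I (\<lambda>i j. R i j + b * (\<Sum>l<m. ?A (z l) i * ?A (z l) j)) X" by blast
  have "normal_family Q I (\<lambda>i j. 1 / (1 - k) * R i j) X"
  proof (rule normal_family_cong[OF Q(3)])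
    fix i j assume "i \<in> I" "j \<in> I"
    then have "R i j + b * (\<Sum>l<m. ?A (z l) i * ?A (z l) j) = (1 + b) * R i j"
      using rep[of i j] by (simp add: algebra_simps)
    also have "1 + b = 1 / (1 - k)" using k by (simp add: b_def field_simps)
    finally show "R i j + b * (\<Sum>l<m. ?A (z l) i * ?A (z l) j) = 1 / (1 - k) * R i j" .
  qed
  with Q(1,2) show ?thesis by blast
qed

section \<open>Uniform concentration over sparse vectors\<close>

lemma bilin_add2: "bilin I W (\<lambda>i. a i + b i) (\<lambda>i. a i + b i)
    = bilin I W a a + bilin I W a b + bilin I W b a + bilin I W b b"
  unfolding bilin_def sum.distrib[symmetric]
  by (intro sum.cong refl) (simp add: algebra_simps)

lemma bilin_mono_neutral:
  assumes "finite I" "T \<subseteq> I" "\<And>i. i \<in> I - T \<Longrightarrow> a i = 0" "\<And>i. i \<in> I - T \<Longrightarrow> b i = 0"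
  shows "bilin I W a b = bilin T W a b"
proof -
  have "bilin I W a b = (\<Sum>i\<in>T. \<Sum>j\<in>I. a i * b j * W i j)"
    unfolding bilin_def using assms by (intro sum.mono_neutral_right) auto
  also have "\<dots> = bilin T W a b"
    unfolding bilin_def using assms by (intro sum.cong refl sum.mono_neutral_right) auto
  finally show ?thesis .
qed

text \<open>A finite net of the unit ball with mesh 1/N. Its vectors vanish outside T, so that they
  can be inserted into forms over larger index sets.\<close>

definition grid_ball :: "'i set \<Rightarrow> nat \<Rightarrow> ('i \<Rightarrow> real) set" where
  "grid_ball T N = {v. (\<forall>i. i \<notin> T \<longrightarrow> v i = 0) \<and>
     (\<forall>i\<in>T. \<exists>k::int. \<bar>k\<bar> \<le> int N \<and> v i = of_int k / real N) \<and> (\<Sum>i\<in>T. (v i)\<^sup>2) \<le> 1}"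

lemma grid_ball_card:
  assumes "finite T"
  shows "finite (grid_ball T N)" "card (grid_ball T N) \<le> (2 * N + 1) ^ card T"
proof -
  let ?P = "T \<rightarrow>\<^sub>E {- int N..int N}"
  let ?h = "\<lambda>f i. if i \<in> T then of_int (f i) / real N else 0"
  have fin: "finite ?P" using assms by (intro finite_PiE) auto
  have sub: "grid_ball T N \<subseteq> ?h ` ?P"
  proof
    fix v assume v: "v \<in> grid_ball T N"
    then have "\<forall>i\<in>T. \<exists>k::int. \<bar>k\<bar> \<le> int N \<and> v i = of_int k / real N" by (simp add: grid_ball_def)
    then obtain k where k: "\<And>i. i \<in> T \<Longrightarrow> \<bar>k i\<bar> \<le> int N \<and> v i = of_int (k i) / real N" by metis
    have "v = ?h (restrict k T)" using v k by (auto simp: grid_ball_def fun_eq_iff)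
    moreover have "restrict k T \<in> ?P" using k by (fastforce simp: abs_le_iff)
    ultimately show "v \<in> ?h ` ?P" by blast
  qed
  show "finite (grid_ball T N)" using sub fin by (rule finite_subset[OF _ finite_imageI])
  have "card (grid_ball T N) \<le> card (?h ` ?P)" using sub fin by (intro card_mono) auto
  also have "\<dots> \<le> card ?P" using fin by (rule card_image_le)
  also have "\<dots> = (2 * N + 1) ^ card T"
    using assms by (simp add: card_PiE nat_add_distrib nat_mult_distrib)
  finally show "card (grid_ball T N) \<le> (2 * N + 1) ^ card T" .
qed

text \<open>Rounding every coordinate towards 0 cannot leave the unit ball. Each coordinate moves by
  at most 1/N, which gives the squared distance card T / N^2 \<le> 1/64.\<close>

lemma grid_ball_approx:
  fixes u :: "'i \<Rightarrow> real"
  assumes fin: "finite T" and N: "0 < N" "64 * card T \<le> N\<^sup>2" and u: "(\<Sum>i\<in>T. (u i)\<^sup>2) \<le> 1"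
  obtains v where "v \<in> grid_ball T N" "(\<Sum>i\<in>T. (u i - v i)\<^sup>2) \<le> 1 / 64"
proof -
  define v where "v i = (if i \<in> T then sgn (u i) * of_int \<lfloor>N * \<bar>u i\<bar>\<rfloor> / real N else 0)" for i
  have fl: "of_int \<lfloor>N * \<bar>x\<bar>\<rfloor> / real N \<le> \<bar>x\<bar>" "\<bar>x\<bar> - 1 / N \<le> of_int \<lfloor>N * \<bar>x\<bar>\<rfloor> / real N"
    "0 \<le> of_int \<lfloor>N * \<bar>x\<bar>\<rfloor> / real N" for x :: real
  proof -
    have "of_int \<lfloor>N * \<bar>x\<bar>\<rfloor> \<le> N * \<bar>x\<bar>" by simp
    then show "of_int \<lfloor>N * \<bar>x\<bar>\<rfloor> / real N \<le> \<bar>x\<bar>" using N by (simp add: field_simps)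
    have "N * \<bar>x\<bar> - 1 \<le> of_int \<lfloor>N * \<bar>x\<bar>\<rfloor>" by linarith
    then have "(N * \<bar>x\<bar> - 1) / N \<le> of_int \<lfloor>N * \<bar>x\<bar>\<rfloor> / real N" by (rule divide_right_mono) simp
    then show "\<bar>x\<bar> - 1 / N \<le> of_int \<lfloor>N * \<bar>x\<bar>\<rfloor> / real N" using N by (simp add: diff_divide_distrib)
  qed simp
  have va: "\<bar>v i\<bar> \<le> \<bar>u i\<bar>" for i
    using fl[of "u i"] by (auto simp: v_def abs_mult sgn_real_def)
  have vd: "\<bar>u i - v i\<bar> \<le> 1 / N" if "i \<in> T" for i
    using fl[of "u i"] that by (auto simp: v_def sgn_real_def abs_if)
  have "v \<in> grid_ball T N"
    unfolding grid_ball_def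
  proof (intro CollectI conjI allI impI ballI)
    show "(\<Sum>i\<in>T. (v i)\<^sup>2) \<le> 1"
      using va by (intro order_trans[OF sum_mono u]) (metis abs_le_square_iff)
    fix i assume i: "i \<in> T"
    have "(u i)\<^sup>2 \<le> 1" using member_le_sum[OF i, of "\<lambda>i. (u i)\<^sup>2"] fin u by auto
    then have "\<bar>u i\<bar> \<le> 1" by (simp add: abs_square_le_1)
    then have "N * \<bar>u i\<bar> \<le> N" using N by (simp add: mult_left_le)
    then have k: "\<lfloor>N * \<bar>u i\<bar>\<rfloor> \<le> int N" "0 \<le> \<lfloor>N * \<bar>u i\<bar>\<rfloor>" by (linarith, simp)
    define k where "k = \<lfloor>N * \<bar>u i\<bar>\<rfloor>"
    show "\<exists>k::int. \<bar>k\<bar> \<le> int N \<and> v i = of_int k / real N"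
      using i k unfolding v_def k_def[symmetric]
      by (intro exI[of _ "(if u i < 0 then -1 else if u i = 0 then 0 else 1) * k"]) (auto simp: sgn_real_def)
  qed (simp add: v_def)
  moreover have "(\<Sum>i\<in>T. (u i - v i)\<^sup>2) \<le> 1 / 64"
  proof -
    have "(\<Sum>i\<in>T. (u i - v i)\<^sup>2) \<le> (\<Sum>i\<in>T. (1 / N)\<^sup>2)"
    proof (rule sum_mono)
      fix i assume "i \<in> T"
      show "(u i - v i)\<^sup>2 \<le> (1 / N)\<^sup>2"
        by (rule abs_le_square_iff[THEN iffD1]) (use vd[OF \<open>i \<in> T\<close>] in simp)
    qed
    also have "\<dots> = real (card T) / (real N)\<^sup>2" by (simp add: power_divide)
    also have "\<dots> \<le> 1 / 64"
    proof -
      have "real (64 * card T) \<le> real (N\<^sup>2)" using N by (simp only: of_nat_le_iff)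
      then show ?thesis using N by (simp add: field_simps)
    qed
    finally show ?thesis .
  qed
  ultimately show thesis by (rule that)
qed

text \<open>Let m be the supremum of the absolute form over the unit ball. Moving a unit vector to a
  grid point at distance at most 1/8 changes the form by at most 2 m / 8 + m / 64 \<le> m / 2, hence
  m \<le> e + m / 2 and m \<le> 2 e. This uses that m is finite, which a crude bound by the sum of
  all entries shows. Polarisation carries the bound from the quadratic to the bilinear form without
  further loss.\<close>

lemma grid_ball_bilin_bound:
  fixes W :: "'i \<Rightarrow> 'i \<Rightarrow> real"
  assumes fin: "finite T" and sym: "\<And>i j. i \<in> T \<Longrightarrow> j \<in> T \<Longrightarrow> W i j = W j i"
    and N: "0 < N" "64 * card T \<le> N\<^sup>2" and net: "\<And>v. v \<in> grid_ball T N \<Longrightarrow> \<bar>bilin T W v v\<bar> \<le> e"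
  shows "\<bar>bilin T W a b\<bar> \<le> 2 * e * sqrt (\<Sum>i\<in>T. (a i)\<^sup>2) * sqrt (\<Sum>i\<in>T. (b i)\<^sup>2)"
proof -
  define n where "n a = sqrt (\<Sum>i\<in>T. (a i)\<^sup>2)" for a :: "'i \<Rightarrow> real"
  have n2: "(n a)\<^sup>2 = (\<Sum>i\<in>T. (a i)\<^sup>2)" for a unfolding n_def by (simp add: sum_nonneg)
  have n0: "0 \<le> n a" for a unfolding n_def by (simp add: sum_nonneg)
  define B where "B = {\<bar>bilin T W u u\<bar> | u. n u \<le> 1}"
  define m where "m = Sup B"
  have bs: "bilin T W a b = bilin T W b a" for a b
    unfolding bilin_def by (subst sum.swap) (intro sum.cong refl, simp add: sym mult_ac)
  have comp: "\<bar>u i\<bar> \<le> n u" if "i \<in> T" for u i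
  proof -
    have "(u i)\<^sup>2 \<le> (n u)\<^sup>2" unfolding n2 using member_le_sum[OF that, of "\<lambda>i. (u i)\<^sup>2"] fin by auto
    then show ?thesis using n0[of u] abs_le_square_iff by force
  qed
  have bdd: "bdd_above B"
  proof (rule bdd_aboveI)
    fix x assume "x \<in> B"
    then obtain u where u: "x = \<bar>bilin T W u u\<bar>" "n u \<le> 1" by (auto simp: B_def)
    have "\<bar>bilin T W u u\<bar> \<le> (\<Sum>i\<in>T. \<Sum>j\<in>T. \<bar>u i * u j * W i j\<bar>)"
      unfolding bilin_def by (rule order_trans[OF sum_abs]) (intro sum_mono sum_abs)
    also have "\<dots> \<le> (\<Sum>i\<in>T. \<Sum>j\<in>T. \<bar>W i j\<bar>)"
    proof (intro sum_mono)
      fix i j assume "i \<in> T" "j \<in> T"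
      then have "\<bar>u i\<bar> * \<bar>u j\<bar> \<le> 1 * 1"
        using comp[of i u] comp[of j u] u(2) by (intro mult_mono) auto
      then have "\<bar>u i\<bar> * \<bar>u j\<bar> * \<bar>W i j\<bar> \<le> 1 * \<bar>W i j\<bar>" by (intro mult_right_mono) auto
      then show "\<bar>u i * u j * W i j\<bar> \<le> \<bar>W i j\<bar>" by (simp add: abs_mult)
    qed
    finally show "x \<le> (\<Sum>i\<in>T. \<Sum>j\<in>T. \<bar>W i j\<bar>)" using u by simp
  qed
  have mB: "\<bar>bilin T W u u\<bar> \<le> m" if "n u \<le> 1" for u
    unfolding m_def using that by (intro cSup_upper bdd) (auto simp: B_def)
  have z: "n (\<lambda>_. 0) = 0" "bilin T W (\<lambda>_. 0) (\<lambda>_. 0) = 0" by (simp_all add: n_def bilin_def)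
  have m0: "0 \<le> m" using mB[of "\<lambda>_. 0"] z by simp
  have nc: "n (\<lambda>i. c * u i) = \<bar>c\<bar> * n u" for c u
    unfolding n_def by (simp add: power_mult_distrib sum_distrib_left[symmetric] real_sqrt_mult)
  have nz: "bilin T W a b = 0" if "n a = 0 \<or> n b = 0" for a b
  proof -
    have "(\<forall>i\<in>T. a i = 0) \<or> (\<forall>i\<in>T. b i = 0)" using that comp[of _ a] comp[of _ b] by (metis abs_le_zero_iff)
    then show ?thesis unfolding bilin_def by auto
  qed
  have q: "\<bar>bilin T W u u\<bar> \<le> m * (n u)\<^sup>2" for u
  proof (cases "n u = 0")
    case False
    then have p: "0 < n u" using n0[of u] by simp
    have "\<bar>bilin T W (\<lambda>i. 1 / n u * u i) (\<lambda>i. 1 / n u * u i)\<bar> \<le> m"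
      by (rule mB) (unfold nc, use p in simp)
    then show ?thesis unfolding bilin_cmult using p by (simp add: abs_mult power_divide field_simps)
  qed (simp add: nz)
  \<comment> \<open>For unit vectors the squared norms of the sum and the difference, both over sqrt
    2, add up to 2, which is exactly the factor in front of the bilinear form.\<close>
  have cross1: "\<bar>bilin T W a b\<bar> \<le> m" if "n a = 1" "n b = 1" for a b
  proof -
    have nn: "(n (\<lambda>i. (a i + b i) / sqrt 2))\<^sup>2 + (n (\<lambda>i. (a i - b i) / sqrt 2))\<^sup>2 = 2"
    proof -
      have "(n (\<lambda>i. (a i + b i) / sqrt 2))\<^sup>2 + (n (\<lambda>i. (a i - b i) / sqrt 2))\<^sup>2 = (n a)\<^sup>2 + (n b)\<^sup>2"
        unfolding n2 sum.distrib[symmetric]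
        by (intro sum.cong refl) (simp add: power_divide field_simps power2_eq_square)
      then show ?thesis using that by simp
    qed
    have "\<bar>2 * bilin T W a b\<bar> \<le> m * (n (\<lambda>i. (a i + b i) / sqrt 2))\<^sup>2 + m * (n (\<lambda>i. (a i - b i) / sqrt 2))\<^sup>2"
      using bilin_polar[of T W a b, OF sym] q[of "\<lambda>i. (a i + b i) / sqrt 2"] q[of "\<lambda>i. (a i - b i) / sqrt 2"]
      by linarith
    also have "\<dots> = m * 2" unfolding distrib_left[symmetric] nn ..
    finally show ?thesis by simp
  qed
  have cross: "\<bar>bilin T W a b\<bar> \<le> m * n a * n b" for a b
  proof (cases "n a = 0 \<or> n b = 0")
    case True then show ?thesis using nz m0 n0 by auto
  next
    case False
    then have p: "0 < n a" "0 < n b" using n0[of a] n0[of b] by auto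
    have "\<bar>bilin T W (\<lambda>i. 1 / n a * a i) (\<lambda>i. 1 / n b * b i)\<bar> \<le> m"
      by (rule cross1) (unfold nc, use p in simp_all)
    moreover have "bilin T W (\<lambda>i. 1 / n a * a i) (\<lambda>i. 1 / n b * b i) = 1 / n a * (1 / n b) * bilin T W a b"
      unfolding bilin_def sum_distrib_left by (intro sum.cong refl) (simp add: mult_ac)
    ultimately have "\<bar>1 / n a * (1 / n b) * bilin T W a b\<bar> \<le> m" by simp
    then show ?thesis using p by (simp add: abs_mult divide_le_eq mult_ac)
  qed
  have "Sup B \<le> e + m / 2"
  proof (rule cSup_least)
    show "B \<noteq> {}" using z unfolding B_def by (metis (mono_tags, lifting) empty_iff mem_Collect_eq zero_le_one)
    fix x assume "x \<in> B"
    then obtain u where u: "x = \<bar>bilin T W u u\<bar>" "n u \<le> 1" by (auto simp: B_def)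
    have "(\<Sum>i\<in>T. (u i)\<^sup>2) \<le> 1"
      unfolding n2[symmetric] using u(2) n0[of u] by (simp add: power_le_one)
    from grid_ball_approx[OF fin N this] obtain v where v: "v \<in> grid_ball T N"
      "(\<Sum>i\<in>T. (u i - v i)\<^sup>2) \<le> 1 / 64" by blast
    define d where "d i = u i - v i" for i
    have nd: "n d \<le> 1 / 8"
    proof -
      have "(n d)\<^sup>2 \<le> (1 / 8)\<^sup>2" using v(2) unfolding n2 d_def by (simp add: power_divide)
      then show ?thesis by (rule power2_le_imp_le) simp
    qed
    have nv: "n v \<le> 1" using v(1) unfolding n_def grid_ball_def by simp
    have "bilin T W u u = bilin T W v v + 2 * bilin T W v d + bilin T W d d"
      using bilin_add2[of T W v d] bs[of v d] by (simp add: d_def)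
    then have "x \<le> \<bar>bilin T W v v\<bar> + 2 * \<bar>bilin T W v d\<bar> + \<bar>bilin T W d d\<bar>" using u by linarith
    moreover have "\<bar>bilin T W v v\<bar> \<le> e" by (rule net[OF v(1)])
    moreover have "m * n v * n d \<le> m * 1 * (1 / 8)"
      using nd nv m0 n0 by (intro mult_mono) auto
    moreover have "m * (n d)\<^sup>2 \<le> m * (1 / 8)\<^sup>2"
      using nd m0 n0 by (intro mult_left_mono power_mono) auto
    moreover have "(1 / 8 :: real)\<^sup>2 = 1 / 64" by (simp add: power_divide)
    ultimately show "x \<le> e + m / 2"
      using cross[of v d] q[of d] m0 by simp
  qed
  then have "m \<le> 2 * e" unfolding m_def[symmetric] by simp
  then have "m * n a * n b \<le> 2 * e * n a * n b" using n0 by (intro mult_right_mono) auto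
  with cross[of a b] show ?thesis unfolding n_def by linarith
qed

section \<open>Sample covariance along one direction and along all sparse directions\<close>

definition sample_cov :: "nat \<Rightarrow> (nat \<times> nat \<Rightarrow> 'a \<Rightarrow> real) \<Rightarrow> 'a \<Rightarrow> nat \<Rightarrow> nat \<Rightarrow> real" where
  "sample_cov n X \<omega> i j = (\<Sum>t=1..n. X (t, i) \<omega> * X (t, j) \<omega>) / n"

text \<open>When R is the covariance of the coordinates X(t, i), this is the covariance between
  times t and u of the scalar series obtained by projecting onto v.\<close>

definition proj_cov :: "nat \<Rightarrow> (nat \<times> nat \<Rightarrow> nat \<times> nat \<Rightarrow> real) \<Rightarrow> (nat \<Rightarrow> real) \<Rightarrow> nat \<Rightarrow> nat \<Rightarrow> real" where
  "proj_cov p R v t u = bilin {..<p} (\<lambda>i j. R (t, i) (u, j)) v v"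

lemma normal_family_project:
  assumes X: "normal_family M ({1..n} \<times> {..<p}) R X"
  shows "normal_family M {1..n} (proj_cov p R v) (\<lambda>t \<omega>. \<Sum>j<p. v j * X (t, j) \<omega>)"
  unfolding normal_family_def
proof (intro conjI ballI allI)
  note Xd = X[unfolded normal_family_def]
  show "prob_space M" "finite {1..n}" using Xd by auto
  have [measurable]: "X (t, j) \<in> borel_measurable M" if "t \<in> {1..n}" "j < p" for t j
    using Xd that by auto
  show "(\<lambda>\<omega>. \<Sum>j<p. v j * X (t, j) \<omega>) \<in> borel_measurable M" if "t \<in> {1..n}" for t
    using that by measurable
  have sym: "R (t, i) (u, j) = R (u, j) (t, i)" if "t \<in> {1..n}" "u \<in> {1..n}" "i < p" "j < p" for t u i j
    using Xd that by blast
  show "proj_cov p R v t u = proj_cov p R v u t" if "t \<in> {1..n}" "u \<in> {1..n}" for t u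
    unfolding proj_cov_def bilin_def using that
    by (subst sum.swap) (intro sum.cong refl, simp add: sym mult_ac)
  fix g :: "nat \<Rightarrow> real"
  let ?a = "\<lambda>(t::nat, j::nat). g t * v j"
  have "centered_normal M (\<lambda>\<omega>. \<Sum>i\<in>{1..n} \<times> {..<p}. ?a i * X i \<omega>) (bilin ({1..n} \<times> {..<p}) R ?a ?a)"
    by (rule normal_family_combination[OF X])
  also have "(\<lambda>\<omega>. \<Sum>i\<in>{1..n} \<times> {..<p}. ?a i * X i \<omega>) = (\<lambda>\<omega>. \<Sum>t=1..n. g t * (\<Sum>j<p. v j * X (t, j) \<omega>))"
    by (simp add: sum.cartesian_product' split_beta sum_distrib_left mult.assoc)
  also have "bilin ({1..n} \<times> {..<p}) R ?a ?a = bilin {1..n} (proj_cov p R v) g g"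
  proof -
    have "bilin ({1..n} \<times> {..<p}) R ?a ?a
        = (\<Sum>t=1..n. \<Sum>i<p. \<Sum>u=1..n. \<Sum>j<p. g t * v i * (g u * v j) * R (t, i) (u, j))"
      unfolding bilin_def by (simp add: sum.cartesian_product' split_beta)
    also have "\<dots> = (\<Sum>t=1..n. \<Sum>u=1..n. \<Sum>i<p. \<Sum>j<p. g t * v i * (g u * v j) * R (t, i) (u, j))"
      by (intro sum.cong refl sum.swap)
    also have "\<dots> = bilin {1..n} (proj_cov p R v) g g"
      unfolding bilin_def proj_cov_def by (simp add: sum_distrib_left mult_ac)
    finally show ?thesis .
  qed
  finally show "centered_normal M (\<lambda>\<omega>. \<Sum>t=1..n. g t * (\<Sum>j<p. v j * X (t, j) \<omega>)) (bilin {1..n} (proj_cov p R v) g g)" .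
qed

text \<open>n times the form of the sample covariance at v is the sum of squares of the projected
  series, a normal family over n time points, so the concentration of squares applies with card I =
  n.\<close>

lemma sample_cov_concentration:
  fixes K z :: real
  assumes X: "normal_family M ({1..n} \<times> {..<p}) R X" and n: "1 \<le> n"
    and diag: "\<And>t i j. t \<in> {1..n} \<Longrightarrow> i < p \<Longrightarrow> j < p \<Longrightarrow> R (t, i) (t, j) = C i j"
    and K: "0 < K" and z: "0 < z" "z \<le> 1"
    and row: "\<And>t. t \<in> {1..n} \<Longrightarrow> (\<Sum>u=1..n. \<bar>proj_cov p R v t u\<bar>) \<le> K"
  shows "measure M {\<omega> \<in> space M. K * z \<le> \<bar>bilin {..<p} (\<lambda>i j. sample_cov n X \<omega> i j - C i j) v v\<bar>}
    \<le> 2 * exp (- (n * z\<^sup>2 / 16))"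
proof -
  have "(\<Sum>t=1..n. (\<Sum>j<p. v j * X (t, j) \<omega>)\<^sup>2) - (\<Sum>t=1..n. proj_cov p R v t t)
      = n * bilin {..<p} (\<lambda>i j. sample_cov n X \<omega> i j - C i j) v v" for \<omega>
  proof -
    have "(\<Sum>t=1..n. (\<Sum>j<p. v j * X (t, j) \<omega>)\<^sup>2)
        = (\<Sum>t=1..n. \<Sum>i<p. \<Sum>j<p. v i * v j * (X (t, i) \<omega> * X (t, j) \<omega>))"
      by (simp add: power2_eq_square sum_product mult_ac)
    also have "\<dots> = (\<Sum>i<p. \<Sum>j<p. \<Sum>t=1..n. v i * v j * (X (t, i) \<omega> * X (t, j) \<omega>))"
      by (subst sum.swap) (intro sum.cong refl sum.swap)
    also have "\<dots> = (\<Sum>i<p. \<Sum>j<p. n * (v i * v j * sample_cov n X \<omega> i j))"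
      using n by (intro sum.cong refl) (simp add: sample_cov_def sum_distrib_left[symmetric])
    also have "\<dots> = n * bilin {..<p} (sample_cov n X \<omega>) v v"
      by (simp only: bilin_def sum_distrib_left)
    finally have 1: "(\<Sum>t=1..n. (\<Sum>j<p. v j * X (t, j) \<omega>)\<^sup>2) = n * bilin {..<p} (sample_cov n X \<omega>) v v" .
    have "(\<Sum>t=1..n. proj_cov p R v t t) = (\<Sum>t=1..n. bilin {..<p} C v v)"
      unfolding proj_cov_def bilin_def using diag by (intro sum.cong refl) auto
    then have 2: "(\<Sum>t=1..n. proj_cov p R v t t) = n * bilin {..<p} C v v" by simp
    show ?thesis unfolding 1 2 right_diff_distrib[symmetric]
      by (simp add: bilin_def sum_subtractf algebra_simps)
  qed
  moreover have "n * K * z \<le> \<bar>n * x\<bar> \<longleftrightarrow> K * z \<le> \<bar>x\<bar>" for x :: real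
    using n by (simp add: abs_mult mult.assoc)
  ultimately show ?thesis
    using normal_family_square_concentration[OF normal_family_project[OF X, of v] K row z] by simp
qed

text \<open>Union bound over the at most p^m ways of adding m coordinates to S, and over the grid on
  each of the resulting index sets; the grid bound then passes to all vectors supported there. The
  event is chosen once and serves every T, a and b, so T may later depend on the outcome.\<close>

lemma sparse_concentration:
  fixes K z :: real
  assumes X: "normal_family M ({1..n} \<times> {..<p}) R X" and n: "1 \<le> n" and p: "0 < p"
    and diag: "\<And>t i j. t \<in> {1..n} \<Longrightarrow> i < p \<Longrightarrow> j < p \<Longrightarrow> R (t, i) (t, j) = C i j"
    and C: "\<And>i j. i < p \<Longrightarrow> j < p \<Longrightarrow> C i j = C j i"
    and K: "0 < K" and z: "0 < z" "z \<le> 1"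
    and row: "\<And>v t. (\<Sum>j<p. (v j)\<^sup>2) \<le> 1 \<Longrightarrow> t \<in> {1..n} \<Longrightarrow> (\<Sum>u=1..n. \<bar>proj_cov p R v t u\<bar>) \<le> K"
    and S: "S \<subseteq> {..<p}" and N: "0 < N" "64 * p \<le> N\<^sup>2"
  shows "\<exists>E\<in>sets M. 1 - measure M E \<le> 2 * real p ^ m * (2 * real N + 1) ^ (card S + m) * exp (- (n * z\<^sup>2 / 16)) \<and>
    (\<forall>\<omega>\<in>E. \<forall>T a b. T \<subseteq> {..<p} \<longrightarrow> card T \<le> m \<longrightarrow>
       (\<forall>i. i < p \<longrightarrow> i \<notin> S \<union> T \<longrightarrow> a i = 0) \<longrightarrow> (\<forall>i. i < p \<longrightarrow> i \<notin> S \<union> T \<longrightarrow> b i = 0) \<longrightarrow>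
       \<bar>bilin {..<p} (\<lambda>i j. sample_cov n X \<omega> i j - C i j) a b\<bar>
         \<le> 2 * (K * z) * sqrt (\<Sum>i<p. (a i)\<^sup>2) * sqrt (\<Sum>i<p. (b i)\<^sup>2))"
proof -
  note Xd = X[unfolded normal_family_def]
  interpret prob_space M using Xd by blast
  have Xm [measurable]: "X (t, j) \<in> borel_measurable M" if "t \<in> {1..n}" "j < p" for t j
    using Xd that by auto
  let ?W = "\<lambda>\<omega> i j. sample_cov n X \<omega> i j - C i j"
  \<comment> \<open>Sets of at most m coordinates are listed as images of functions; counting some
    of them several times is harmless, and the number of functions is exactly p^m.\<close>
  define Fs where "Fs = ({..<m} \<rightarrow>\<^sub>E {..<p})"
  define U where "U f = S \<union> f ` {..<m}" for f :: "nat \<Rightarrow> nat"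
  define P where "P = Sigma Fs (\<lambda>f. grid_ball (U f) N)"
  have finF: "finite Fs" unfolding Fs_def by (intro finite_PiE) auto
  have finS: "finite S" using S finite_subset by blast
  have finU: "finite (U f)" for f unfolding U_def using finS by simp
  have Usub: "U f \<subseteq> {..<p}" if "f \<in> Fs" for f
    using that S unfolding U_def Fs_def by (auto simp: PiE_iff)
  have finP: "finite P" unfolding P_def using finF grid_ball_card(1)[OF finU] by blast
  have cardU: "card (U f) \<le> card S + m" for f
  proof -
    have "card (U f) \<le> card S + card (f ` {..<m})" unfolding U_def by (rule card_Un_le)
    also have "card (f ` {..<m}) \<le> m" using card_image_le[of "{..<m}" f] by simp
    finally show ?thesis by simp
  qed
  have cardP: "real (card P) \<le> real p ^ m * (2 * real N + 1) ^ (card S + m)"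
  proof -
    have "card P = (\<Sum>f\<in>Fs. card (grid_ball (U f) N))"
      unfolding P_def using finF grid_ball_card(1)[OF finU] by (intro card_SigmaI) auto
    also have "\<dots> \<le> (\<Sum>f\<in>Fs. (2 * N + 1) ^ (card S + m))"
    proof (rule sum_mono)
      fix f
      show "card (grid_ball (U f) N) \<le> (2 * N + 1) ^ (card S + m)"
        by (rule order_trans[OF grid_ball_card(2)[OF finU] power_increasing[OF cardU]]) simp
    qed
    also have "\<dots> = p ^ m * (2 * N + 1) ^ (card S + m)"
      unfolding Fs_def by (simp add: card_PiE)
    finally have "real (card P) \<le> real (p ^ m * (2 * N + 1) ^ (card S + m))" by (simp only: of_nat_le_iff)
    then show ?thesis by (simp add: add.commute)
  qed
  define bad where "bad v = {\<omega> \<in> space M. K * z \<le> \<bar>bilin {..<p} (?W \<omega>) v v\<bar>}" for v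
  have Wm: "(\<lambda>\<omega>. bilin {..<p} (?W \<omega>) v v) \<in> borel_measurable M" for v
    unfolding bilin_def sample_cov_def by measurable
  have badm: "bad v \<in> sets M" for v
    unfolding bad_def using Wm[of v] by measurable
  have badp: "measure M (bad v) \<le> 2 * exp (- (n * z\<^sup>2 / 16))" if "f \<in> Fs" "v \<in> grid_ball (U f) N" for f v
  proof -
    have "(\<Sum>j<p. (v j)\<^sup>2) = (\<Sum>j\<in>U f. (v j)\<^sup>2)"
      using that Usub[of f] by (intro sum.mono_neutral_right) (auto simp: grid_ball_def)
    also have "\<dots> \<le> 1" using that by (simp add: grid_ball_def)
    finally show ?thesis
      unfolding bad_def by (intro sample_cov_concentration[OF X n diag K z] row)
  qed
  define E where "E = space M - (\<Union>(f, v)\<in>P. bad v)"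
  have Um: "(\<Union>(f, v)\<in>P. bad v) \<in> sets M"
    using finP badm by (intro sets.finite_UN) auto
  have Em: "E \<in> sets M" unfolding E_def using Um by auto
  have "1 - measure M E = measure M (\<Union>(f, v)\<in>P. bad v)"
    unfolding E_def using Um by (simp add: prob_compl)
  also have "\<dots> \<le> (\<Sum>(f, v)\<in>P. measure M (bad v))"
    using finP badm by (intro order_trans[OF measure_UNION_le]) (auto simp: split_beta)
  also have "\<dots> \<le> (\<Sum>(f, v)\<in>P. 2 * exp (- (n * z\<^sup>2 / 16)))"
    by (intro sum_mono) (auto simp: P_def intro: badp)
  also have "\<dots> = real (card P) * (2 * exp (- (n * z\<^sup>2 / 16)))" by (simp add: split_beta)
  also have "\<dots> \<le> (real p ^ m * (2 * real N + 1) ^ (card S + m)) * (2 * exp (- (n * z\<^sup>2 / 16)))"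
    by (intro mult_right_mono cardP) auto
  finally have Ep: "1 - measure M E \<le> 2 * real p ^ m * (2 * real N + 1) ^ (card S + m) * exp (- (n * z\<^sup>2 / 16))"
    by (simp add: mult_ac)
  have main: "\<bar>bilin {..<p} (?W \<omega>) a b\<bar> \<le> 2 * (K * z) * sqrt (\<Sum>i<p. (a i)\<^sup>2) * sqrt (\<Sum>i<p. (b i)\<^sup>2)"
    if \<omega>: "\<omega> \<in> E" and T: "T \<subseteq> {..<p}" "card T \<le> m"
      and a: "\<forall>i. i < p \<longrightarrow> i \<notin> S \<union> T \<longrightarrow> a i = 0" and b: "\<forall>i. i < p \<longrightarrow> i \<notin> S \<union> T \<longrightarrow> b i = 0" for \<omega> T a b
  proof -
    have "\<exists>f\<in>Fs. T \<subseteq> f ` {..<m}"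
    proof (cases "T = {}")
      case True
      have "(\<lambda>i\<in>{..<m}. 0) \<in> Fs" using p unfolding Fs_def by auto
      with True show ?thesis by auto
    next
      case False
      have finT: "finite T" using T finite_subset by blast
      obtain h where h: "bij_betw h {..<card T} T"
        using ex_bij_betw_nat_finite[OF finT] by (auto simp: atLeast0LessThan)
      \<comment> \<open>A set with fewer than m elements is padded by repeating one of its
        elements.\<close>
      define f where "f = (\<lambda>i\<in>{..<m}. if i < card T then h i else h 0)"
      have "0 < card T" using False finT by (simp add: card_gt_0_iff)
      moreover have "h i < p" if "i < card T" for i
        using bij_betwE[OF h] that T(1) by auto
      ultimately have "f \<in> Fs" unfolding Fs_def f_def by auto
      moreover have "T \<subseteq> f ` {..<m}"
      proof
        fix x assume "x \<in> T"
        then obtain i where "i < card T" "x = h i" using h by (auto simp: bij_betw_def)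
        then show "x \<in> f ` {..<m}" using T(2) by (intro image_eqI[of _ _ i]) (auto simp: f_def)
      qed
      ultimately show ?thesis by blast
    qed
    then obtain f where f: "f \<in> Fs" "T \<subseteq> f ` {..<m}" by blast
    have STU: "S \<union> T \<subseteq> U f" using f(2) unfolding U_def by auto
    have net: "\<bar>bilin (U f) (?W \<omega>) v v\<bar> \<le> K * z" if v: "v \<in> grid_ball (U f) N" for v
    proof -
      have "\<omega> \<notin> bad v" using \<omega> f v unfolding E_def P_def by auto
      then have "\<bar>bilin {..<p} (?W \<omega>) v v\<bar> \<le> K * z" using \<omega> unfolding bad_def E_def by auto
      also have "bilin {..<p} (?W \<omega>) v v = bilin (U f) (?W \<omega>) v v"
        using v Usub[OF f(1)] by (intro bilin_mono_neutral) (auto simp: grid_ball_def)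
      finally show ?thesis .
    qed
    have sum_eq: "(\<Sum>i<p. (c i)\<^sup>2) = (\<Sum>i\<in>U f. (c i)\<^sup>2)" if "\<forall>i. i < p \<longrightarrow> i \<notin> S \<union> T \<longrightarrow> c i = 0" for c :: "nat \<Rightarrow> real"
      using that Usub[OF f(1)] STU by (intro sum.mono_neutral_right) auto
    have "card (U f) \<le> p" using card_mono[OF _ Usub[OF f(1)]] by simp
    then have N': "64 * card (U f) \<le> N\<^sup>2" using N by linarith
    have "\<bar>bilin (U f) (?W \<omega>) a b\<bar> \<le> 2 * (K * z) * sqrt (\<Sum>i\<in>U f. (a i)\<^sup>2) * sqrt (\<Sum>i\<in>U f. (b i)\<^sup>2)"
    proof (rule grid_ball_bilin_bound[OF finU _ N(1) N' net])
      fix i j assume "i \<in> U f" "j \<in> U f"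
      then have "i < p" "j < p" using Usub[OF f(1)] by auto
      then show "?W \<omega> i j = ?W \<omega> j i" using C[of i j] by (simp add: sample_cov_def mult.commute)
    qed
    moreover have "bilin {..<p} (?W \<omega>) a b = bilin (U f) (?W \<omega>) a b"
      using Usub[OF f(1)] STU a b by (intro bilin_mono_neutral) auto
    ultimately show ?thesis using sum_eq[OF a] sum_eq[OF b] by simp
  qed
  show ?thesis using Em Ep main by (intro bexI[of _ E] conjI ballI allI impI) auto
qed

section \<open>The second eigenvalue\<close>

definition mat_trace :: "nat \<Rightarrow> real mat \<Rightarrow> real" where
  "mat_trace d A = (\<Sum>i<d. A $$ (i, i))"

lemma index_mult_mat_sum:
  assumes "A \<in> carrier_mat d d" "B \<in> carrier_mat d d" "i < d" "j < d"
  shows "(A * B) $$ (i, j) = (\<Sum>l<d. A $$ (i, l) * B $$ (l, j))"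
  using assms by (simp add: scalar_prod_def atLeast0LessThan)

lemma mat_trace_comm:
  assumes "A \<in> carrier_mat d d" "B \<in> carrier_mat d d"
  shows "mat_trace d (A * B) = mat_trace d (B * A)"
proof -
  have "mat_trace d (A * B) = (\<Sum>i<d. \<Sum>l<d. A $$ (i, l) * B $$ (l, i))"
    unfolding mat_trace_def using assms by (intro sum.cong refl index_mult_mat_sum) auto
  also have "\<dots> = (\<Sum>l<d. \<Sum>i<d. B $$ (l, i) * A $$ (i, l))"
    by (subst sum.swap) (simp add: mult.commute)
  also have "\<dots> = mat_trace d (B * A)"
    unfolding mat_trace_def using assms by (intro sum.cong refl index_mult_mat_sum[symmetric]) auto
  finally show ?thesis .
qed

lemma mat_trace_similar:
  assumes sim: "similar_mat_wit A B P Q" and A: "A \<in> carrier_mat d d"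
  shows "mat_trace d A = mat_trace d B"
proof -
  have c: "B \<in> carrier_mat d d" "P \<in> carrier_mat d d" "Q \<in> carrier_mat d d"
    and PQ: "Q * P = 1\<^sub>m d" and AB: "A = P * B * Q"
    using sim A unfolding similar_mat_wit_def Let_def by auto
  have "mat_trace d A = mat_trace d (Q * (P * B))"
    unfolding AB using c by (intro mat_trace_comm) auto
  also have "Q * (P * B) = B"
    using c PQ by (subst assoc_mult_mat[symmetric, of Q d d P d B d]) auto
  finally show ?thesis .
qed

lemma similar_mat_wit_square:
  assumes sim: "similar_mat_wit A B P Q" and A: "A \<in> carrier_mat d d"
  shows "similar_mat_wit (A * A) (B * B) P Q"
proof -
  have c: "B \<in> carrier_mat d d" "P \<in> carrier_mat d d" "Q \<in> carrier_mat d d"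
    and PQ: "Q * P = 1\<^sub>m d" "P * Q = 1\<^sub>m d" and AB: "A = P * B * Q"
    using sim A unfolding similar_mat_wit_def Let_def by auto
  have "A * A = P * B * (Q * (P * (B * Q)))"
    unfolding AB using c by (simp add: assoc_mult_mat[of _ d d _ d _ d])
  also have "Q * (P * (B * Q)) = B * Q"
    using c PQ by (subst assoc_mult_mat[symmetric, of Q d d P d "B * Q" d]) auto
  also have "P * B * (B * Q) = P * (B * B) * Q"
    using c by (simp add: assoc_mult_mat[of _ d d _ d _ d])
  finally show ?thesis
    unfolding similar_mat_wit_def Let_def using A c PQ by auto
qed

lemma upper_triangular_square:
  fixes B :: "real mat"
  assumes B: "B \<in> carrier_mat d d" and ut: "upper_triangular B"
  shows "upper_triangular (B * B)" "i < d \<Longrightarrow> (B * B) $$ (i, i) = (B $$ (i, i))\<^sup>2"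
proof -
  have z: "B $$ (i, j) = 0" if "j < i" "i < d" for i j
    using ut that B unfolding upper_triangular_def by auto
  show "upper_triangular (B * B)"
  proof (rule upper_triangularI)
    fix i j assume "j < i" "i < dim_row (B * B)"
    then have ij: "j < i" "i < d" using B by auto
    have "(B * B) $$ (i, j) = (\<Sum>l<d. B $$ (i, l) * B $$ (l, j))"
      using ij by (intro index_mult_mat_sum B) auto
    also have "\<dots> = 0"
    proof (intro sum.neutral ballI)
      fix l assume "l \<in> {..<d}"
      then show "B $$ (i, l) * B $$ (l, j) = 0"
        using z[of l i] z[of j l] ij by (cases "l < i") auto
    qed
    finally show "(B * B) $$ (i, j) = 0" .
  qed
  assume i: "i < d"
  have "(B * B) $$ (i, i) = (\<Sum>l<d. B $$ (i, l) * B $$ (l, i))"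
    using i by (intro index_mult_mat_sum B) auto
  also have "\<dots> = (\<Sum>l<d. if l = i then (B $$ (i, i))\<^sup>2 else 0)"
  proof (intro sum.cong refl)
    fix l assume "l \<in> {..<d}"
    then show "B $$ (i, l) * B $$ (l, i) = (if l = i then (B $$ (i, i))\<^sup>2 else 0)"
      using z[of l i] z[of i l] i by (cases l i rule: linorder_cases) (auto simp: power2_eq_square)
  qed
  also have "\<dots> = (B $$ (i, i))\<^sup>2" using i by simp
  finally show "(B * B) $$ (i, i) = (B $$ (i, i))\<^sup>2" .
qed

text \<open>The power of A with exponent 2^m. With repeated squaring, symmetry, triangular form and
  the Cauchy-Schwarz inequality are each needed for a single square only.\<close>

primrec iterated_square :: "nat \<Rightarrow> real mat \<Rightarrow> real mat" where
  "iterated_square 0 A = A"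
| "iterated_square (Suc m) A = iterated_square m A * iterated_square m A"

lemma iterated_square_carrier: "A \<in> carrier_mat d d \<Longrightarrow> iterated_square m A \<in> carrier_mat d d"
  by (induction m) auto

lemma iterated_square_sym:
  assumes A: "A \<in> carrier_mat d d" and sym: "\<And>i j. i < d \<Longrightarrow> j < d \<Longrightarrow> A $$ (i, j) = A $$ (j, i)"
  shows "i < d \<Longrightarrow> j < d \<Longrightarrow> iterated_square m A $$ (i, j) = iterated_square m A $$ (j, i)"
proof (induction m arbitrary: i j)
  case (Suc m)
  note c = iterated_square_carrier[OF A, of m]
  have "iterated_square (Suc m) A $$ (i, j) = (\<Sum>l<d. iterated_square m A $$ (i, l) * iterated_square m A $$ (l, j))"
    using Suc.prems by (simp only: iterated_square.simps index_mult_mat_sum[OF c c])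
  also have "\<dots> = (\<Sum>l<d. iterated_square m A $$ (j, l) * iterated_square m A $$ (l, i))"
    using Suc by (intro sum.cong refl) simp
  also have "\<dots> = iterated_square (Suc m) A $$ (j, i)"
    using Suc.prems by (simp only: iterated_square.simps index_mult_mat_sum[OF c c])
  finally show ?case .
qed (simp add: sym)

text \<open>A Schur decomposition with the prescribed eigenvalues on the diagonal. The same
  similarity triangularises every square, and squaring a triangular matrix squares its
  diagonal.\<close>

lemma trace_iterated_square:
  assumes A: "A \<in> carrier_mat d d" and cp: "char_poly A = (\<Prod>j=1..d. [:- e j, 1:])"
  shows "mat_trace d (iterated_square m A) = (\<Sum>j=1..d. (e j) ^ (2 ^ m))"
proof -
  define es where "es = map e [1..<Suc d]"
  have "(\<Prod>j=1..d. [:- e j, 1:]) = (\<Prod>j\<in>set [1..<Suc d]. [:- e j, 1:])"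
    by (intro prod.cong) auto
  also have "\<dots> = (\<Prod>a\<leftarrow>es. [:- a, 1:])"
    unfolding es_def by (subst prod.distinct_set_conv_list) (auto simp: comp_def)
  finally have cp': "char_poly A = (\<Prod>a\<leftarrow>es. [:- a, 1:])" using cp by simp
  obtain B P Q where "schur_decomposition A es = (B, P, Q)" by (cases "schur_decomposition A es") auto
  from schur_decomposition[OF A cp' this]
  have sim: "similar_mat_wit A B P Q" and ut: "upper_triangular B" and dg: "diag_mat B = es" by auto
  have B: "B \<in> carrier_mat d d" using sim A unfolding similar_mat_wit_def Let_def by auto
  have dg': "B $$ (i, i) = e (Suc i)" if "i < d" for i
  proof -
    have "B $$ (i, i) = diag_mat B ! i" using B that by (simp add: diag_mat_def)
    then show ?thesis using that by (simp add: dg es_def del: upt_Suc)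
  qed
  have "\<exists>B'. similar_mat_wit (iterated_square m A) B' P Q \<and> upper_triangular B' \<and>
      (\<forall>i<d. B' $$ (i, i) = (e (Suc i)) ^ (2 ^ m))"
  proof (induction m)
    case 0
    show ?case using sim ut dg' by (intro exI[of _ B]) auto
  next
    case (Suc m)
    then obtain B' where B': "similar_mat_wit (iterated_square m A) B' P Q" "upper_triangular B'"
      "\<And>i. i < d \<Longrightarrow> B' $$ (i, i) = (e (Suc i)) ^ (2 ^ m)" by auto
    have c: "B' \<in> carrier_mat d d"
      using B'(1) iterated_square_carrier[OF A, of m] unfolding similar_mat_wit_def Let_def by auto
    show ?case
      using similar_mat_wit_square[OF B'(1) iterated_square_carrier[OF A]] upper_triangular_square[OF c B'(2)] B'(3)
      by (intro exI[of _ "B' * B'"]) (simp add: power_mult[symmetric] mult.commute)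
  qed
  then obtain B' where B': "similar_mat_wit (iterated_square m A) B' P Q"
    "\<And>i. i < d \<Longrightarrow> B' $$ (i, i) = (e (Suc i)) ^ (2 ^ m)" by auto
  have "mat_trace d (iterated_square m A) = mat_trace d B'"
    by (rule mat_trace_similar[OF B'(1) iterated_square_carrier[OF A]])
  also have "\<dots> = (\<Sum>i<d. (e (Suc i)) ^ (2 ^ m))"
    unfolding mat_trace_def using B'(2) by (intro sum.cong) auto
  also have "\<dots> = (\<Sum>j=1..d. (e j) ^ (2 ^ m))"
    by (rule sum.reindex_bij_witness[of _ "\<lambda>j. j - 1" Suc]) auto
  finally show ?thesis .
qed

text \<open>If y < x, the powers of x / y would outgrow the constant. This absorbs the dimension
  factor that comes with the trace.\<close>

lemma le_of_power_le_const_mult: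
  fixes x y c :: real
  assumes "0 \<le> x" "0 \<le> y" and le: "\<And>m. x ^ (2 ^ m) \<le> c * y ^ (2 ^ m)"
  shows "x \<le> y"
proof (rule ccontr)
  assume "\<not> x \<le> y"
  then have xy: "y < x" by simp
  show False
  proof (cases "y = 0")
    case True
    then show False using le[of 0] xy by simp
  next
    case False
    then have y: "0 < y" using assms by simp
    then have "1 < x / y" using xy by simp
    then obtain n where n: "c < (x / y) ^ n" using real_arch_pow by blast
    also have "(x / y) ^ n \<le> (x / y) ^ (2 ^ n)"
      using \<open>1 < x / y\<close> by (intro power_increasing) (auto intro: less_imp_le)
    also have "\<dots> \<le> c" using le[of n] y by (simp add: power_divide divide_le_eq)
    finally show False by simp
  qed
qed

lemma bessel_two:
  fixes r q w :: "nat \<Rightarrow> real"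
  assumes "(\<Sum>i<d. (q i)\<^sup>2) = 1" "(\<Sum>i<d. (w i)\<^sup>2) = 1" "(\<Sum>i<d. q i * w i) = 0"
  shows "(\<Sum>i<d. r i * q i)\<^sup>2 + (\<Sum>i<d. r i * w i)\<^sup>2 \<le> (\<Sum>i<d. (r i)\<^sup>2)"
proof -
  define a where "a = (\<Sum>i<d. r i * q i)"
  define b where "b = (\<Sum>i<d. r i * w i)"
  have "0 \<le> (\<Sum>i<d. (r i - a * q i - b * w i)\<^sup>2)" by (intro sum_nonneg) auto
  also have "\<dots> = (\<Sum>i<d. (r i)\<^sup>2 + a\<^sup>2 * (q i)\<^sup>2 + b\<^sup>2 * (w i)\<^sup>2 - 2 * a * (r i * q i) - 2 * b * (r i * w i) + 2 * a * b * (q i * w i))"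
    by (intro sum.cong refl) (simp add: power2_eq_square algebra_simps)
  also have "\<dots> = (\<Sum>i<d. (r i)\<^sup>2) + a\<^sup>2 * 1 + b\<^sup>2 * 1 - 2 * a * a - 2 * b * b + 2 * a * b * 0"
    using assms by (simp add: sum.distrib sum_subtractf sum_distrib_left[symmetric] a_def[symmetric] b_def[symmetric])
  finally show ?thesis unfolding a_def[symmetric] b_def[symmetric] by (simp add: power2_eq_square)
qed

text \<open>The trace of a high power of \<open>A\<close> is the sum of the powers of the eigenvalues and bounds the
  contribution of any orthonormal pair; this replaces an orthonormal eigenbasis.\<close>

lemma quadratic_form_le_second_eigenvalue:
  fixes A :: "real mat" and q w :: "nat \<Rightarrow> real"
  assumes A: "A \<in> carrier_mat d d" and sym: "\<And>i j. i < d \<Longrightarrow> j < d \<Longrightarrow> A $$ (i, j) = A $$ (j, i)"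
    and cp: "char_poly A = (\<Prod>j=1..d. [:- e j, 1:])" and d: "1 \<le> d"
    and e: "\<And>j. j \<in> {2..d} \<Longrightarrow> 0 \<le> e j \<and> e j \<le> \<mu>" and \<mu>: "0 \<le> \<mu>"
    and eig: "\<And>i. i < d \<Longrightarrow> (\<Sum>j<d. A $$ (i, j) * q j) = e 1 * q i"
    and q: "(\<Sum>i<d. (q i)\<^sup>2) = 1" and w: "(\<Sum>i<d. (w i)\<^sup>2) = 1" and qw: "(\<Sum>i<d. q i * w i) = 0"
  shows "(\<Sum>i<d. \<Sum>j<d. w i * w j * A $$ (i, j)) \<le> \<mu>"
proof -
  define M where "M m i j = iterated_square m A $$ (i, j)" for m i j
  note c = iterated_square_carrier[OF A]
  have M0: "M 0 i j = A $$ (i, j)" for i j by (simp add: M_def)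
  have MS: "M (Suc m) i j = (\<Sum>l<d. M m i l * M m l j)" if "i < d" "j < d" for m i j
    unfolding M_def using that by (simp only: iterated_square.simps index_mult_mat_sum[OF c c])
  have Msym: "M m i j = M m j i" if "i < d" "j < d" for m i j
    unfolding M_def using iterated_square_sym[OF A sym] that by blast
  have Mq: "(\<Sum>j<d. M m i j * q j) = (e 1) ^ (2 ^ m) * q i" if "i < d" for m i
    using that
  proof (induction m arbitrary: i)
    case 0 then show ?case using eig by (simp add: M0)
  next
    case (Suc m)
    have "(\<Sum>j<d. M (Suc m) i j * q j) = (\<Sum>j<d. \<Sum>l<d. M m i l * (M m l j * q j))"
      using Suc.prems by (intro sum.cong refl) (simp add: MS sum_distrib_right mult.assoc)
    also have "\<dots> = (\<Sum>l<d. M m i l * (\<Sum>j<d. M m l j * q j))"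
      by (subst sum.swap) (simp add: sum_distrib_left)
    also have "\<dots> = (\<Sum>l<d. (e 1) ^ (2 ^ m) * (M m i l * q l))"
      using Suc.IH by (intro sum.cong refl) simp
    also have "\<dots> = (e 1) ^ (2 ^ m) * ((e 1) ^ (2 ^ m) * q i)"
      unfolding sum_distrib_left[symmetric] using Suc by simp
    finally show ?case by (simp add: power_add[symmetric] mult_2 mult.assoc[symmetric])
  qed
  define v where "v m i = (\<Sum>j<d. M m i j * w j)" for m i
  \<comment> \<open>The quadratic form at w of the power of A with exponent 2^m.\<close>
  define cc where "cc m = (\<Sum>i<d. w i * v m i)" for m
  have vv: "(\<Sum>i<d. (v m i)\<^sup>2) = cc (Suc m)" for m
  proof -
    have "cc (Suc m) = (\<Sum>i<d. \<Sum>j<d. \<Sum>l<d. w i * (M m i l * M m l j * w j))"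
      unfolding cc_def v_def by (intro sum.cong refl) (simp add: MS sum_distrib_left sum_distrib_right)
    also have "\<dots> = (\<Sum>i<d. \<Sum>l<d. \<Sum>j<d. w i * (M m i l * M m l j * w j))"
      by (intro sum.cong refl sum.swap)
    also have "\<dots> = (\<Sum>l<d. \<Sum>i<d. \<Sum>j<d. w i * (M m i l * M m l j * w j))"
      by (rule sum.swap)
    also have "\<dots> = (\<Sum>l<d. (v m l)\<^sup>2)"
    proof (intro sum.cong refl)
      fix l assume l: "l \<in> {..<d}"
      have "(v m l)\<^sup>2 = (\<Sum>i<d. \<Sum>j<d. (M m l i * w i) * (M m l j * w j))"
        unfolding v_def power2_eq_square sum_product ..
      also have "\<dots> = (\<Sum>i<d. \<Sum>j<d. w i * (M m i l * M m l j * w j))"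
        using l by (intro sum.cong refl) (simp add: Msym[of l])
      finally show "(\<Sum>i<d. \<Sum>j<d. w i * (M m i l * M m l j * w j)) = (v m l)\<^sup>2" ..
    qed
    finally show ?thesis ..
  qed
  \<comment> \<open>Cauchy-Schwarz for the unit vector w and its image: squaring the form at w is
    dominated by squaring the matrix.\<close>
  have cs: "(cc m)\<^sup>2 \<le> cc (Suc m)" for m
    using Cauchy_Schwarz_ineq_sum[of w "v m" "{..<d}"] unfolding cc_def[symmetric] w vv by simp
  have chain: "((cc 0)\<^sup>2) ^ (2 ^ m) \<le> cc (Suc m)" for m
  proof (induction m)
    case 0 then show ?case using cs[of 0] by simp
  next
    case (Suc m)
    have "((cc 0)\<^sup>2) ^ (2 ^ Suc m) = (((cc 0)\<^sup>2) ^ (2 ^ m))\<^sup>2" by (simp add: power_mult[symmetric] mult.commute)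
    also have "\<dots> \<le> (cc (Suc m))\<^sup>2" using Suc by (intro power_mono) auto
    also have "\<dots> \<le> cc (Suc (Suc m))" by (rule cs)
    finally show ?case .
  qed
  have bound: "cc (Suc m) \<le> real d * (\<mu>\<^sup>2) ^ (2 ^ m)" for m
  proof -
    have sq: "((e j) ^ (2 ^ m))\<^sup>2 = (e j) ^ (2 ^ Suc m)" for j
      by (simp add: power_mult[symmetric] mult.commute)
    have "(e 1) ^ (2 ^ Suc m) + cc (Suc m) = (\<Sum>i<d. ((e 1) ^ (2 ^ m) * q i)\<^sup>2 + (v m i)\<^sup>2)"
      unfolding sum.distrib vv power_mult_distrib sum_distrib_left[symmetric] q sq by simp
    \<comment> \<open>Bessel's inequality for the orthonormal pair q, w, applied to each row. The
      squared entries of a symmetric matrix sum to the trace of its square.\<close>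
    also have "\<dots> \<le> (\<Sum>i<d. \<Sum>j<d. (M m i j)\<^sup>2)"
    proof (intro sum_mono)
      fix i assume "i \<in> {..<d}"
      then have i: "i < d" by simp
      show "((e 1) ^ (2 ^ m) * q i)\<^sup>2 + (v m i)\<^sup>2 \<le> (\<Sum>j<d. (M m i j)\<^sup>2)"
        using bessel_two[OF q w qw, of "M m i"] unfolding Mq[OF i] v_def .
    qed
    also have "\<dots> = (\<Sum>i<d. M (Suc m) i i)"
      by (intro sum.cong refl) (auto simp: MS power2_eq_square Msym intro!: sum.cong)
    also have "\<dots> = (\<Sum>j=1..d. (e j) ^ (2 ^ Suc m))"
      using trace_iterated_square[OF A cp, of "Suc m"] unfolding mat_trace_def M_def .
    also have "{1..d} = insert 1 {2..d}" using d by auto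
    also have "(\<Sum>j\<in>insert 1 {2..d}. (e j) ^ (2 ^ Suc m)) = (e 1) ^ (2 ^ Suc m) + (\<Sum>j=2..d. (e j) ^ (2 ^ Suc m))"
      by (rule sum.insert) auto
    \<comment> \<open>The power of the leading eigenvalue stands on both sides, once from q and once
      from the trace, and cancels exactly; only the lower eigenvalues remain.\<close>
    finally have "cc (Suc m) \<le> (\<Sum>j=2..d. (e j) ^ (2 ^ Suc m))" by simp
    also have "\<dots> \<le> (\<Sum>j=2..d. \<mu> ^ (2 ^ Suc m))"
      using e by (intro sum_mono power_mono) auto
    also have "\<dots> = real (card {2..d}) * \<mu> ^ (2 ^ Suc m)" by simp
    also have "\<dots> \<le> real d * \<mu> ^ (2 ^ Suc m)"
      using \<mu> by (intro mult_right_mono) auto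
    also have "\<mu> ^ (2 ^ Suc m) = (\<mu>\<^sup>2) ^ (2 ^ m)" by (simp add: power_mult[symmetric])
    finally show ?thesis .
  qed
  have "(cc 0)\<^sup>2 \<le> \<mu>\<^sup>2"
    by (rule le_of_power_le_const_mult[of _ _ "real d"]) (use order_trans[OF chain bound] in auto)
  then have "cc 0 \<le> \<mu>" using \<mu> abs_le_square_iff[of "cc 0" \<mu>] by simp
  moreover have "cc 0 = (\<Sum>i<d. \<Sum>j<d. w i * w j * A $$ (i, j))"
    unfolding cc_def v_def M0 by (simp add: sum_distrib_left mult_ac)
  ultimately show ?thesis by simp
qed

section \<open>Curvature of the risk at the leading eigenvector\<close>

definition sqnorm :: "nat \<Rightarrow> (nat \<Rightarrow> real) \<Rightarrow> real" where
  "sqnorm p a = (\<Sum>i<p. (a i)\<^sup>2)"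

definition quartic_risk :: "nat \<Rightarrow> (nat \<Rightarrow> nat \<Rightarrow> real) \<Rightarrow> (nat \<Rightarrow> real) \<Rightarrow> real" where
  "quartic_risk p S b = - (1/2) * bilin {..<p} S b b + (1/4) * (sqnorm p b)\<^sup>2"

lemma sqnorm_nonneg: "0 \<le> sqnorm p a"
  unfolding sqnorm_def by (intro sum_nonneg) auto

lemma bilin_diff_matrix: "bilin I (\<lambda>i j. S i j - C i j) a b = bilin I S a b - bilin I C a b"
  unfolding bilin_def sum_subtractf[symmetric] by (intro sum.cong refl) (simp add: algebra_simps)

lemma bilin_scale_matrix: "bilin I (\<lambda>i j. c * C i j) a b = c * bilin I C a b"
  unfolding bilin_def sum_distrib_left by (intro sum.cong refl) simp

lemma bilin_shift_sym:
  assumes "\<And>i j. i \<in> I \<Longrightarrow> j \<in> I \<Longrightarrow> W i j = W j i"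
  shows "bilin I W b b = bilin I W c c + 2 * bilin I W (\<lambda>i. b i - c i) c + bilin I W (\<lambda>i. b i - c i) (\<lambda>i. b i - c i)"
proof -
  have "bilin I W c (\<lambda>i. b i - c i) = bilin I W (\<lambda>i. b i - c i) c"
    unfolding bilin_def by (subst sum.swap) (intro sum.cong refl, simp add: assms mult_ac)
  then show ?thesis using bilin_add2[of I W c "\<lambda>i. b i - c i"] by simp
qed

text \<open>What the deterministic analysis uses of the population covariance C. The gap is kept as
  \<phi>^2 - \<sigma> \<phi>, which dominates (\<phi> - \<sigma>)^2 when 0 < \<sigma> \<le> \<phi>,
  so that the curvature becomes linear in \<sigma>.\<close>

locale leading_eigenvector =
  fixes p :: nat and C :: "nat \<Rightarrow> nat \<Rightarrow> real" and q :: "nat \<Rightarrow> real" and \<phi> \<sigma> \<eta> :: real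
  assumes C_sym: "\<And>i j. i < p \<Longrightarrow> j < p \<Longrightarrow> C i j = C j i"
    and C_psd: "\<And>a. 0 \<le> bilin {..<p} C a a"
    and C_eig: "\<And>i. i < p \<Longrightarrow> (\<Sum>j<p. C i j * q j) = \<phi>\<^sup>2 * q i"
    and q_unit: "sqnorm p q = 1"
    and C_gap: "\<And>w. (\<Sum>i<p. q i * w i) = 0 \<Longrightarrow> bilin {..<p} C w w \<le> (\<phi>\<^sup>2 - \<sigma> * \<phi>) * sqnorm p w"
    and eta: "0 < \<eta>" "3 * \<eta> < \<sigma>" and sigma: "\<sigma> \<le> \<phi>"
begin

lemma phi_pos: "0 < \<phi>" and eta_phi: "3 * \<eta> \<le> \<phi>"
  using eta sigma by linarith+

text \<open>Splits e into x q and a remainder w orthogonal to q, with r = |w|^2 and B the form of C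
  at w. As q is an eigenvector, the cross terms vanish both in the norm and in the form, and
  everything depends on the three numbers x, r, B only.\<close>

lemma decompose:
  obtains x r B where "sqnorm p e = x\<^sup>2 + r" "0 \<le> r" "0 \<le> B" "B \<le> (\<phi>\<^sup>2 - \<sigma> * \<phi>) * r"
    "\<And>c. sqnorm p (\<lambda>i. c * q i + e i) = (c + x)\<^sup>2 + r"
    "\<And>c. bilin {..<p} C (\<lambda>i. c * q i + e i) (\<lambda>i. c * q i + e i) = \<phi>\<^sup>2 * (c + x)\<^sup>2 + B"
proof -
  define x where "x = (\<Sum>i<p. q i * e i)"
  define w where "w i = e i - x * q i" for i
  define r where "r = sqnorm p w"
  define B where "B = bilin {..<p} C w w"
  have qq: "(\<Sum>i<p. q i * q i) = 1" using q_unit by (simp add: sqnorm_def power2_eq_square)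
  have qw: "(\<Sum>i<p. q i * w i) = 0"
  proof -
    have "(\<Sum>i<p. q i * w i) = x - x * (\<Sum>i<p. q i * q i)"
      unfolding w_def x_def sum_distrib_left sum_subtractf[symmetric]
      by (intro sum.cong refl) (simp add: algebra_simps)
    then show ?thesis using qq by simp
  qed
  have s: "sqnorm p (\<lambda>i. a * q i + w i) = a\<^sup>2 + r" for a
  proof -
    have "sqnorm p (\<lambda>i. a * q i + w i) = a\<^sup>2 * (\<Sum>i<p. q i * q i) + 2 * a * (\<Sum>i<p. q i * w i) + r"
      unfolding sqnorm_def r_def sum_distrib_left sum.distrib[symmetric]
      by (intro sum.cong refl) (simp add: power2_eq_square algebra_simps)
    then show ?thesis using qq qw by simp
  qed
  have bq: "bilin {..<p} C a q = \<phi>\<^sup>2 * (\<Sum>i<p. a i * q i)" for a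
  proof -
    have "bilin {..<p} C a q = (\<Sum>i<p. a i * (\<Sum>j<p. C i j * q j))"
      unfolding bilin_def by (simp add: sum_distrib_left mult_ac)
    also have "\<dots> = (\<Sum>i<p. a i * (\<phi>\<^sup>2 * q i))" using C_eig by (intro sum.cong refl) simp
    finally show ?thesis by (simp add: sum_distrib_left mult_ac)
  qed
  have bb: "bilin {..<p} C (\<lambda>i. a * q i + w i) (\<lambda>i. a * q i + w i) = \<phi>\<^sup>2 * a\<^sup>2 + B" for a
  proof -
    have sw: "bilin {..<p} C q w = bilin {..<p} C w q"
      unfolding bilin_def by (subst sum.swap) (intro sum.cong refl, simp add: C_sym mult_ac)
    have "bilin {..<p} C (\<lambda>i. a * q i + w i) (\<lambda>i. a * q i + w i)
        = a\<^sup>2 * bilin {..<p} C q q + a * bilin {..<p} C q w + a * bilin {..<p} C w q + B"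
      unfolding B_def bilin_def sum_distrib_left sum.distrib[symmetric]
      by (intro sum.cong refl) (simp add: algebra_simps power2_eq_square)
    then show ?thesis unfolding sw bq using qq qw by (simp add: mult.commute)
  qed
  have ce: "(\<lambda>i. c * q i + e i) = (\<lambda>i. (c + x) * q i + w i)" for c
    by (simp add: w_def fun_eq_iff algebra_simps)
  show thesis
  proof (rule that[of x r B])
    show "sqnorm p e = x\<^sup>2 + r" using s[of x] by (simp add: w_def)
    show "0 \<le> r" "0 \<le> B" unfolding r_def B_def by (simp_all add: sqnorm_nonneg C_psd)
    show "B \<le> (\<phi>\<^sup>2 - \<sigma> * \<phi>) * r" unfolding B_def r_def by (rule C_gap[OF qw])
    show "sqnorm p (\<lambda>i. c * q i + e i) = (c + x)\<^sup>2 + r" for c unfolding ce by (rule s)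
    show "bilin {..<p} C (\<lambda>i. c * q i + e i) (\<lambda>i. c * q i + e i) = \<phi>\<^sup>2 * (c + x)\<^sup>2 + B" for c
      unfolding ce by (rule bb)
  qed
qed

lemma gap_nonneg: "0 \<le> \<phi>\<^sup>2 - \<sigma> * \<phi>" "\<phi>\<^sup>2 - \<sigma> * \<phi> \<le> \<phi>\<^sup>2"
  using sigma phi_pos eta by (simp_all add: power2_eq_square)

lemma bilin_le: "bilin {..<p} C u u \<le> \<phi>\<^sup>2 * sqnorm p u"
proof -
  obtain x r B where d: "sqnorm p u = x\<^sup>2 + r" "0 \<le> r" "0 \<le> B" "B \<le> (\<phi>\<^sup>2 - \<sigma> * \<phi>) * r"
    "\<And>c. sqnorm p (\<lambda>i. c * q i + u i) = (c + x)\<^sup>2 + r"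
    "\<And>c. bilin {..<p} C (\<lambda>i. c * q i + u i) (\<lambda>i. c * q i + u i) = \<phi>\<^sup>2 * (c + x)\<^sup>2 + B"
    by (rule decompose[of u, OF that])
  have "B \<le> \<phi>\<^sup>2 * r" using d(4) mult_right_mono[OF gap_nonneg(2) d(2)] by linarith
  then show ?thesis using d(1) d(6)[of 0] by (simp add: algebra_simps)
qed

lemma bilin_q: "bilin {..<p} C (\<lambda>i. c * q i) (\<lambda>i. c * q i) = \<phi>\<^sup>2 * c\<^sup>2"
proof -
  obtain x r B where d: "sqnorm p (\<lambda>_. 0) = x\<^sup>2 + r" "0 \<le> r" "0 \<le> B" "B \<le> (\<phi>\<^sup>2 - \<sigma> * \<phi>) * r"
    "\<And>c. sqnorm p (\<lambda>i. c * q i + 0) = (c + x)\<^sup>2 + r"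
    "\<And>c. bilin {..<p} C (\<lambda>i. c * q i + 0) (\<lambda>i. c * q i + 0) = \<phi>\<^sup>2 * (c + x)\<^sup>2 + B"
    by (rule decompose[of "\<lambda>_. 0", OF that])
  have "x\<^sup>2 + r = 0" using d(1) by (simp add: sqnorm_def)
  then have "x = 0" "r = 0" using d(2) by (auto simp: add_nonneg_eq_0_iff)
  then show ?thesis using d by simp
qed

lemma sqnorm_q: "sqnorm p (\<lambda>i. c * q i) = c\<^sup>2"
  using q_unit by (simp add: sqnorm_def power_mult_distrib sum_distrib_left[symmetric])

lemma risk_q: "quartic_risk p C (\<lambda>i. \<phi> * q i) = - (1/4) * \<phi>^4"
  unfolding quartic_risk_def bilin_q sqnorm_q by (simp add: power2_eq_square power4_eq_xxxx)

text \<open>Let x be the component of e along q, w the rest, D = |e|^2. The risk exceeds its value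
  at \<phi> q by (2 \<phi> x + D)^2 / 4 + (\<phi>^2 |w|^2 - C(w,w)) / 2: the square curves along q,
  the gap curves across it. Only the cubic term \<phi> x D can be negative, and |x| \<le> \<eta>
  limits it to \<phi> \<eta> D. In the upper bound the square contributes 5/2 and the second term
  1/2.\<close>

lemma risk_bounds:
  assumes e: "sqnorm p e \<le> \<eta>\<^sup>2"
  shows "quartic_risk p C (\<lambda>i. \<phi> * q i) + \<phi> * (\<sigma> - 3 * \<eta>) / 2 * sqnorm p e \<le> quartic_risk p C (\<lambda>i. \<phi> * q i + e i)"
    and "quartic_risk p C (\<lambda>i. \<phi> * q i + e i) \<le> quartic_risk p C (\<lambda>i. \<phi> * q i) + 3 * \<phi>\<^sup>2 * sqnorm p e"
proof -
  obtain x r B where d: "sqnorm p e = x\<^sup>2 + r" "0 \<le> r" "0 \<le> B" "B \<le> (\<phi>\<^sup>2 - \<sigma> * \<phi>) * r"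
    "\<And>c. sqnorm p (\<lambda>i. c * q i + e i) = (c + x)\<^sup>2 + r"
    "\<And>c. bilin {..<p} C (\<lambda>i. c * q i + e i) (\<lambda>i. c * q i + e i) = \<phi>\<^sup>2 * (c + x)\<^sup>2 + B"
    by (rule decompose[of e, OF that])
  define D where "D = x\<^sup>2 + r"
  have D: "0 \<le> D" "D \<le> \<eta>\<^sup>2" "x\<^sup>2 \<le> D" "sqnorm p e = D" using d(1,2) e by (auto simp: D_def)
  have xe: "\<bar>x\<bar> \<le> \<eta>"
    using D eta abs_le_square_iff[of x \<eta>] by simp
  have eq: "quartic_risk p C (\<lambda>i. \<phi> * q i + e i) - quartic_risk p C (\<lambda>i. \<phi> * q i)
      = (1/4) * (2 * \<phi> * x + D)\<^sup>2 + (1/2) * \<phi>\<^sup>2 * r - (1/2) * B"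
    unfolding risk_q unfolding quartic_risk_def d(5,6) D_def
    by (simp add: power2_eq_square power4_eq_xxxx algebra_simps)
  have sq: "(1/4) * (2 * \<phi> * x + D)\<^sup>2 = \<phi>\<^sup>2 * x\<^sup>2 + \<phi> * x * D + (1/4) * D\<^sup>2"
    by (simp add: power2_eq_square algebra_simps)
  have "- (\<phi> * \<eta> * D) \<le> \<phi> * x * D"
  proof -
    have "(- \<eta>) * (\<phi> * D) \<le> x * (\<phi> * D)" using xe phi_pos D by (intro mult_right_mono) auto
    then show ?thesis by (simp add: mult_ac)
  qed
  moreover have "\<sigma> * \<phi> * x\<^sup>2 \<le> \<phi>\<^sup>2 * x\<^sup>2"
    using gap_nonneg(1) by (intro mult_right_mono) auto
  moreover have "(1/2) * (\<sigma> * \<phi>) * r \<le> (1/2) * \<phi>\<^sup>2 * r - (1/2) * B"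
    using d(4) by (simp add: algebra_simps)
  moreover have "0 \<le> \<sigma> * \<phi> * x\<^sup>2" using eta sigma phi_pos by (intro mult_nonneg_nonneg) auto
  moreover have "0 \<le> \<phi> * \<eta> * D" using eta phi_pos D by (intro mult_nonneg_nonneg) auto
  ultimately have "(1/2) * (\<sigma> * \<phi>) * D - (3/2) * (\<phi> * \<eta> * D)
      \<le> quartic_risk p C (\<lambda>i. \<phi> * q i + e i) - quartic_risk p C (\<lambda>i. \<phi> * q i)"
  proof -
    assume "- (\<phi> * \<eta> * D) \<le> \<phi> * x * D" "\<sigma> * \<phi> * x\<^sup>2 \<le> \<phi>\<^sup>2 * x\<^sup>2"
      "(1/2) * (\<sigma> * \<phi>) * r \<le> (1/2) * \<phi>\<^sup>2 * r - (1/2) * B" "0 \<le> \<sigma> * \<phi> * x\<^sup>2" "0 \<le> \<phi> * \<eta> * D"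
    moreover have "(1/2) * (\<sigma> * \<phi>) * D = (1/2) * (\<sigma> * \<phi> * x\<^sup>2) + (1/2) * (\<sigma> * \<phi>) * r"
      by (simp add: D_def algebra_simps)
    moreover have "0 \<le> (1/4) * D\<^sup>2" by simp
    ultimately show ?thesis unfolding eq sq by linarith
  qed
  then show "quartic_risk p C (\<lambda>i. \<phi> * q i) + \<phi> * (\<sigma> - 3 * \<eta>) / 2 * sqnorm p e \<le> quartic_risk p C (\<lambda>i. \<phi> * q i + e i)"
  proof -
    assume "(1/2) * (\<sigma> * \<phi>) * D - (3/2) * (\<phi> * \<eta> * D)
      \<le> quartic_risk p C (\<lambda>i. \<phi> * q i + e i) - quartic_risk p C (\<lambda>i. \<phi> * q i)"
    moreover have "\<phi> * (\<sigma> - 3 * \<eta>) / 2 * D = (1/2) * (\<sigma> * \<phi>) * D - (3/2) * (\<phi> * \<eta> * D)"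
      by (simp add: algebra_simps diff_divide_distrib)
    ultimately show ?thesis unfolding D(4) by linarith
  qed
  have "(2 * \<phi> * x + D)\<^sup>2 \<le> 2 * (2 * \<phi> * x)\<^sup>2 + 2 * D\<^sup>2"
    using zero_le_power2[of "2 * \<phi> * x - D"] by (simp add: power2_eq_square algebra_simps)
  also have "\<dots> \<le> 8 * \<phi>\<^sup>2 * D + 2 * (\<phi>\<^sup>2 * D)"
  proof -
    have "\<phi>\<^sup>2 * x\<^sup>2 \<le> \<phi>\<^sup>2 * D" using D by (intro mult_left_mono) auto
    moreover have "D * D \<le> \<phi>\<^sup>2 * D"
    proof (rule mult_right_mono)
      have "\<eta>\<^sup>2 \<le> \<phi>\<^sup>2" using eta eta_phi by (intro power_mono) auto
      then show "D \<le> \<phi>\<^sup>2" using D by linarith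
    qed (use D in auto)
    ultimately show ?thesis by (simp add: power2_eq_square power_mult_distrib mult_ac)
  qed
  finally have "(1/4) * (2 * \<phi> * x + D)\<^sup>2 \<le> (5/2) * \<phi>\<^sup>2 * D" by (simp add: mult_ac)
  moreover have "\<phi>\<^sup>2 * r \<le> \<phi>\<^sup>2 * D" unfolding D_def by (intro mult_left_mono) auto
  ultimately have "quartic_risk p C (\<lambda>i. \<phi> * q i + e i) - quartic_risk p C (\<lambda>i. \<phi> * q i) \<le> 3 * \<phi>\<^sup>2 * D"
    unfolding eq using d(3) by simp
  then show "quartic_risk p C (\<lambda>i. \<phi> * q i + e i) \<le> quartic_risk p C (\<lambda>i. \<phi> * q i) + 3 * \<phi>\<^sup>2 * sqnorm p e"
    unfolding D(4) by simp
qed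

text \<open>On the ball the form of C is largest at the boundary point (\<phi> + \<eta>) q, with a
  deficit quadratic in the distance from it. Staying in the ball forces that squared distance to be
  at most 2 \<eta> (\<eta> - x), so the first-order loss 2 \<phi>^3 (\<eta> - x) pays for \<phi>^3 /
  \<eta> times the squared distance.\<close>

lemma quadratic_form_gap:
  assumes e: "sqnorm p e \<le> \<eta>\<^sup>2"
  shows "bilin {..<p} C (\<lambda>i. \<phi> * q i + e i) (\<lambda>i. \<phi> * q i + e i)
    + \<phi>^3 / \<eta> * sqnorm p (\<lambda>i. \<phi> * q i + e i - (\<phi> + \<eta>) * q i) \<le> \<phi>\<^sup>2 * (\<phi> + \<eta>)\<^sup>2"
proof -
  obtain x r B where d: "sqnorm p e = x\<^sup>2 + r" "0 \<le> r" "0 \<le> B" "B \<le> (\<phi>\<^sup>2 - \<sigma> * \<phi>) * r"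
    "\<And>c. sqnorm p (\<lambda>i. c * q i + e i) = (c + x)\<^sup>2 + r"
    "\<And>c. bilin {..<p} C (\<lambda>i. c * q i + e i) (\<lambda>i. c * q i + e i) = \<phi>\<^sup>2 * (c + x)\<^sup>2 + B"
    by (rule decompose[of e, OF that])
  have "(\<lambda>i. \<phi> * q i + e i - (\<phi> + \<eta>) * q i) = (\<lambda>i. (- \<eta>) * q i + e i)"
    by (simp add: fun_eq_iff algebra_simps)
  then have D: "sqnorm p (\<lambda>i. \<phi> * q i + e i - (\<phi> + \<eta>) * q i) = (- \<eta> + x)\<^sup>2 + r"
    using d(5)[of "- \<eta>"] by simp
  have xr: "x\<^sup>2 + r \<le> \<eta>\<^sup>2" using e d(1) by simp
  have "(- \<eta> + x)\<^sup>2 + r \<le> 2 * \<eta> * (\<eta> - x)"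
    using xr by (simp add: power2_eq_square algebra_simps)
  then have "\<phi>^3 / \<eta> * ((- \<eta> + x)\<^sup>2 + r) \<le> \<phi>^3 / \<eta> * (2 * \<eta> * (\<eta> - x))"
    using phi_pos eta by (intro mult_left_mono) auto
  also have "\<dots> = \<phi>\<^sup>2 * (2 * \<phi> * (\<eta> - x))" using eta by (simp add: power2_eq_square power3_eq_cube)
  finally have 1: "\<phi>^3 / \<eta> * ((- \<eta> + x)\<^sup>2 + r) \<le> \<phi>\<^sup>2 * (2 * \<phi> * (\<eta> - x))" .
  have 2: "B \<le> \<phi>\<^sup>2 * r" using d(4) mult_right_mono[OF gap_nonneg(2) d(2)] by linarith
  have "\<phi>\<^sup>2 * (2 * \<phi> * (\<eta> - x) + r + (\<phi> + x)\<^sup>2) \<le> \<phi>\<^sup>2 * (\<phi> + \<eta>)\<^sup>2"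
    using xr by (intro mult_left_mono) (auto simp: power2_eq_square algebra_simps)
  then show ?thesis unfolding D d(6) using 1 2 by (simp add: algebra_simps)
qed

text \<open>The basic inequality against the competitor \<open>e'\<close>: curvature bounds the risk
  at e from below, the quadratic upper bound controls it at \<open>e'\<close>, and the noise is
  linear in the norms up to a constant. If d = |e| exceeded \<gamma> \<phi> / \<mu>, the curvature
  term would be at least \<gamma> \<phi> d / 2, whereas each of the three remaining terms is at most
  \<gamma> \<phi> d / 100.\<close>

lemma estimator_error:
  fixes S :: "nat \<Rightarrow> nat \<Rightarrow> real" and \<theta> \<gamma> :: real
  assumes S: "\<And>i j. i < p \<Longrightarrow> j < p \<Longrightarrow> S i j = S j i"
    and \<theta>: "\<theta> = 1 / 1000" and \<gamma>: "0 < \<gamma>" "\<gamma> < \<sigma> - 3 * \<eta>"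
    and e: "sqnorm p e \<le> \<eta>\<^sup>2"
    and e': "sqnorm p e' \<le> \<eta>\<^sup>2" "sqrt (sqnorm p e') \<le> 64 * \<theta> * \<gamma> * \<eta> / \<phi>"
    and le: "quartic_risk p S (\<lambda>i. \<phi> * q i + e i) \<le> quartic_risk p S (\<lambda>i. \<phi> * q i + e' i)"
    and W: "\<And>a b. a = e \<or> a = e' \<Longrightarrow> b = a \<or> b = (\<lambda>i. \<phi> * q i) \<Longrightarrow>
      \<bar>bilin {..<p} (\<lambda>i j. S i j - C i j) a b\<bar> \<le> 4 * \<theta> * \<phi> * \<gamma> * sqrt (sqnorm p a) * sqrt (sqnorm p b)"
  shows "sqrt (sqnorm p e) \<le> \<gamma> * \<phi> / (\<sigma> - 3 * \<eta>)"
proof -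
  define \<mu> where "\<mu> = \<sigma> - 3 * \<eta>"
  have \<mu>: "0 < \<mu>" "\<mu> \<le> \<phi>" "\<gamma> < \<mu>" using eta sigma \<gamma> by (auto simp: \<mu>_def)
  let ?W = "\<lambda>i j. S i j - C i j"
  let ?b0 = "\<lambda>i. \<phi> * q i"
  define \<omega> where "\<omega> = 4 * \<theta> * \<phi> * \<gamma>"
  have w0: "0 \<le> \<omega>" using \<theta> phi_pos \<gamma> by (simp add: \<omega>_def)
  define f where "f a = 2 * bilin {..<p} ?W a ?b0 + bilin {..<p} ?W a a" for a
  have sb0: "sqrt (sqnorm p ?b0) = \<phi>" using phi_pos by (simp add: sqnorm_q)
  have diff: "quartic_risk p S (\<lambda>i. ?b0 i + a i) - quartic_risk p S ?b0
      = quartic_risk p C (\<lambda>i. ?b0 i + a i) - quartic_risk p C ?b0 - (1/2) * f a" for a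
  proof -
    have "bilin {..<p} ?W (\<lambda>i. ?b0 i + a i) (\<lambda>i. ?b0 i + a i) = bilin {..<p} ?W ?b0 ?b0 + f a"
      using bilin_shift_sym[of "{..<p}" ?W "\<lambda>i. ?b0 i + a i" ?b0] S C_sym by (simp add: f_def)
    then show ?thesis unfolding quartic_risk_def bilin_diff_matrix by simp
  qed
  \<comment> \<open>The factor 7/3 is 2 + 1/3: twice the cross term with \<phi> q, plus the
    quadratic term, where |a| \<le> \<eta> \<le> \<phi> / 3.\<close>
  have fb: "\<bar>f a\<bar> \<le> \<omega> * sqrt (sqnorm p a) * (7/3 * \<phi>)" if a: "a = e \<or> a = e'" for a
  proof -
    have s: "0 \<le> sqrt (sqnorm p a)" "sqrt (sqnorm p a) \<le> \<eta>"
      using a e e'(1) eta by (auto simp: sqnorm_nonneg intro!: real_le_lsqrt)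
    have "\<bar>f a\<bar> \<le> 2 * (\<omega> * sqrt (sqnorm p a) * \<phi>) + \<omega> * sqrt (sqnorm p a) * sqrt (sqnorm p a)"
    proof -
      have "\<bar>bilin {..<p} ?W a ?b0\<bar> \<le> \<omega> * sqrt (sqnorm p a) * \<phi>"
        using W[OF a, of ?b0] unfolding \<omega>_def[symmetric] sb0 by simp
      moreover have "\<bar>bilin {..<p} ?W a a\<bar> \<le> \<omega> * sqrt (sqnorm p a) * sqrt (sqnorm p a)"
        using W[OF a, of a] unfolding \<omega>_def[symmetric] by simp
      ultimately show ?thesis unfolding f_def by linarith
    qed
    also have "\<dots> = \<omega> * sqrt (sqnorm p a) * (2 * \<phi> + sqrt (sqnorm p a))" by (simp add: algebra_simps)
    also have "\<dots> \<le> \<omega> * sqrt (sqnorm p a) * (7/3 * \<phi>)"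
      using s w0 eta_phi by (intro mult_left_mono) auto
    finally show ?thesis .
  qed
  define d where "d = sqrt (sqnorm p e)"
  define y where "y = sqrt (sqnorm p e')"
  have d2: "d\<^sup>2 = sqnorm p e" and y2: "y\<^sup>2 = sqnorm p e'" by (simp_all add: d_def y_def sqnorm_nonneg)
  have d0: "0 \<le> d" and y0: "0 \<le> y" by (simp_all add: d_def y_def sqnorm_nonneg)
  have yb: "y * \<phi> \<le> 64 * \<theta> * \<gamma> * \<eta>" using e'(2) phi_pos by (simp add: y_def field_simps)
  have "\<phi> * \<mu> / 2 * d\<^sup>2 \<le> 3 * \<phi>\<^sup>2 * y\<^sup>2 + (1/2) * (\<omega> * d * (7/3 * \<phi>)) + (1/2) * (\<omega> * y * (7/3 * \<phi>))"
  proof -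
    have "quartic_risk p C ?b0 + \<phi> * \<mu> / 2 * d\<^sup>2 \<le> quartic_risk p C (\<lambda>i. ?b0 i + e i)"
      using risk_bounds(1)[OF e] unfolding d2 \<mu>_def .
    moreover have "quartic_risk p C (\<lambda>i. ?b0 i + e' i) \<le> quartic_risk p C ?b0 + 3 * \<phi>\<^sup>2 * y\<^sup>2"
      using risk_bounds(2)[OF e'(1)] unfolding y2 .
    moreover have "\<bar>f e\<bar> \<le> \<omega> * d * (7/3 * \<phi>)" "\<bar>f e'\<bar> \<le> \<omega> * y * (7/3 * \<phi>)"
      unfolding d_def y_def by (rule fb, simp)+
    ultimately show ?thesis using le diff[of e] diff[of e'] by linarith
  qed
  also have "\<dots> = \<phi> * (3 * \<phi> * y\<^sup>2 + (7/6) * \<omega> * d + (7/6) * \<omega> * y)" by (simp add: algebra_simps power2_eq_square)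
  finally have "\<phi> * (\<mu> / 2 * d\<^sup>2) \<le> \<phi> * (3 * \<phi> * y\<^sup>2 + (7/6) * \<omega> * d + (7/6) * \<omega> * y)" by (simp add: mult.assoc)
  then have main: "\<mu> / 2 * d\<^sup>2 \<le> 3 * \<phi> * y\<^sup>2 + (7/6) * \<omega> * d + (7/6) * \<omega> * y"
    using phi_pos by simp
  show ?thesis
  proof (rule ccontr)
    assume "\<not> sqrt (sqnorm p e) \<le> \<gamma> * \<phi> / (\<sigma> - 3 * \<eta>)"
    then have "\<gamma> * \<phi> / \<mu> < d" unfolding d_def \<mu>_def by simp
    then have dl: "\<gamma> * \<phi> < \<mu> * d" using \<mu> by (simp add: field_simps)
    have dp: "0 < d" using dl mult_pos_pos[OF \<gamma>(1) phi_pos] d0 by (cases "d = 0") auto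
    have y\<gamma>: "y \<le> 64 * \<theta> * \<gamma> / 3"
    proof -
      have "y * \<phi> \<le> 64 * \<theta> * \<gamma> / 3 * \<phi>"
      proof -
        have "0 \<le> 64 * \<theta> * \<gamma> / 3" using \<theta> \<gamma> by simp
        from mult_left_mono[OF eta_phi this] have "64 * \<theta> * \<gamma> * \<eta> \<le> 64 * \<theta> * \<gamma> / 3 * \<phi>" by simp
        then show ?thesis using yb by (rule order_trans[rotated])
      qed
      then show ?thesis using phi_pos by simp
    qed
    have yd: "y \<le> 64 * \<theta> / 3 * d"
    proof -
      have "\<gamma> * \<phi> < \<phi> * d" using dl \<mu>(2) dp by (meson mult_right_mono less_le_trans less_imp_le)
      then have "\<gamma> \<le> d" using phi_pos by (simp add: mult.commute)
      then have "64 * \<theta> / 3 * \<gamma> \<le> 64 * \<theta> / 3 * d" using \<theta> by (intro mult_left_mono) auto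
      moreover have "64 * \<theta> * \<gamma> / 3 = 64 * \<theta> / 3 * \<gamma>" by simp
      ultimately show ?thesis using y\<gamma> by linarith
    qed
    have "3 * \<phi> * y\<^sup>2 \<le> \<gamma> * \<phi> * d / 100"
    proof -
      have "y * y \<le> (64 * \<theta> * \<gamma> / 3) * (64 * \<theta> / 3 * d)" by (intro mult_mono y\<gamma> yd y0) (use \<theta> \<gamma> in auto)
      moreover have "(64 * \<theta> * \<gamma> / 3) * (64 * \<theta> / 3 * d) = 4096 / 9000000 * (\<gamma> * d)" by (simp add: \<theta>)
      moreover have "0 < \<gamma> * d" using \<gamma>(1) dp by (rule mult_pos_pos)
      ultimately have "y * y \<le> \<gamma> * d / 1000" by linarith
      then have "3 * \<phi> * (y * y) \<le> 3 * \<phi> * (\<gamma> * d / 1000)" using phi_pos by (intro mult_left_mono) auto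
      moreover have "3 * \<phi> * (\<gamma> * d / 1000) = 3 / 1000 * (\<gamma> * \<phi> * d)" by simp
      moreover have "0 < \<gamma> * \<phi> * d" using \<gamma>(1) phi_pos dp by simp
      ultimately show ?thesis unfolding power2_eq_square by linarith
    qed
    moreover have "(7/6) * \<omega> * d \<le> \<gamma> * \<phi> * d / 100"
    proof -
      have "(7/6) * \<omega> * d = 28 / 6000 * (\<gamma> * \<phi> * d)" by (simp add: \<omega>_def \<theta>)
      moreover have "0 < \<gamma> * \<phi> * d" using \<gamma>(1) phi_pos dp by simp
      ultimately show ?thesis by linarith
    qed
    moreover have "(7/6) * \<omega> * y \<le> \<gamma> * \<phi> * d / 100"
    proof -
      have "(7/6) * \<omega> * y \<le> (7/6) * \<omega> * d"
        using w0 yd \<theta> dp by (intro mult_left_mono) auto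
      then show ?thesis using \<open>(7/6) * \<omega> * d \<le> \<gamma> * \<phi> * d / 100\<close> by linarith
    qed
    moreover have "\<gamma> * \<phi> * d / 2 \<le> \<mu> / 2 * d\<^sup>2"
      using mult_right_mono[OF less_imp_le[OF dl], of d] dp by (simp add: power2_eq_square)
    moreover have "0 < \<gamma> * \<phi> * d" using \<gamma> phi_pos dp by simp
    ultimately show False using main by simp
  qed
qed

text \<open>S is close to k C, and c collects what does not grow with the sample. A point of the
  ball that maximises the form of S up to c must lie near (\<phi> + \<eta>) q: the deficit of C
  grows quadratically in the distance, the noise only linearly up to a small quadratic part. All
  terms carry the factor k, by the hypothesis on c, and k cancels.\<close>

lemma near_leading_direction:
  fixes S :: "nat \<Rightarrow> nat \<Rightarrow> real" and \<theta> \<gamma> k c :: real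
  assumes S: "\<And>i j. i < p \<Longrightarrow> j < p \<Longrightarrow> S i j = S j i"
    and \<theta>: "\<theta> = 1 / 1000" and \<gamma>: "0 < \<gamma>" "\<gamma> < \<sigma> - 3 * \<eta>" and k: "0 < k"
    and e: "sqnorm p e \<le> \<eta>\<^sup>2"
    and d: "d = (\<lambda>i. \<phi> * q i + e i - (\<phi> + \<eta>) * q i)"
    and ge: "bilin {..<p} S (\<lambda>i. (\<phi> + \<eta>) * q i) (\<lambda>i. (\<phi> + \<eta>) * q i) - c
      \<le> bilin {..<p} S (\<lambda>i. \<phi> * q i + e i) (\<lambda>i. \<phi> * q i + e i)"
    and W: "\<And>b. b = d \<or> b = (\<lambda>i. (\<phi> + \<eta>) * q i) \<Longrightarrow>
      \<bar>bilin {..<p} (\<lambda>i j. S i j - k * C i j) d b\<bar> \<le> k * (4 * \<theta> * \<phi> * \<gamma>) * sqrt (sqnorm p d) * sqrt (sqnorm p b)"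
    and c: "c \<le> k * (1000 * \<theta>\<^sup>2 * \<gamma>\<^sup>2 * \<eta> * \<phi>)"
  shows "sqrt (sqnorm p d) \<le> 64 * \<theta> * \<gamma> * \<eta> / \<phi>"
proof -
  define \<omega> where "\<omega> = 4 * \<theta> * \<phi> * \<gamma>"
  have w0: "0 \<le> \<omega>" using \<theta> phi_pos \<gamma> by (simp add: \<omega>_def)
  let ?W = "\<lambda>i j. S i j - k * C i j"
  let ?bs = "\<lambda>i. (\<phi> + \<eta>) * q i"
  define y where "y = sqrt (sqnorm p d)"
  have y2: "y\<^sup>2 = sqnorm p d" and y0: "0 \<le> y" by (simp_all add: y_def sqnorm_nonneg)
  have sbs: "sqrt (sqnorm p ?bs) = \<phi> + \<eta>" using phi_pos eta by (simp add: sqnorm_q)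
  have "bilin {..<p} ?W (\<lambda>i. \<phi> * q i + e i) (\<lambda>i. \<phi> * q i + e i)
      = bilin {..<p} ?W ?bs ?bs + 2 * bilin {..<p} ?W d ?bs + bilin {..<p} ?W d d"
    unfolding d by (rule bilin_shift_sym) (use S C_sym in auto)
  then have ex: "bilin {..<p} S (\<lambda>i. \<phi> * q i + e i) (\<lambda>i. \<phi> * q i + e i)
        - k * bilin {..<p} C (\<lambda>i. \<phi> * q i + e i) (\<lambda>i. \<phi> * q i + e i)
      = bilin {..<p} S ?bs ?bs - k * bilin {..<p} C ?bs ?bs + 2 * bilin {..<p} ?W d ?bs + bilin {..<p} ?W d d"
    by (simp only: bilin_diff_matrix bilin_scale_matrix)
  have "\<bar>bilin {..<p} ?W d ?bs\<bar> \<le> k * \<omega> * y * (\<phi> + \<eta>)" "\<bar>bilin {..<p} ?W d d\<bar> \<le> k * \<omega> * y * y"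
    using W[of ?bs] W[of d] unfolding \<omega>_def[symmetric] y_def sbs by auto
  then have "k * bilin {..<p} C ?bs ?bs - c
      \<le> k * bilin {..<p} C (\<lambda>i. \<phi> * q i + e i) (\<lambda>i. \<phi> * q i + e i) + 2 * (k * \<omega> * y * (\<phi> + \<eta>)) + k * \<omega> * y * y"
    using ge ex by (simp only: abs_le_iff) linarith
  moreover have "k * (bilin {..<p} C (\<lambda>i. \<phi> * q i + e i) (\<lambda>i. \<phi> * q i + e i) + \<phi>^3 / \<eta> * y\<^sup>2) \<le> k * (\<phi>\<^sup>2 * (\<phi> + \<eta>)\<^sup>2)"
    using k quadratic_form_gap[OF e] unfolding y2 d by (intro mult_left_mono) auto
  ultimately have "k * (\<phi>^3 / \<eta> * y\<^sup>2) \<le> k * (2 * \<omega> * y * (\<phi> + \<eta>) + \<omega> * y * y + 1000 * \<theta>\<^sup>2 * \<gamma>\<^sup>2 * \<eta> * \<phi>)"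
    unfolding bilin_q using c by (simp add: algebra_simps)
  then have main: "\<phi>^3 / \<eta> * y\<^sup>2 \<le> 2 * \<omega> * y * (\<phi> + \<eta>) + \<omega> * y * y + 1000 * \<theta>\<^sup>2 * \<gamma>\<^sup>2 * \<eta> * \<phi>"
    by (simp only: mult_le_cancel_left_pos[OF k])
  show ?thesis
  proof (rule ccontr)
    assume "\<not> sqrt (sqnorm p d) \<le> 64 * \<theta> * \<gamma> * \<eta> / \<phi>"
    then have yl: "64 * \<theta> * \<gamma> * \<eta> / \<phi> < y" by (simp add: y_def)
    have yp: "0 < y"
    proof -
      have "0 < 64 * \<theta> * \<gamma> * \<eta> / \<phi>" using \<theta> \<gamma> eta phi_pos by simp
      then show ?thesis using yl by linarith
    qed
    \<comment> \<open>A common unit. Were y too large, the deficit would be at least 64 Z, whereas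
      the noise and c together amount to at most 27 Z plus one hundredth of the deficit.\<close>
    define Z where "Z = \<theta> * \<gamma> * \<phi>\<^sup>2 * y"
    have Z: "0 < Z" unfolding Z_def using \<theta> \<gamma> phi_pos yp by simp
    have a1: "64 * Z \<le> \<phi>^3 / \<eta> * y\<^sup>2"
    proof -
      have "64 * \<theta> * \<gamma> * \<eta> < y * \<phi>" using yl phi_pos by (simp add: field_simps)
      then have "64 * \<theta> * \<gamma> * \<eta> * (\<phi>\<^sup>2 * y) \<le> y * \<phi> * (\<phi>\<^sup>2 * y)"
        using yp phi_pos by (intro mult_right_mono) auto
      then have "64 * Z * \<eta> \<le> \<phi>^3 * y\<^sup>2"
        unfolding Z_def by (simp add: power2_eq_square power3_eq_cube mult_ac)
      then show ?thesis using eta by (simp add: field_simps)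
    qed
    have a2: "2 * \<omega> * y * (\<phi> + \<eta>) \<le> 11 * Z"
    proof -
      have "\<phi> + \<eta> \<le> 4/3 * \<phi>" using eta_phi by simp
      then have "2 * \<omega> * y * (\<phi> + \<eta>) \<le> 2 * \<omega> * y * (4/3 * \<phi>)"
        using w0 yp by (intro mult_left_mono) auto
      also have "\<dots> = 32/3 * Z" unfolding \<omega>_def Z_def by (simp add: power2_eq_square mult_ac)
      finally show ?thesis using Z by simp
    qed
    have a3: "\<omega> * y * y \<le> (1/100) * (\<phi>^3 / \<eta> * y\<^sup>2)"
    proof -
      have "\<gamma> \<le> \<phi>" using \<gamma> sigma eta by linarith
      have "\<omega> \<le> 4 * \<theta> * \<phi> * \<phi>" unfolding \<omega>_def using \<theta> phi_pos \<open>\<gamma> \<le> \<phi>\<close> by (intro mult_left_mono) auto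
      also have "\<dots> \<le> (1/100) * (\<phi>^3 / \<eta>)"
      proof -
        have "\<phi> * \<phi> * \<eta> \<le> \<phi> * \<phi> * \<phi>" using eta_phi eta phi_pos by (intro mult_left_mono) auto
        then have "\<phi> * \<phi> \<le> \<phi>^3 / \<eta>" using eta by (simp add: field_simps power3_eq_cube)
        moreover have "0 < \<phi> * \<phi>" using phi_pos by simp
        moreover have "4 * \<theta> * \<phi> * \<phi> = 4 / 1000 * (\<phi> * \<phi>)" using \<theta> by simp
        ultimately show ?thesis by linarith
      qed
      finally have "\<omega> * (y * y) \<le> (1/100) * (\<phi>^3 / \<eta>) * (y * y)" by (intro mult_right_mono) auto
      then show ?thesis by (simp add: power2_eq_square mult_ac)
    qed
    have a4: "1000 * \<theta>\<^sup>2 * \<gamma>\<^sup>2 * \<eta> * \<phi> \<le> 16 * Z"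
    proof -
      have le: "64 * \<theta> * \<gamma> * \<eta> \<le> y * \<phi>" using yl phi_pos by (simp add: field_simps)
      have "0 \<le> \<theta> * \<gamma> * \<phi>" using \<theta> \<gamma> phi_pos by simp
      from mult_left_mono[OF le this]
      have "(\<theta> * \<gamma> * \<phi>) * (64 * \<theta> * \<gamma> * \<eta>) \<le> (\<theta> * \<gamma> * \<phi>) * (y * \<phi>)" .
      moreover have "(\<theta> * \<gamma> * \<phi>) * (y * \<phi>) = Z" unfolding Z_def by (simp add: power2_eq_square mult_ac)
      moreover have "(\<theta> * \<gamma> * \<phi>) * (64 * \<theta> * \<gamma> * \<eta>) = 64 * (\<theta>\<^sup>2 * \<gamma>\<^sup>2 * \<eta> * \<phi>)" by (simp add: power2_eq_square mult_ac)
      ultimately have "64 * (\<theta>\<^sup>2 * \<gamma>\<^sup>2 * \<eta> * \<phi>) \<le> Z" by simp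
      moreover have "1000 * \<theta>\<^sup>2 * \<gamma>\<^sup>2 * \<eta> * \<phi> = 1000 * (\<theta>\<^sup>2 * \<gamma>\<^sup>2 * \<eta> * \<phi>)" by (simp add: mult_ac)
      ultimately show ?thesis using Z by linarith
    qed
    show False using main a1 a2 a3 a4 Z by linarith
  qed
qed

end

section \<open>Stationary Gaussian series\<close>

text \<open>The mean being 0 makes the constant 0 in the degenerate case and the location parameter
  0 in the other, and the characteristic function identifies both.\<close>

lemma gaussian_variable_centered_normal:
  assumes M: "prob_space M" and g: "gaussian_variable M Y" and m: "(\<integral>\<omega>. Y \<omega> \<partial>M) = 0"
  shows "centered_normal M Y (\<integral>\<omega>. (Y \<omega>)\<^sup>2 \<partial>M)"
proof -
  interpret prob_space M by fact
  have Ym [measurable]: "Y \<in> borel_measurable M" using g by (simp add: gaussian_variable_def)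
  have "\<exists>v. centered_normal M Y v"
  proof -
    from g consider (const) c where "AE \<omega> in M. Y \<omega> = c"
      | (norm) \<mu> \<tau> where "\<tau> > 0" "distributed M lborel Y (normal_density \<mu> \<tau>)"
      unfolding gaussian_variable_def by blast
    then show ?thesis
    proof cases
      case const
      have "(\<integral>\<omega>. Y \<omega> \<partial>M) = (\<integral>\<omega>. c \<partial>M)"
        using const by (intro integral_cong_AE) auto
      then have c: "c = 0" using m by (simp add: prob_space)
      have "centered_normal M Y 0"
      proof (rule centered_normalI_char[OF M Ym order_refl])
        fix t
        have "(CLINT \<omega>|M. iexp (t * Y \<omega>)) = (CLINT \<omega>|M. 1)"
          using const c by (intro integral_cong_AE) auto
        then show "(CLINT \<omega>|M. iexp (t * Y \<omega>)) = of_real (exp (- (t\<^sup>2 * 0 / 2)))"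
          by (simp add: prob_space)
      qed
      then show ?thesis by blast
    next
      case norm
      have "\<mu> = 0" using normal_distributed_expectation[OF norm(1) norm(2)] m by simp
      with norm have d: "distributed M lborel Y (normal_density 0 \<tau>)" by simp
      have "centered_normal M Y (\<tau>\<^sup>2)"
      proof (rule centered_normalI_char[OF M Ym])
        fix t
        have "(CLINT \<omega>|M. iexp (t * Y \<omega>)) = (CLINT x|distr M lborel Y. iexp (t * x))"
          by (rule integral_distr[symmetric]) auto
        also have "distr M lborel Y = density lborel (normal_density 0 \<tau>)"
          by (rule distributed_distr_eq_density[OF d])
        also have "(CLINT x|density lborel (normal_density 0 \<tau>). iexp (t * x))
            = (CLINT x|lborel. normal_density 0 \<tau> x *\<^sub>R iexp (t * x))"
          by (rule integral_density) auto
        also have "\<dots> = of_real (exp (- (t\<^sup>2 * \<tau>\<^sup>2 / 2)))"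
          by (rule normal_density_char[OF norm(1)])
        finally show "(CLINT \<omega>|M. iexp (t * Y \<omega>)) = of_real (exp (- (t\<^sup>2 * \<tau>\<^sup>2 / 2)))" .
      qed simp
      then show ?thesis by blast
    qed
  qed
  then obtain v where v: "centered_normal M Y v" by blast
  with centered_normal_square(2)[OF v] show ?thesis by simp
qed

lemma integrable_mult_of_square:
  fixes f g :: "'a \<Rightarrow> real"
  assumes [measurable]: "f \<in> borel_measurable M" "g \<in> borel_measurable M"
    and "integrable M (\<lambda>x. (f x)\<^sup>2)" "integrable M (\<lambda>x. (g x)\<^sup>2)"
  shows "integrable M (\<lambda>x. f x * g x)"
proof (rule Bochner_Integration.integrable_bound)
  show "integrable M (\<lambda>x. (f x)\<^sup>2 + (g x)\<^sup>2)" using assms by auto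
  have "\<bar>a * b\<bar> \<le> a\<^sup>2 + b\<^sup>2" for a b :: real
  proof -
    have "2 * \<bar>a\<bar> * \<bar>b\<bar> \<le> a\<^sup>2 + b\<^sup>2" using sum_squares_bound[of "\<bar>a\<bar>" "\<bar>b\<bar>"] by simp
    moreover have "0 \<le> \<bar>a\<bar> * \<bar>b\<bar>" by simp
    ultimately show ?thesis unfolding abs_mult by linarith
  qed
  then show "AE x in M. norm (f x * g x) \<le> norm ((f x)\<^sup>2 + (g x)\<^sup>2)" by auto
qed measurable

locale gaussian_series =
  fixes M :: "'a measure" and d :: nat and X :: "'a process"
  assumes prob: "prob_space M" and rv: "\<And>t. random_vec M d (X t)"
    and stat: "strictly_stationary M d X" and zm: "zero_mean M d X" and gp: "gaussian_process M d X"
begin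

section \<open>Second moments of coordinates and of projections\<close>

definition coord :: "nat \<times> nat \<Rightarrow> 'a \<Rightarrow> real" where
  "coord i \<omega> = vec_index (X (int (fst i)) \<omega>) (snd i)"

definition cov :: "nat \<times> nat \<Rightarrow> nat \<times> nat \<Rightarrow> real" where
  "cov i j = (\<integral>\<omega>. coord i \<omega> * coord j \<omega> \<partial>M)"

definition dir :: "(nat \<Rightarrow> real) \<Rightarrow> int \<Rightarrow> 'a \<Rightarrow> real" where
  "dir v t \<omega> = (\<Sum>j<d. v j * vec_index (X t \<omega>) j)"

definition var_dir :: "(nat \<Rightarrow> real) \<Rightarrow> real" where
  "var_dir v = bilin {..<d} (\<lambda>i j. cov_mat M d X $$ (i, j)) v v"

sublocale prob_space M by (rule prob)

lemma X_measurable [measurable]: "j < d \<Longrightarrow> (\<lambda>\<omega>. vec_index (X t \<omega>) j) \<in> borel_measurable M"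
  using rv by (simp add: random_vec_def)

lemma dir_measurable [measurable]: "dir v t \<in> borel_measurable M"
  unfolding dir_def by measurable

lemma centered_normal_sum:
  assumes T: "finite T"
  shows "centered_normal M (\<lambda>\<omega>. \<Sum>t\<in>T. \<Sum>j<d. a t j * vec_index (X t \<omega>) j)
    (\<integral>\<omega>. (\<Sum>t\<in>T. \<Sum>j<d. a t j * vec_index (X t \<omega>) j)\<^sup>2 \<partial>M)"
proof (rule gaussian_variable_centered_normal[OF prob])
  show "gaussian_variable M (\<lambda>\<omega>. \<Sum>t\<in>T. \<Sum>j<d. a t j * vec_index (X t \<omega>) j)"
    using gp T unfolding gaussian_process_def by blast
  have "integrable M (\<lambda>\<omega>. vec_index (X t \<omega>) j)" "(\<integral>\<omega>. vec_index (X t \<omega>) j \<partial>M) = 0" if "j < d" for t j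
    using zm that unfolding zero_mean_def by auto
  note z = this
  have "(\<integral>\<omega>. (\<Sum>t\<in>T. \<Sum>j<d. a t j * vec_index (X t \<omega>) j) \<partial>M)
      = (\<Sum>t\<in>T. \<Sum>j<d. (\<integral>\<omega>. a t j * vec_index (X t \<omega>) j \<partial>M))"
    by (subst Bochner_Integration.integral_sum)
      (auto intro!: Bochner_Integration.integrable_sum integrable_mult_right z(1) sum.cong
        Bochner_Integration.integral_sum simp del: integral_mult_right_zero)
  then show "(\<integral>\<omega>. (\<Sum>t\<in>T. \<Sum>j<d. a t j * vec_index (X t \<omega>) j) \<partial>M) = 0"
    by (simp add: z(2))
qed

lemma centered_normal_dir: "centered_normal M (dir v t) (\<integral>\<omega>. (dir v t \<omega>)\<^sup>2 \<partial>M)"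
  using centered_normal_sum[of "{t}" "\<lambda>_. v"] by (simp add: dir_def[abs_def])

lemma dir_unit: "j < d \<Longrightarrow> dir (\<lambda>i. if i = j then 1 else 0) t = (\<lambda>\<omega>. vec_index (X t \<omega>) j)"
proof
  fix \<omega> assume j: "j < d"
  have "dir (\<lambda>i. if i = j then 1 else 0) t \<omega> = (\<Sum>i<d. if i = j then vec_index (X t \<omega>) i else 0)"
    unfolding dir_def by (intro sum.cong) auto
  then show "dir (\<lambda>i. if i = j then 1 else 0) t \<omega> = vec_index (X t \<omega>) j" using j by simp
qed

lemma integrable_X_square: "j < d \<Longrightarrow> integrable M (\<lambda>\<omega>. (vec_index (X t \<omega>) j)\<^sup>2)"
  using centered_normal_square(1)[OF centered_normal_dir[of "\<lambda>i. if i = j then 1 else 0" t]] dir_unit[of j t]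
  by simp

lemma integrable_X_mult: "i < d \<Longrightarrow> j < d \<Longrightarrow> integrable M (\<lambda>\<omega>. vec_index (X t \<omega>) i * vec_index (X u \<omega>) j)"
  by (intro integrable_mult_of_square integrable_X_square) measurable

lemma normal_family_coord: "normal_family M ({1..n} \<times> {..<d}) cov coord"
  unfolding normal_family_def
proof (intro conjI ballI allI)
  show "prob_space M" by (rule prob)
  show "finite ({1..n} \<times> {..<d})" by simp
  show "coord i \<in> borel_measurable M" if "i \<in> {1..n} \<times> {..<d}" for i
    using that unfolding coord_def[abs_def] by auto
  show "cov i j = cov j i" for i j by (simp add: cov_def mult.commute)
  fix a :: "nat \<times> nat \<Rightarrow> real"
  let ?I = "{1..n} \<times> {..<d}"
  let ?Y = "\<lambda>\<omega>. \<Sum>i\<in>?I. a i * coord i \<omega>"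
  have Y: "?Y \<omega> = (\<Sum>t\<in>int ` {1..n}. \<Sum>j<d. a (nat t, j) * vec_index (X t \<omega>) j)" for \<omega>
    by (subst sum.reindex) (auto simp: sum.cartesian_product' coord_def intro!: sum.cong)
  have "(\<integral>\<omega>. (?Y \<omega>)\<^sup>2 \<partial>M) = (\<integral>\<omega>. (\<Sum>i\<in>?I. \<Sum>j\<in>?I. a i * a j * (coord i \<omega> * coord j \<omega>)) \<partial>M)"
    by (simp add: power2_eq_square sum_product mult_ac)
  also have "\<dots> = bilin ?I cov a a"
  proof -
    have int: "integrable M (\<lambda>\<omega>. coord i \<omega> * coord j \<omega>)" if "i \<in> ?I" "j \<in> ?I" for i j
      unfolding coord_def using that by (intro integrable_X_mult) auto
    have "(\<integral>\<omega>. (\<Sum>i\<in>?I. \<Sum>j\<in>?I. a i * a j * (coord i \<omega> * coord j \<omega>)) \<partial>M)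
        = (\<Sum>i\<in>?I. \<Sum>j\<in>?I. (\<integral>\<omega>. a i * a j * (coord i \<omega> * coord j \<omega>) \<partial>M))"
      by (subst Bochner_Integration.integral_sum)
        (auto intro!: Bochner_Integration.integrable_sum integrable_mult_right int sum.cong Bochner_Integration.integral_sum simp del: integral_mult_right_zero)
    then show ?thesis unfolding bilin_def cov_def by simp
  qed
  finally have eq: "(\<integral>\<omega>. (?Y \<omega>)\<^sup>2 \<partial>M) = bilin ?I cov a a" .
  have "centered_normal M ?Y (\<integral>\<omega>. (?Y \<omega>)\<^sup>2 \<partial>M)"
    unfolding Y by (rule centered_normal_sum) simp
  then show "centered_normal M ?Y (bilin ?I cov a a)" unfolding eq .
qed

lemma stationary_second_moment:
  assumes ij: "i < d" "j < d"
  shows "(\<integral>\<omega>. vec_index (X t \<omega>) i * vec_index (X t \<omega>) j \<partial>M) = cov_mat M d X $$ (i, j)"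
proof -
  let ?P = "Pi\<^sub>M ({0} \<times> {..<d}) (\<lambda>_. borel) :: (int \<times> nat \<Rightarrow> real) measure"
  have law: "joint_law M d X {0} t = joint_law M d X {0} 0"
    using stat unfolding strictly_stationary_def by blast
  have m: "(\<lambda>\<omega>. \<lambda>(s, k) \<in> {0} \<times> {..<d}. vec_index (X (s + h) \<omega>) k) \<in> measurable M ?P" for h
    by (rule measurable_restrict) auto
  have g: "(\<lambda>x. x (0, i) * x (0, j)) \<in> borel_measurable ?P"
    using ij by (intro borel_measurable_times measurable_component_singleton) auto
  have "(\<integral>x. x (0, i) * x (0, j) \<partial>joint_law M d X {0} h) = (\<integral>\<omega>. vec_index (X h \<omega>) i * vec_index (X h \<omega>) j \<partial>M)" for h
    unfolding joint_law_def using ij by (subst integral_distr[OF m g]) auto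
  from this[of t] this[of 0] law show ?thesis using ij by (simp add: cov_mat_def)
qed

lemma expectation_dir_mult:
  "(\<integral>\<omega>. dir v t \<omega> * dir w u \<omega> \<partial>M)
    = (\<Sum>i<d. \<Sum>j<d. v i * w j * (\<integral>\<omega>. vec_index (X t \<omega>) i * vec_index (X u \<omega>) j \<partial>M))"
proof -
  have "(\<integral>\<omega>. dir v t \<omega> * dir w u \<omega> \<partial>M)
      = (\<integral>\<omega>. (\<Sum>i<d. \<Sum>j<d. v i * w j * (vec_index (X t \<omega>) i * vec_index (X u \<omega>) j)) \<partial>M)"
    unfolding dir_def sum_product by (simp add: mult_ac)
  also have "\<dots> = (\<Sum>i<d. \<Sum>j<d. (\<integral>\<omega>. v i * w j * (vec_index (X t \<omega>) i * vec_index (X u \<omega>) j) \<partial>M))"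
    by (subst Bochner_Integration.integral_sum)
      (auto intro!: Bochner_Integration.integrable_sum integrable_mult_right integrable_X_mult sum.cong Bochner_Integration.integral_sum simp del: integral_mult_right_zero)
  finally show ?thesis by simp
qed

lemma second_moment_dir: "(\<integral>\<omega>. (dir v t \<omega>)\<^sup>2 \<partial>M) = var_dir v"
  unfolding power2_eq_square expectation_dir_mult var_dir_def bilin_def
  by (intro sum.cong refl) (simp add: stationary_second_moment)

lemma var_dir_nonneg: "0 \<le> var_dir v"
  unfolding second_moment_dir[of v 0, symmetric] by simp

text \<open>The projection onto v divided by its standard deviation is an admissible test function
  at both times. Taking it with either sign on one side yields the absolute value.\<close>

lemma rho_coeff_bound:
  assumes v: "0 < var_dir v"
  shows "\<bar>\<integral>\<omega>. dir v t \<omega> * dir v (t + int l) \<omega> \<partial>M\<bar> \<le> rho_coeff M d X l * var_dir v"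
proof -
  define s where "s = sqrt (var_dir v)"
  have s: "0 < s" "s\<^sup>2 = var_dir v" using v by (simp_all add: s_def)
  define f where "f c x = c * (\<Sum>j<d. v j * x j) / s" for c and x :: "nat \<Rightarrow> real"
  have fc: "f c (coords d (X u \<omega>)) = c * dir v u \<omega> / s" for c u \<omega>
    unfolding f_def dir_def coords_def by (intro arg_cong2[where f="(/)"] arg_cong2[where f="(*)"] sum.cong refl) auto
  have fm: "f c \<in> borel_measurable (Pi\<^sub>M {..<d} (\<lambda>_. borel))" for c
    unfolding f_def by measurable
  let ?S = "{integral\<^sup>L M (\<lambda>\<omega>. f (coords d (X t \<omega>)) * g (coords d (X (t + int l) \<omega>))) | f g t.
            f \<in> borel_measurable (Pi\<^sub>M {..<d} (\<lambda>_. borel)) \<and>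
            g \<in> borel_measurable (Pi\<^sub>M {..<d} (\<lambda>_. borel)) \<and>
            integral\<^sup>L M (\<lambda>\<omega>. f (coords d (X t \<omega>))) = 0 \<and>
            integral\<^sup>L M (\<lambda>\<omega>. g (coords d (X (t + int l) \<omega>))) = 0 \<and>
            integral\<^sup>L M (\<lambda>\<omega>. (f (coords d (X t \<omega>)))\<^sup>2) = 1 \<and>
            integral\<^sup>L M (\<lambda>\<omega>. (g (coords d (X (t + int l) \<omega>)))\<^sup>2) = 1} :: real set"
  have cm [measurable]: "(\<lambda>\<omega>. coords d (X t \<omega>)) \<in> measurable M (Pi\<^sub>M {..<d} (\<lambda>_. borel))" for t
    unfolding coords_def by (rule measurable_restrict) auto
  \<comment> \<open>A real supremum dominates its elements only for a set bounded above; here f g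
    \<le> f^2 + g^2 gives the bound 2.\<close>
  have bdd: "bdd_above ?S"
  proof (rule bdd_aboveI)
    fix x assume "x \<in> ?S"
    then obtain f g t where x: "x = integral\<^sup>L M (\<lambda>\<omega>. f (coords d (X t \<omega>)) * g (coords d (X (t + int l) \<omega>)))"
      and [measurable]: "f \<in> borel_measurable (Pi\<^sub>M {..<d} (\<lambda>_. borel))" "g \<in> borel_measurable (Pi\<^sub>M {..<d} (\<lambda>_. borel))"
      and f2: "integral\<^sup>L M (\<lambda>\<omega>. (f (coords d (X t \<omega>)))\<^sup>2) = 1"
      and g2: "integral\<^sup>L M (\<lambda>\<omega>. (g (coords d (X (t + int l) \<omega>)))\<^sup>2) = 1" by auto
    let ?f = "\<lambda>\<omega>. f (coords d (X t \<omega>))"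
    let ?g = "\<lambda>\<omega>. g (coords d (X (t + int l) \<omega>))"
    \<comment> \<open>A non-integrable function would have integral 0, contrary to the normalisation
      to 1.\<close>
    have i1: "integrable M (\<lambda>\<omega>. (?f \<omega>)\<^sup>2)"
    proof (rule ccontr)
      assume "\<not> ?thesis"
      from not_integrable_integral_eq[OF this] f2 show False by simp
    qed
    have i2: "integrable M (\<lambda>\<omega>. (?g \<omega>)\<^sup>2)"
    proof (rule ccontr)
      assume "\<not> ?thesis"
      from not_integrable_integral_eq[OF this] g2 show False by simp
    qed
    note i = i1 i2
    have "x \<le> (\<integral>\<omega>. (?f \<omega>)\<^sup>2 + (?g \<omega>)\<^sup>2 \<partial>M)"
      unfolding x
    proof (rule integral_mono)
      show "integrable M (\<lambda>\<omega>. ?f \<omega> * ?g \<omega>)" by (intro integrable_mult_of_square i) measurable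
      fix \<omega>
      show "?f \<omega> * ?g \<omega> \<le> (?f \<omega>)\<^sup>2 + (?g \<omega>)\<^sup>2"
        using sum_squares_bound[of "?f \<omega>" "?g \<omega>"] zero_le_power2[of "?f \<omega>"] zero_le_power2[of "?g \<omega>"] by linarith
    qed (use i in auto)
    also have "\<dots> = 2" using f2 g2 i by simp
    finally show "x \<le> 2" .
  qed
  have d0: "(\<integral>\<omega>. dir v u \<omega> \<partial>M) = 0" for u
    using zm unfolding dir_def zero_mean_def by (simp add: Bochner_Integration.integral_sum)
  have mem: "c * (\<integral>\<omega>. dir v t \<omega> * dir v (t + int l) \<omega> \<partial>M) / var_dir v \<le> rho_coeff M d X l"
    if c: "c\<^sup>2 = 1" for c
    unfolding rho_coeff_def
  proof (rule cSup_upper[OF _ bdd])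
    show "c * (\<integral>\<omega>. dir v t \<omega> * dir v (t + int l) \<omega> \<partial>M) / var_dir v \<in> ?S"
    proof (intro CollectI exI conjI)
      show "f c \<in> borel_measurable (Pi\<^sub>M {..<d} (\<lambda>_. borel))" "f 1 \<in> borel_measurable (Pi\<^sub>M {..<d} (\<lambda>_. borel))"
        by (rule fm)+
      have "(\<integral>\<omega>. (c * dir v t \<omega> / s) * (1 * dir v (t + int l) \<omega> / s) \<partial>M)
          = (\<integral>\<omega>. c / s\<^sup>2 * (dir v t \<omega> * dir v (t + int l) \<omega>) \<partial>M)"
        by (intro Bochner_Integration.integral_cong refl) (simp add: power2_eq_square)
      then show "c * (\<integral>\<omega>. dir v t \<omega> * dir v (t + int l) \<omega> \<partial>M) / var_dir v
          = (\<integral>\<omega>. f c (coords d (X t \<omega>)) * f 1 (coords d (X (t + int l) \<omega>)) \<partial>M)"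
        unfolding fc s(2) by simp
      show "(\<integral>\<omega>. f c (coords d (X t \<omega>)) \<partial>M) = 0" "(\<integral>\<omega>. f 1 (coords d (X (t + int l) \<omega>)) \<partial>M) = 0"
        unfolding fc using d0 by simp_all
      have sq: "(\<integral>\<omega>. (a * dir v u \<omega> / s)\<^sup>2 \<partial>M) = a\<^sup>2" for a u
        using s v second_moment_dir[of v u] by (simp add: power_divide power_mult_distrib)
      show "(\<integral>\<omega>. (f c (coords d (X t \<omega>)))\<^sup>2 \<partial>M) = 1" "(\<integral>\<omega>. (f 1 (coords d (X (t + int l) \<omega>)))\<^sup>2 \<partial>M) = 1"
        unfolding fc sq using c by simp_all
    qed
  qed
  show ?thesis
    using mem[of 1] mem[of "- 1"] v by (simp add: abs_le_iff field_simps)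
qed

lemma rho_coeff_nonneg: "0 < var_dir v \<Longrightarrow> 0 \<le> rho_coeff M d X l"
  using rho_coeff_bound[of v 0 l] by (metis abs_ge_zero order_trans zero_le_mult_iff not_less)

text \<open>A direction of zero variance cannot be normalised to a test function, but its projection
  vanishes almost surely, so both sides are 0.\<close>

lemma dir_mult_le:
  assumes w: "0 < var_dir w"
  shows "\<bar>\<integral>\<omega>. dir v t \<omega> * dir v (t + int l) \<omega> \<partial>M\<bar> \<le> rho_coeff M d X l * var_dir v"
proof (cases "var_dir v = 0")
  case True
  have "integrable M (\<lambda>\<omega>. (dir v t \<omega>)\<^sup>2)" by (rule centered_normal_square(1)[OF centered_normal_dir])
  then have "AE \<omega> in M. (dir v t \<omega>)\<^sup>2 = 0"
    using integral_nonneg_eq_0_iff_AE[of M "\<lambda>\<omega>. (dir v t \<omega>)\<^sup>2"] second_moment_dir[of v t] True by simp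
  then have "AE \<omega> in M. dir v t \<omega> * dir v (t + int l) \<omega> = 0" by auto
  then have "(\<integral>\<omega>. dir v t \<omega> * dir v (t + int l) \<omega> \<partial>M) = 0"
    by (rule integral_eq_zero_AE)
  then show ?thesis using True by simp
next
  case False
  then show ?thesis using var_dir_nonneg[of v] by (intro rho_coeff_bound) simp
qed

lemma proj_cov_dir: "proj_cov d cov v t u = (\<integral>\<omega>. dir v (int t) \<omega> * dir v (int u) \<omega> \<partial>M)"
  unfolding proj_cov_def bilin_def expectation_dir_mult cov_def coord_def by simp

text \<open>Seen from time t, each lag occurs at most once in the past and once in the future, hence
  the factor 2. The direction w of positive variance serves to show that the mixing coefficients are
  nonnegative.\<close>

lemma proj_cov_row_sum:
  assumes w: "0 < var_dir w" and v: "var_dir v \<le> V" and t: "t \<in> {1..n}"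
  shows "(\<Sum>u=1..n. \<bar>proj_cov d cov v t u\<bar>) \<le> 2 * V * (\<Sum>l=0..n. rho_coeff M d X l)"
proof -
  let ?\<rho> = "rho_coeff M d X"
  have r0: "0 \<le> ?\<rho> l" for l by (rule rho_coeff_nonneg[OF w])
  have pw: "\<bar>proj_cov d cov v t u\<bar> \<le> V * ?\<rho> (nat \<bar>int t - int u\<bar>)" for u
  proof -
    have "\<bar>proj_cov d cov v t u\<bar> \<le> ?\<rho> (nat \<bar>int t - int u\<bar>) * var_dir v"
    proof (cases "t \<le> u")
      case True
      then show ?thesis unfolding proj_cov_dir using dir_mult_le[OF w, of v "int t" "u - t"]
        by (simp add: of_nat_diff nat_diff_distrib')
    next
      case False
      then show ?thesis unfolding proj_cov_dir using dir_mult_le[OF w, of v "int u" "t - u"]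
        by (simp add: of_nat_diff nat_diff_distrib' mult.commute)
    qed
    also have "\<dots> \<le> ?\<rho> (nat \<bar>int t - int u\<bar>) * V" using v r0 by (intro mult_left_mono) auto
    finally show ?thesis by (simp add: mult.commute)
  qed
  have V: "0 \<le> V" using v var_dir_nonneg[of v] by linarith
  \<comment> \<open>Past and future overlap in u = t; counting lag 0 twice is harmless for an upper
    bound.\<close>
  have "(\<Sum>u=1..n. ?\<rho> (nat \<bar>int t - int u\<bar>)) \<le> (\<Sum>u=1..t. ?\<rho> (t - u)) + (\<Sum>u=t..n. ?\<rho> (u - t))"
  proof -
    have "(\<Sum>u=1..n. ?\<rho> (nat \<bar>int t - int u\<bar>)) \<le> (\<Sum>u\<in>{1..t} \<union> {t..n}. ?\<rho> (nat \<bar>int t - int u\<bar>))"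
      using t r0 by (intro sum_mono2) auto
    also have "\<dots> \<le> (\<Sum>u=1..t. ?\<rho> (nat \<bar>int t - int u\<bar>)) + (\<Sum>u=t..n. ?\<rho> (nat \<bar>int t - int u\<bar>))"
      using r0 by (subst sum_Un) (auto intro!: sum_nonneg)
    also have "(\<Sum>u=1..t. ?\<rho> (nat \<bar>int t - int u\<bar>)) = (\<Sum>u=1..t. ?\<rho> (t - u))"
      by (intro sum.cong refl arg_cong[where f="?\<rho>"]) auto
    also have "(\<Sum>u=t..n. ?\<rho> (nat \<bar>int t - int u\<bar>)) = (\<Sum>u=t..n. ?\<rho> (u - t))"
      by (intro sum.cong refl arg_cong[where f="?\<rho>"]) auto
    finally show ?thesis .
  qed
  also have "(\<Sum>u=1..t. ?\<rho> (t - u)) = (\<Sum>l\<in>(\<lambda>u. t - u) ` {1..t}. ?\<rho> l)"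
    by (rule sum.reindex[symmetric, unfolded comp_def]) (auto intro!: inj_onI)
  also have "\<dots> \<le> (\<Sum>l=0..n. ?\<rho> l)"
    using t r0 by (intro sum_mono2) auto
  also have "(\<Sum>u=t..n. ?\<rho> (u - t)) = (\<Sum>l\<in>(\<lambda>u. u - t) ` {t..n}. ?\<rho> l)"
    by (rule sum.reindex[symmetric, unfolded comp_def]) (auto intro!: inj_onI)
  also have "\<dots> \<le> (\<Sum>l=0..n. ?\<rho> l)"
    using t r0 by (intro sum_mono2) auto
  finally have "(\<Sum>u=1..n. ?\<rho> (nat \<bar>int t - int u\<bar>)) \<le> 2 * (\<Sum>l=0..n. ?\<rho> l)" by simp
  then have "V * (\<Sum>u=1..n. ?\<rho> (nat \<bar>int t - int u\<bar>)) \<le> V * (2 * (\<Sum>l=0..n. ?\<rho> l))"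
    using V by (rule mult_left_mono)
  moreover have "(\<Sum>u=1..n. \<bar>proj_cov d cov v t u\<bar>) \<le> V * (\<Sum>u=1..n. ?\<rho> (nat \<bar>int t - int u\<bar>))"
    unfolding sum_distrib_left by (intro sum_mono pw)
  ultimately show ?thesis by simp
qed

lemma rho_coeff_0_ge:
  assumes w: "0 < var_dir w"
  shows "1 \<le> rho_coeff M d X 0"
  using rho_coeff_bound[OF w, of 0 0] second_moment_dir[of w 0] w
  by (simp add: power2_eq_square)

end

section \<open>The estimator\<close>

text \<open>For p at least 7 both 2 \<le> p and 16 p + 1 \<le> p^3, so the number of events is at
  most p to the power 1 + m + 3 (k + m), which is at most 8 st. The exponent 2 (b + 4 st) of p
  cancels this and leaves 2 b.\<close>

lemma union_bound_exponent:
  fixes p N :: nat and st b x :: real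
  assumes p: "6 < p" and N: "N = 8 * p" and m: "real m \<le> st" and k: "real k \<le> st" and st: "1 \<le> st"
    and b: "0 < b" and x: "x = 2 * (b + 4 * st) * ln p"
  shows "2 * real p ^ m * (2 * real N + 1) ^ (k + m) * exp (- x) \<le> exp (- b * ln p)"
proof -
  have p7: "7 \<le> real p" using p by simp
  have lp: "0 < ln (real p)" using p by simp
  have pw: "real p ^ j = exp (j * ln p)" for j
    using p7 by (simp add: exp_of_nat_mult)
  have "2 * real N + 1 \<le> real p ^ 3"
  proof -
    have "7 * real p \<le> real p * real p" using p7 by (intro mult_right_mono) auto
    then have "49 \<le> real p * real p" using p7 by linarith
    then have "49 * real p \<le> real p * real p * real p" by (intro mult_right_mono) auto
    moreover have "real N = 8 * real p" by (simp add: N)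
    ultimately show ?thesis unfolding power3_eq_cube using p7 by linarith
  qed
  then have "(2 * real N + 1) ^ (k + m) \<le> (real p ^ 3) ^ (k + m)" by (intro power_mono) auto
  also have "\<dots> = real p ^ (3 * (k + m))" by (simp only: power_mult)
  finally have "2 * real p ^ m * (2 * real N + 1) ^ (k + m) \<le> real p ^ 1 * real p ^ m * real p ^ (3 * (k + m))"
    using p7 by (intro mult_mono) auto
  also have "\<dots> = real p ^ (1 + m + 3 * (k + m))" by (simp only: power_add)
  also have "\<dots> = exp (real (1 + m + 3 * (k + m)) * ln p)" by (rule pw)
  also have "\<dots> \<le> exp (8 * st * ln p)"
    using m k st lp by simp
  finally have "2 * real p ^ m * (2 * real N + 1) ^ (k + m) * exp (- x) \<le> exp (8 * st * ln p) * exp (- x)"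
    by (intro mult_right_mono) auto
  also have "\<dots> = exp (- (2 * b) * ln p)"
    unfolding exp_add[symmetric] x by (simp add: algebra_simps)
  also have "\<dots> \<le> exp (- b * ln p)" using b lp by simp
  finally show ?thesis .
qed

section \<open>Norms, supports and risk in terms of coordinate functions\<close>

definition support_vec :: "nat \<Rightarrow> (nat \<Rightarrow> real) \<Rightarrow> nat set" where
  "support_vec p a = {j. j < p \<and> a j \<noteq> 0}"

lemma l2_norm_vec_sqnorm: "v \<in> carrier_vec p \<Longrightarrow> l2_norm_vec v = sqrt (sqnorm p (\<lambda>i. vec_index v i))"
  unfolding l2_norm_vec_def scalar_prod_def sqnorm_def by (simp add: atLeast0LessThan power2_eq_square)

lemma l0_norm_vec_support: "v \<in> carrier_vec p \<Longrightarrow> l0_norm_vec v = card (support_vec p (\<lambda>i. vec_index v i))"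
  unfolding l0_norm_vec_def support_vec_def by simp

lemma emp_risk_quartic_risk:
  assumes S: "S \<in> carrier_mat p p" and v: "v \<in> carrier_vec p"
  shows "emp_risk S v = quartic_risk p (\<lambda>i j. S $$ (i, j)) (\<lambda>i. vec_index v i)"
proof -
  have "scalar_prod v (S *\<^sub>v v) = bilin {..<p} (\<lambda>i j. S $$ (i, j)) (\<lambda>i. vec_index v i) (\<lambda>i. vec_index v i)"
    unfolding bilin_def using S v
    by (simp add: scalar_prod_def atLeast0LessThan sum_distrib_left mult_ac)
  moreover have "l2_norm_vec v ^ 4 = (sqnorm p (\<lambda>i. vec_index v i))\<^sup>2"
  proof -
    have "l2_norm_vec v ^ 4 = (l2_norm_vec v ^ 2)\<^sup>2" by simp
    then show ?thesis unfolding l2_norm_vec_sqnorm[OF v] by (simp add: sqnorm_nonneg)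
  qed
  ultimately show ?thesis unfolding emp_risk_def quartic_risk_def by simp
qed

lemma quartic_risk_cong:
  "(\<And>i j. i < p \<Longrightarrow> j < p \<Longrightarrow> S i j = S' i j) \<Longrightarrow> quartic_risk p S b = quartic_risk p S' b"
  unfolding quartic_risk_def bilin_def by simp

locale sparse_pca = gaussian_series M p X + leading_eigenvector p "\<lambda>i j. cov_mat M p X $$ (i, j)" q \<phi> \<sigma> \<eta>
  for M :: "'a measure" and p X q and \<phi> \<sigma> \<eta> :: real +
  fixes n :: nat and lam s b :: real and bhat :: "'a \<Rightarrow> real vec"
  assumes n: "1 \<le> n" and p: "6 < p" and b: "0 < b" and lam: "0 \<le> lam" and s: "0 \<le> s"
    and est: "l0_estimator M p X n (vec p (\<lambda>i. \<phi> * q i)) \<eta> lam bhat"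
    and spc: "sparsity_constant M p X n (vec p (\<lambda>i. \<phi> * q i)) \<eta> bhat s"
begin

definition supp :: "nat set" where
  "supp = support_vec p q"

definition sparsity :: real where
  "sparsity = max (real (card supp)) s"

definition rho_sum :: real where
  "rho_sum = (\<Sum>l=0..n. rho_coeff M p X l)"

lemma var_dir_q: "var_dir q = \<phi>\<^sup>2"
  using bilin_q[of 1] unfolding var_dir_def by simp

lemma rho_sum_ge: "1 \<le> rho_sum"
proof -
  have v: "0 < var_dir q" using var_dir_q phi_pos by simp
  have "rho_coeff M p X 0 \<le> rho_sum"
    unfolding rho_sum_def using rho_coeff_nonneg[OF v] by (intro member_le_sum) auto
  with rho_coeff_0_ge[OF v] show ?thesis by linarith
qed

lemma row_sum:
  assumes "(\<Sum>j<p. (v j)\<^sup>2) \<le> 1" "t \<in> {1..n}"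
  shows "(\<Sum>u=1..n. \<bar>proj_cov p cov v t u\<bar>) \<le> 2 * \<phi>\<^sup>2 * rho_sum"
  unfolding rho_sum_def
proof (rule proj_cov_row_sum[OF _ _ assms(2)])
  show "0 < var_dir q" using var_dir_q phi_pos by simp
  have "var_dir v \<le> \<phi>\<^sup>2 * sqnorm p v" unfolding var_dir_def by (rule bilin_le)
  also have "\<dots> \<le> \<phi>\<^sup>2 * 1" using assms(1) unfolding sqnorm_def by (intro mult_left_mono) auto
  finally show "var_dir v \<le> \<phi>\<^sup>2" by simp
qed

lemma cov_diag: "i < p \<Longrightarrow> j < p \<Longrightarrow> cov (t, i) (t, j) = cov_mat M p X $$ (i, j)"
  unfolding cov_def coord_def by (simp add: stationary_second_moment)

lemma supp_sub: "supp \<subseteq> {..<p}" and finite_supp: "finite supp"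
  unfolding supp_def support_vec_def by auto

lemma supp_card: "1 \<le> card supp"
proof (rule ccontr)
  assume "\<not> 1 \<le> card supp"
  then have "supp = {}" using finite_supp by (simp add: not_le)
  then have "q i = 0" if "i < p" for i using that unfolding supp_def support_vec_def by auto
  then have "sqnorm p q = 0" unfolding sqnorm_def by simp
  then show False using q_unit by simp
qed

definition sc :: "'a \<Rightarrow> nat \<Rightarrow> nat \<Rightarrow> real" where
  "sc \<omega> = sample_cov n coord \<omega>"

lemma sc_sym: "sc \<omega> i j = sc \<omega> j i"
  unfolding sc_def sample_cov_def by (simp add: mult.commute)

lemma sample_cov_mat_sc: "i < p \<Longrightarrow> j < p \<Longrightarrow> sample_cov_mat p X n \<omega> $$ (i, j) = sc \<omega> i j"
  unfolding sample_cov_mat_def sc_def sample_cov_def coord_def by simp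

lemma emp_risk_sc:
  assumes "v \<in> carrier_vec p"
  shows "emp_risk (sample_cov_mat p X n \<omega>) v = quartic_risk p (sc \<omega>) (\<lambda>i. vec_index v i)"
proof -
  have "sample_cov_mat p X n \<omega> \<in> carrier_mat p p" unfolding sample_cov_mat_def by simp
  from emp_risk_quartic_risk[OF this assms] show ?thesis
    by (simp add: quartic_risk_cong[OF sample_cov_mat_sc])
qed

text \<open>T stands for the support of a sparse vector, so that the vectors a, c cover the truth,
  an s-sparse vector and their differences. The scale k is 1 for the given law and large for the
  rescaled one.\<close>

definition small_noise :: "real \<Rightarrow> real \<Rightarrow> 'a \<Rightarrow> bool" where
  "small_noise k w \<omega> \<longleftrightarrow> (\<forall>T a c. T \<subseteq> {..<p} \<longrightarrow> real (card T) \<le> s \<longrightarrow>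
     (\<forall>i. i < p \<longrightarrow> i \<notin> supp \<union> T \<longrightarrow> a i = 0) \<longrightarrow> (\<forall>i. i < p \<longrightarrow> i \<notin> supp \<union> T \<longrightarrow> c i = 0) \<longrightarrow>
     \<bar>bilin {..<p} (\<lambda>i j. sc \<omega> i j - k * cov_mat M p X $$ (i, j)) a c\<bar>
       \<le> k * w * sqrt (sqnorm p a) * sqrt (sqnorm p c))"

text \<open>The row sums of the projected covariance are at most k times 2 \<phi>^2
  \<open>rho_sum\<close>; the passage from the grid to all vectors doubles this, which explains the
  factor 4. The measure is a parameter because the given and the rescaled law are both
  needed.\<close>

lemma small_noise_probability:
  fixes k z :: real
  assumes Q: "normal_family Q ({1..n} \<times> {..<p}) (\<lambda>i j. k * cov i j) coord" and k: "0 < k"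
    and z: "0 < z" "z \<le> 1" and nz: "n * z\<^sup>2 / 16 = 2 * (b + 4 * sparsity) * ln p"
  shows "\<exists>E\<in>sets Q. 1 - exp (- b * ln p) \<le> measure Q E \<and> (\<forall>\<omega>\<in>E. small_noise k (4 * \<phi>\<^sup>2 * rho_sum * z) \<omega>)"
proof -
  let ?K = "k * (2 * \<phi>\<^sup>2 * rho_sum)"
  have K: "0 < ?K" using k phi_pos rho_sum_ge by simp
  have pc: "proj_cov p (\<lambda>i j. k * cov i j) v t u = k * proj_cov p cov v t u" for v t u
    unfolding proj_cov_def by (rule bilin_scale_matrix)
  have row: "(\<Sum>u=1..n. \<bar>proj_cov p (\<lambda>i j. k * cov i j) v t u\<bar>) \<le> ?K"
    if "(\<Sum>j<p. (v j)\<^sup>2) \<le> 1" "t \<in> {1..n}" for v t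
    unfolding pc using mult_left_mono[OF row_sum[OF that], of k] k by (simp add: abs_mult sum_distrib_left)
  \<comment> \<open>Fine enough for the net condition whatever the size of the support, and still
    polynomial in p.\<close>
  define N :: nat where "N = 8 * p"
  have N: "0 < N" "64 * p \<le> N\<^sup>2" and p0: "0 < p" using p by (simp_all add: N_def power2_eq_square)
  have diag: "k * cov (t, i) (t, j) = k * cov_mat M p X $$ (i, j)" if "t \<in> {1..n}" "i < p" "j < p" for t i j
    using cov_diag[OF that(2,3)] by simp
  have Csym: "k * cov_mat M p X $$ (i, j) = k * cov_mat M p X $$ (j, i)" if "i < p" "j < p" for i j
    using C_sym[OF that] by simp
  have "\<exists>E\<in>sets Q. 1 - measure Q E \<le> 2 * real p ^ nat \<lfloor>s\<rfloor> * (2 * real N + 1) ^ (card supp + nat \<lfloor>s\<rfloor>) * exp (- (n * z\<^sup>2 / 16)) \<and>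
    (\<forall>\<omega>\<in>E. \<forall>T a c. T \<subseteq> {..<p} \<longrightarrow> card T \<le> nat \<lfloor>s\<rfloor> \<longrightarrow>
       (\<forall>i. i < p \<longrightarrow> i \<notin> supp \<union> T \<longrightarrow> a i = 0) \<longrightarrow> (\<forall>i. i < p \<longrightarrow> i \<notin> supp \<union> T \<longrightarrow> c i = 0) \<longrightarrow>
       \<bar>bilin {..<p} (\<lambda>i j. sample_cov n coord \<omega> i j - k * cov_mat M p X $$ (i, j)) a c\<bar>
         \<le> 2 * (?K * z) * sqrt (\<Sum>i<p. (a i)\<^sup>2) * sqrt (\<Sum>i<p. (c i)\<^sup>2))"
    using sparse_concentration[where M = Q and R = "\<lambda>i j. k * cov i j" and X = coord and n = n and p = p
        and C = "\<lambda>i j. k * cov_mat M p X $$ (i, j)" and K = ?K and z = z and S = supp and N = N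
        and m = "nat \<lfloor>s\<rfloor>", OF Q n p0 diag Csym K z row supp_sub N] by simp
  then obtain E where E: "E \<in> sets Q"
    and pr: "1 - measure Q E \<le> 2 * real p ^ nat \<lfloor>s\<rfloor> * (2 * real N + 1) ^ (card supp + nat \<lfloor>s\<rfloor>) * exp (- (n * z\<^sup>2 / 16))"
    and sn: "\<forall>\<omega>\<in>E. \<forall>T a c. T \<subseteq> {..<p} \<longrightarrow> card T \<le> nat \<lfloor>s\<rfloor> \<longrightarrow>
       (\<forall>i. i < p \<longrightarrow> i \<notin> supp \<union> T \<longrightarrow> a i = 0) \<longrightarrow> (\<forall>i. i < p \<longrightarrow> i \<notin> supp \<union> T \<longrightarrow> c i = 0) \<longrightarrow>
       \<bar>bilin {..<p} (\<lambda>i j. sample_cov n coord \<omega> i j - k * cov_mat M p X $$ (i, j)) a c\<bar>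
         \<le> 2 * (?K * z) * sqrt (\<Sum>i<p. (a i)\<^sup>2) * sqrt (\<Sum>i<p. (c i)\<^sup>2)"
    by - (elim bexE conjE, rule that)
  have "2 * real p ^ nat \<lfloor>s\<rfloor> * (2 * real N + 1) ^ (card supp + nat \<lfloor>s\<rfloor>) * exp (- (n * z\<^sup>2 / 16)) \<le> exp (- b * ln p)"
  proof (rule union_bound_exponent[OF p N_def _ _ _ b nz])
    show "real (nat \<lfloor>s\<rfloor>) \<le> sparsity" using s unfolding sparsity_def by linarith
    show "real (card supp) \<le> sparsity" unfolding sparsity_def by simp
    show "1 \<le> sparsity" using supp_card unfolding sparsity_def by linarith
  qed
  with pr have "1 - exp (- b * ln p) \<le> measure Q E" by linarith
  moreover have "small_noise k (4 * \<phi>\<^sup>2 * rho_sum * z) \<omega>" if "\<omega> \<in> E" for \<omega>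
    unfolding small_noise_def
  proof (intro allI impI)
    fix T a c assume T: "T \<subseteq> {..<p}" "real (card T) \<le> s"
      and a: "\<forall>i. i < p \<longrightarrow> i \<notin> supp \<union> T \<longrightarrow> a i = (0::real)" and c: "\<forall>i. i < p \<longrightarrow> i \<notin> supp \<union> T \<longrightarrow> c i = (0::real)"
    have "card T \<le> nat \<lfloor>s\<rfloor>" using T(2) by linarith
    from sn[rule_format, OF that T(1) this a[rule_format] c[rule_format]]
    show "\<bar>bilin {..<p} (\<lambda>i j. sc \<omega> i j - k * cov_mat M p X $$ (i, j)) a c\<bar>
       \<le> k * (4 * \<phi>\<^sup>2 * rho_sum * z) * sqrt (sqnorm p a) * sqrt (sqnorm p c)"
      unfolding sc_def sqnorm_def by (simp add: mult_ac)
  qed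
  ultimately show ?thesis using E by blast
qed

section \<open>The two minimality properties of the estimator\<close>

definition in_ball :: "real vec \<Rightarrow> bool" where
  "in_ball v \<longleftrightarrow> v \<in> carrier_vec p \<and> sqnorm p (\<lambda>i. vec_index v i - \<phi> * q i) \<le> \<eta>\<^sup>2"

lemma in_ball_iff: "v \<in> local_ball p (vec p (\<lambda>i. \<phi> * q i)) \<eta> \<longleftrightarrow> in_ball v"
proof (cases "v \<in> carrier_vec p")
  case True
  then have "l2_norm_vec (v - vec p (\<lambda>i. \<phi> * q i)) = sqrt (sqnorm p (\<lambda>i. vec_index v i - \<phi> * q i))"
    by (subst l2_norm_vec_sqnorm[of _ p]) (auto simp: sqnorm_def)
  then show ?thesis
    using True eta unfolding local_ball_def in_ball_def
    by (auto simp: sqrt_le_D intro!: real_le_lsqrt)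
qed (simp add: local_ball_def in_ball_def)

lemma bhat_carrier: "\<omega> \<in> space M \<Longrightarrow> bhat \<omega> \<in> carrier_vec p"
  using est unfolding l0_estimator_def random_vec_def by blast

lemma bhat_in_ball: "\<omega> \<in> space M \<Longrightarrow> in_ball (bhat \<omega>)"
  using est in_ball_iff unfolding l0_estimator_def is_arg_min_def by blast

text \<open>Valid at every outcome and hence usable under any measure, in contrast to the minimality
  among sparse vectors, which is only almost sure.\<close>

lemma bhat_penalized:
  assumes "\<omega> \<in> space M" "in_ball v"
  shows "quartic_risk p (sc \<omega>) (\<lambda>i. vec_index (bhat \<omega>) i) + lam * real (l0_norm_vec (bhat \<omega>))
    \<le> quartic_risk p (sc \<omega>) (\<lambda>i. vec_index v i) + lam * real (l0_norm_vec v)"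
proof -
  have "\<not> emp_risk (sample_cov_mat p X n \<omega>) v + lam * real (l0_norm_vec v)
      < emp_risk (sample_cov_mat p X n \<omega>) (bhat \<omega>) + lam * real (l0_norm_vec (bhat \<omega>))"
    using est assms in_ball_iff unfolding l0_estimator_def is_arg_min_def by blast
  then show ?thesis
    using emp_risk_sc[of v] emp_risk_sc[OF bhat_carrier[OF assms(1)]] assms(2) unfolding in_ball_def by simp
qed

lemma bhat_sparse_minimizer:
  "AE \<omega> in M. real (card (support_vec p (\<lambda>i. vec_index (bhat \<omega>) i))) \<le> s \<and>
    (\<forall>v. in_ball v \<longrightarrow> real (card (support_vec p (\<lambda>i. vec_index v i))) \<le> s \<longrightarrow>
      quartic_risk p (sc \<omega>) (\<lambda>i. vec_index (bhat \<omega>) i) \<le> quartic_risk p (sc \<omega>) (\<lambda>i. vec_index v i))"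
proof -
  have "AE \<omega> in M. is_arg_min (emp_risk (sample_cov_mat p X n \<omega>))
          (\<lambda>\<beta>. \<beta> \<in> local_ball p (vec p (\<lambda>i. \<phi> * q i)) \<eta> \<inter> sparse_vecs p s) (bhat \<omega>)"
    using spc unfolding sparsity_constant_def by blast
  then show ?thesis
  proof (rule AE_mp, intro AE_I2 impI)
    fix \<omega> assume \<omega>: "\<omega> \<in> space M" and am: "is_arg_min (emp_risk (sample_cov_mat p X n \<omega>))
          (\<lambda>\<beta>. \<beta> \<in> local_ball p (vec p (\<lambda>i. \<phi> * q i)) \<eta> \<inter> sparse_vecs p s) (bhat \<omega>)"
    have sp: "v \<in> sparse_vecs p s \<longleftrightarrow> real (card (support_vec p (\<lambda>i. vec_index v i))) \<le> s" if "v \<in> carrier_vec p" for v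
      using that l0_norm_vec_support[OF that] by (simp add: sparse_vecs_def)
    have le: "emp_risk (sample_cov_mat p X n \<omega>) (bhat \<omega>) \<le> emp_risk (sample_cov_mat p X n \<omega>) v"
      if "in_ball v" "v \<in> sparse_vecs p s" for v
      using am that in_ball_iff unfolding is_arg_min_def by (metis IntI not_less)
    note bc = bhat_carrier[OF \<omega>]
    show "real (card (support_vec p (\<lambda>i. vec_index (bhat \<omega>) i))) \<le> s \<and>
      (\<forall>v. in_ball v \<longrightarrow> real (card (support_vec p (\<lambda>i. vec_index v i))) \<le> s \<longrightarrow>
        quartic_risk p (sc \<omega>) (\<lambda>i. vec_index (bhat \<omega>) i) \<le> quartic_risk p (sc \<omega>) (\<lambda>i. vec_index v i))"
    proof (intro conjI allI impI)
      have "bhat \<omega> \<in> sparse_vecs p s" using am unfolding is_arg_min_def by blast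
      then show "real (card (support_vec p (\<lambda>i. vec_index (bhat \<omega>) i))) \<le> s" using sp[OF bc] by blast
      fix v assume v: "in_ball v" "real (card (support_vec p (\<lambda>i. vec_index v i))) \<le> s"
      then have vc: "v \<in> carrier_vec p" unfolding in_ball_def by blast
      from le[OF v(1)] sp[OF vc] v(2)
      have "emp_risk (sample_cov_mat p X n \<omega>) (bhat \<omega>) \<le> emp_risk (sample_cov_mat p X n \<omega>) v" by blast
      then show "quartic_risk p (sc \<omega>) (\<lambda>i. vec_index (bhat \<omega>) i) \<le> quartic_risk p (sc \<omega>) (\<lambda>i. vec_index v i)"
        unfolding emp_risk_sc[OF bc] emp_risk_sc[OF vc] .
    qed
  qed
qed

lemma support_zero: "i < p \<Longrightarrow> i \<notin> support_vec p a \<Longrightarrow> a i = 0"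
  unfolding support_vec_def by auto

lemma support_sub: "support_vec p a \<subseteq> {..<p}"
  unfolding support_vec_def by auto

lemma q_zero: "i < p \<Longrightarrow> i \<notin> supp \<Longrightarrow> q i = 0"
  unfolding supp_def by (rule support_zero)

text \<open>On a rescaled sample with covariance \<open>k \<cdot> cov\<close>, \<open>k\<close> large, the penalty is negligible against
  the quadratic form. If \<open>s\<close> is smaller than the true sparsity, this forces an \<open>s\<close>-sparse vector
  close to the truth to exist.\<close>

lemma sparse_approximation:
  fixes \<theta> \<zeta> \<gamma> :: real
  assumes \<theta>: "\<theta> = 1 / 1000" and \<zeta>: "0 < \<zeta>" "\<zeta> \<le> 1" and \<gamma>: "\<gamma> = \<phi> * (\<zeta> * rho_sum)" "\<gamma> < \<sigma> - 3 * \<eta>"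
    and nz: "n * (\<theta> * \<zeta>)\<^sup>2 / 16 = 2 * (b + 4 * sparsity) * ln p"
  shows "\<exists>e. sqnorm p e \<le> \<eta>\<^sup>2 \<and> sqrt (sqnorm p e) \<le> 64 * \<theta> * \<gamma> * \<eta> / \<phi> \<and>
    real (card (support_vec p (\<lambda>i. \<phi> * q i + e i))) \<le> s"
proof (cases "real (card supp) \<le> s")
  case True
  have g: "0 < \<gamma>" using \<gamma> \<zeta> phi_pos rho_sum_ge by simp
  \<comment> \<open>The truth itself is sparse enough, so the error 0 will do.\<close>
  have "support_vec p (\<lambda>i. \<phi> * q i + 0) = supp"
    using phi_pos unfolding supp_def support_vec_def by auto
  then show ?thesis using True g eta phi_pos \<theta> by (intro exI[of _ "\<lambda>_. 0"]) (auto simp: sqnorm_def)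
next
  case False
  have g: "0 < \<gamma>" using \<gamma> \<zeta> phi_pos rho_sum_ge by simp
  have g\<phi>: "\<gamma> \<le> \<phi>" using \<gamma>(2) sigma eta by linarith
  \<comment> \<open>Twice what may be lost when only the quadratic forms are compared: the quartic
    term at (\<phi> + \<eta>) q and the largest possible penalty lam * p.\<close>
  define c where "c = (1/2) * (\<phi> + \<eta>)^4 + 2 * lam * p"
  \<comment> \<open>Large enough for c to be negligible on the scale required near the leading
    direction.\<close>
  define k where "k = max 1 (c / (1000 * \<theta>\<^sup>2 * \<gamma>\<^sup>2 * \<eta> * \<phi>))"
  have k1: "1 \<le> k" unfolding k_def by simp
  have tp: "0 < 1000 * \<theta>\<^sup>2 * \<gamma>\<^sup>2 * \<eta> * \<phi>" using \<theta> g eta phi_pos by simp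
  have ck: "c \<le> k * (1000 * \<theta>\<^sup>2 * \<gamma>\<^sup>2 * \<eta> * \<phi>)"
  proof -
    have "c / (1000 * \<theta>\<^sup>2 * \<gamma>\<^sup>2 * \<eta> * \<phi>) \<le> k" unfolding k_def by simp
    then show ?thesis using tp by (simp only: pos_divide_le_eq)
  qed
  \<comment> \<open>The scaling lemma multiplies the covariance by 1 / (1 - t), which is k.\<close>
  define t where "t = 1 - 1 / k"
  have t: "0 \<le> t" "t < 1" "1 / (1 - t) = k" using k1 by (auto simp: t_def)
  obtain Q where sQ: "sets Q = sets M" and ac: "absolutely_continuous M Q"
    and Q: "normal_family Q ({1..n} \<times> {..<p}) (\<lambda>i j. k * cov i j) coord"
    using normal_family_scale[OF normal_family_coord t(1,2), of n] unfolding t(3) by blast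
  interpret Q: prob_space Q using Q by (simp add: normal_family_def)
  have spQ: "space Q = space M" using sQ by (rule sets_eq_imp_space_eq)
  have k0: "0 < k" using k1 by simp
  have z: "0 < \<theta> * \<zeta>" "\<theta> * \<zeta> \<le> 1" unfolding \<theta> using \<zeta> by simp_all
  obtain E where E: "E \<in> sets Q" "1 - exp (- b * ln p) \<le> measure Q E"
    "\<And>\<omega>. \<omega> \<in> E \<Longrightarrow> small_noise k (4 * \<phi>\<^sup>2 * rho_sum * (\<theta> * \<zeta>)) \<omega>"
    using small_noise_probability[OF Q k0 z nz] by blast
  have w: "4 * \<phi>\<^sup>2 * rho_sum * (\<theta> * \<zeta>) = 4 * \<theta> * \<phi> * \<gamma>" unfolding \<gamma>(1) by (simp add: power2_eq_square)
  have "exp (- b * ln p) < 1" using b p by simp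
  then have pos: "0 < measure Q E" using E(2) by linarith
  have "AE \<omega> in Q. real (card (support_vec p (\<lambda>i. vec_index (bhat \<omega>) i))) \<le> s"
    using bhat_sparse_minimizer by (intro absolutely_continuous_AE[OF sQ ac]) auto
  \<comment> \<open>E has positive Q-probability and sparsity has passed from M to Q, so some
    outcome enjoys both.\<close>
  then have "\<exists>\<omega>\<in>E. real (card (support_vec p (\<lambda>i. vec_index (bhat \<omega>) i))) \<le> s"
  proof (rule contrapos_pp)
    assume "\<not> ?thesis"
    then have no: "\<And>\<omega>. \<omega> \<in> E \<Longrightarrow> \<not> real (card (support_vec p (\<lambda>i. vec_index (bhat \<omega>) i))) \<le> s" by blast
    show "\<not> (AE \<omega> in Q. real (card (support_vec p (\<lambda>i. vec_index (bhat \<omega>) i))) \<le> s)"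
    proof
      assume "AE \<omega> in Q. real (card (support_vec p (\<lambda>i. vec_index (bhat \<omega>) i))) \<le> s"
      then have "AE \<omega> in Q. \<omega> \<notin> E" using no by (auto elim: eventually_mono)
      then have "measure Q E = 0" using E(1) by (simp add: Q.prob_eq_0)
      then show False using pos by simp
    qed
  qed
  then obtain \<omega> where \<omega>: "\<omega> \<in> E" and sp: "real (card (support_vec p (\<lambda>i. vec_index (bhat \<omega>) i))) \<le> s" by blast
  have \<omega>M: "\<omega> \<in> space M" using \<omega> sets.sets_into_space[OF E(1)] spQ by blast
  define e where "e i = vec_index (bhat \<omega>) i - \<phi> * q i" for i
  have be: "(\<lambda>i. vec_index (bhat \<omega>) i) = (\<lambda>i. \<phi> * q i + e i)" by (simp add: e_def)
  have e\<eta>: "sqnorm p e \<le> \<eta>\<^sup>2" using bhat_in_ball[OF \<omega>M] unfolding in_ball_def e_def by blast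
  \<comment> \<open>Exactly at distance \<eta> from \<phi> q, hence an admissible point to compare
    the penalised minimiser with.\<close>
  let ?bs = "\<lambda>i. (\<phi> + \<eta>) * q i"
  define d where "d = (\<lambda>i. \<phi> * q i + e i - ?bs i)"
  have ge: "bilin {..<p} (sc \<omega>) ?bs ?bs - c \<le> bilin {..<p} (sc \<omega>) (\<lambda>i. \<phi> * q i + e i) (\<lambda>i. \<phi> * q i + e i)"
  proof -
    define v where "v = vec p ?bs"
    have "sqnorm p (\<lambda>i. vec_index v i - \<phi> * q i) = sqnorm p (\<lambda>i. \<eta> * q i)"
      unfolding sqnorm_def v_def by (intro sum.cong refl) (simp add: algebra_simps)
    then have "in_ball v" unfolding in_ball_def v_def by (simp add: sqnorm_q)
    from bhat_penalized[OF \<omega>M this]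
    have "quartic_risk p (sc \<omega>) (\<lambda>i. \<phi> * q i + e i) + lam * real (l0_norm_vec (bhat \<omega>))
        \<le> quartic_risk p (sc \<omega>) (\<lambda>i. vec_index v i) + lam * real (l0_norm_vec v)" unfolding be .
    moreover have "quartic_risk p (sc \<omega>) (\<lambda>i. vec_index v i) = quartic_risk p (sc \<omega>) ?bs"
      unfolding quartic_risk_def bilin_def sqnorm_def v_def by simp
    moreover have "lam * real (l0_norm_vec v) \<le> lam * p"
    proof -
      have "card {j. j < p \<and> vec_index v j \<noteq> 0} \<le> card {..<p}" by (intro card_mono) auto
      then have "l0_norm_vec v \<le> p" unfolding l0_norm_vec_def v_def by simp
      then show ?thesis using lam by (intro mult_left_mono) auto
    qed
    moreover have "0 \<le> lam * real (l0_norm_vec (bhat \<omega>))" using lam by simp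
    moreover have "quartic_risk p (sc \<omega>) ?bs = - (1/2) * bilin {..<p} (sc \<omega>) ?bs ?bs + (1/4) * (\<phi> + \<eta>)^4"
      unfolding quartic_risk_def sqnorm_q by (simp add: power2_eq_square power4_eq_xxxx)
    moreover have "- (1/2) * bilin {..<p} (sc \<omega>) (\<lambda>i. \<phi> * q i + e i) (\<lambda>i. \<phi> * q i + e i)
        \<le> quartic_risk p (sc \<omega>) (\<lambda>i. \<phi> * q i + e i)"
      unfolding quartic_risk_def by simp
    ultimately show ?thesis unfolding c_def by linarith
  qed
  have "sqrt (sqnorm p d) \<le> 64 * \<theta> * \<gamma> * \<eta> / \<phi>"
  proof (rule near_leading_direction[OF sc_sym \<theta> g \<gamma>(2) k0 e\<eta> d_def ge _ ck])
    fix a assume a: "a = d \<or> a = ?bs"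
    let ?T = "support_vec p (\<lambda>i. vec_index (bhat \<omega>) i)"
    have dz: "d i = 0" if "i < p" "i \<notin> supp \<union> ?T" for i
      using q_zero[of i] support_zero[of i "\<lambda>i. vec_index (bhat \<omega>) i"] that unfolding d_def e_def by simp
    have az: "a i = 0" if "i < p" "i \<notin> supp \<union> ?T" for i
      using a dz[OF that] q_zero[of i] that by auto
    show "\<bar>bilin {..<p} (\<lambda>i j. sc \<omega> i j - k * cov_mat M p X $$ (i, j)) d a\<bar>
        \<le> k * (4 * \<theta> * \<phi> * \<gamma>) * sqrt (sqnorm p d) * sqrt (sqnorm p a)"
      using E(3)[OF \<omega>] sp support_sub dz az unfolding small_noise_def w by blast
  qed
  then have dl: "sqrt (sqnorm p d) \<le> 64 * \<theta> * \<gamma> * \<eta> / \<phi>" .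
  \<comment> \<open>Maps (\<phi> + \<eta>) q to \<phi> q. As r is positive the support is unchanged,
    and as r \<le> 1 the distance does not grow.\<close>
  define r where "r = \<phi> / (\<phi> + \<eta>)"
  have r: "0 < r" "r \<le> 1" using phi_pos eta by (auto simp: r_def)
  define e' where "e' i = r * d i" for i
  have pe: "\<phi> * q i + e' i = r * vec_index (bhat \<omega>) i" for i
  proof -
    have "r * ((\<phi> + \<eta>) * q i) = \<phi> * q i" using phi_pos eta by (simp add: r_def)
    moreover have "e' i = r * vec_index (bhat \<omega>) i - r * ((\<phi> + \<eta>) * q i)"
      unfolding e'_def d_def e_def right_diff_distrib[symmetric] by simp
    ultimately show ?thesis by linarith
  qed
  have s1: "sqrt (sqnorm p e') = r * sqrt (sqnorm p d)"
    unfolding e'_def sqnorm_def using r by (simp add: power_mult_distrib sum_distrib_left[symmetric] real_sqrt_mult)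
  have s2: "sqrt (sqnorm p e') \<le> 64 * \<theta> * \<gamma> * \<eta> / \<phi>"
  proof -
    have "r * sqrt (sqnorm p d) \<le> 1 * sqrt (sqnorm p d)" using r by (intro mult_right_mono) (auto simp: sqnorm_nonneg)
    then show ?thesis using dl unfolding s1 by linarith
  qed
  \<comment> \<open>The shrunk vector has to lie in the ball around the truth again, to be an
    admissible competitor for the given law.\<close>
  have "64 * \<theta> * \<gamma> * \<eta> / \<phi> \<le> \<eta>"
  proof -
    have "\<gamma> * \<eta> \<le> \<phi> * \<eta>" using g\<phi> eta by (intro mult_right_mono) auto
    moreover have "64 * \<theta> * \<gamma> * \<eta> = 64 / 1000 * (\<gamma> * \<eta>)" using \<theta> by simp
    moreover have "0 < \<phi> * \<eta>" using phi_pos eta by simp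
    ultimately have "64 * \<theta> * \<gamma> * \<eta> \<le> \<phi> * \<eta>" by linarith
    then show ?thesis using phi_pos by (simp add: divide_le_eq mult.commute)
  qed
  with s2 have "sqrt (sqnorm p e') \<le> \<eta>" by linarith
  then have "sqnorm p e' \<le> \<eta>\<^sup>2" using sqrt_le_D by blast
  moreover have "support_vec p (\<lambda>i. \<phi> * q i + e' i) = support_vec p (\<lambda>i. vec_index (bhat \<omega>) i)"
    unfolding pe support_vec_def using r by auto
  ultimately show ?thesis using s2 sp by (intro exI[of _ e']) simp
qed

lemma l2_error_measurable: "{\<omega> \<in> space M. l2_norm_vec (bhat \<omega> - vec p (\<lambda>i. \<phi> * q i)) \<le> \<delta>} \<in> sets M"
proof -
  have m [measurable]: "(\<lambda>\<omega>. vec_index (bhat \<omega>) j) \<in> borel_measurable M" if "j < p" for j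
    using est that unfolding l0_estimator_def random_vec_def by blast
  have "l2_norm_vec (bhat \<omega> - vec p (\<lambda>i. \<phi> * q i)) = sqrt (\<Sum>i<p. (vec_index (bhat \<omega>) i - \<phi> * q i)\<^sup>2)"
    if "\<omega> \<in> space M" for \<omega>
    using bhat_carrier[OF that] by (subst l2_norm_vec_sqnorm[of _ p]) (auto simp: sqnorm_def)
  then have "{\<omega> \<in> space M. l2_norm_vec (bhat \<omega> - vec p (\<lambda>i. \<phi> * q i)) \<le> \<delta>}
      = {\<omega> \<in> space M. sqrt (\<Sum>i<p. (vec_index (bhat \<omega>) i - \<phi> * q i)\<^sup>2) \<le> \<delta>}" by auto
  also have "\<dots> \<in> sets M" by measurable
  finally show ?thesis .
qed

text \<open>The competitor has at most s nonzero entries, and among such vectors in the ball the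
  estimator minimises the unpenalised risk almost surely. On the event of small noise the error is
  therefore at most \<gamma> \<phi> / (\<sigma> - 3 \<eta>), which does not exceed \<delta>.\<close>

lemma error_probability:
  fixes \<zeta> \<gamma> \<delta> :: real
  assumes \<zeta>: "\<zeta> = sqrt ((b + 4 * sparsity) * ln (real p) / (1 / 32000000 * real n))" "\<zeta>\<^sup>2 < \<zeta>"
    and \<gamma>: "\<gamma> = \<phi> * (\<zeta> * rho_sum)" "0 < \<sigma> - 3 * \<eta> - \<gamma>"
    and \<delta>: "\<delta> = (\<gamma> * \<phi> + sqrt (\<gamma>\<^sup>2 * \<phi>\<^sup>2 + 4 * (\<sigma> - 3 * \<eta> - \<gamma>) * sparsity * lam)) / (2 * (\<sigma> - 3 * \<eta> - \<gamma>))"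
  shows "1 - exp (- b * ln (real p)) \<le> measure M {\<omega> \<in> space M. l2_norm_vec (bhat \<omega> - vec p (\<lambda>i. \<phi> * q i)) \<le> \<delta>}"
proof -
  define \<theta> :: real where "\<theta> = 1 / 1000"
  have sp0: "0 \<le> sparsity" unfolding sparsity_def by simp
  have z0: "0 < \<zeta>" "\<zeta> \<le> 1"
  proof -
    show "0 < \<zeta>" using \<zeta>(2) zero_le_power2[of \<zeta>] by linarith
    then show "\<zeta> \<le> 1" using \<zeta>(2) by (simp add: power2_eq_square)
  qed
  have z2: "\<zeta>\<^sup>2 = (b + 4 * sparsity) * ln (real p) / (1 / 32000000 * real n)"
    unfolding \<zeta>(1) using b sp0 p by (intro real_sqrt_pow2) (auto intro!: divide_nonneg_nonneg mult_nonneg_nonneg)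
  have nz: "n * (\<theta> * \<zeta>)\<^sup>2 / 16 = 2 * (b + 4 * sparsity) * ln p"
    unfolding power_mult_distrib z2 using n by (simp add: \<theta>_def power_divide)
  have g: "0 < \<gamma>" "\<gamma> < \<sigma> - 3 * \<eta>" using \<gamma> z0 phi_pos rho_sum_ge by simp_all
  obtain e' where e': "sqnorm p e' \<le> \<eta>\<^sup>2" "sqrt (sqnorm p e') \<le> 64 * \<theta> * \<gamma> * \<eta> / \<phi>"
    "real (card (support_vec p (\<lambda>i. \<phi> * q i + e' i))) \<le> s"
    using sparse_approximation[OF \<theta>_def z0 \<gamma>(1) g(2) nz] by blast
  have Q: "normal_family M ({1..n} \<times> {..<p}) (\<lambda>i j. (1::real) * cov i j) coord"
    unfolding mult_1 by (rule normal_family_coord)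
  have one: "0 < (1::real)" by simp
  have z: "0 < \<theta> * \<zeta>" "\<theta> * \<zeta> \<le> 1" using z0 by (simp_all add: \<theta>_def)
  obtain E where E: "E \<in> sets M" "1 - exp (- b * ln p) \<le> measure M E"
    "\<And>\<omega>. \<omega> \<in> E \<Longrightarrow> small_noise 1 (4 * \<phi>\<^sup>2 * rho_sum * (\<theta> * \<zeta>)) \<omega>"
    using small_noise_probability[OF Q one z nz] by blast
  have w: "4 * \<phi>\<^sup>2 * rho_sum * (\<theta> * \<zeta>) = 4 * \<theta> * \<phi> * \<gamma>" unfolding \<gamma>(1) by (simp add: power2_eq_square)
  \<comment> \<open>The square root in \<delta> is at least \<gamma> \<phi>, so \<delta> is at least
    \<gamma> \<phi> / (\<mu> - \<gamma>), and a larger denominator only lowers this.\<close>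
  have \<delta>le: "\<gamma> * \<phi> / (\<sigma> - 3 * \<eta>) \<le> \<delta>"
  proof -
    define \<mu> where "\<mu> = \<sigma> - 3 * \<eta>"
    have \<mu>: "0 < \<mu> - \<gamma>" "0 < \<mu>" using g by (auto simp: \<mu>_def)
    have "\<gamma> * \<phi> \<le> sqrt (\<gamma>\<^sup>2 * \<phi>\<^sup>2 + 4 * (\<mu> - \<gamma>) * sparsity * lam)"
      using \<mu> sp0 lam by (intro real_le_rsqrt) (simp add: power_mult_distrib)
    then have "\<gamma> * \<phi> + \<gamma> * \<phi> \<le> \<gamma> * \<phi> + sqrt (\<gamma>\<^sup>2 * \<phi>\<^sup>2 + 4 * (\<mu> - \<gamma>) * sparsity * lam)" by simp
    then have "(\<gamma> * \<phi> + \<gamma> * \<phi>) / (2 * (\<mu> - \<gamma>)) \<le> \<delta>"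
      unfolding \<delta> \<mu>_def[symmetric] using \<mu> by (intro divide_right_mono) auto
    moreover have "(\<gamma> * \<phi> + \<gamma> * \<phi>) / (2 * (\<mu> - \<gamma>)) = \<gamma> * \<phi> / (\<mu> - \<gamma>)"
      using \<mu> by (simp add: field_simps)
    moreover have "\<gamma> * \<phi> / \<mu> \<le> \<gamma> * \<phi> / (\<mu> - \<gamma>)"
      using \<mu> g phi_pos by (intro divide_left_mono) auto
    ultimately have "\<gamma> * \<phi> / \<mu> \<le> \<delta>" by (metis order_trans)
    then show ?thesis unfolding \<mu>_def .
  qed
  have "AE \<omega> in M. \<omega> \<in> E \<longrightarrow> \<omega> \<in> {\<omega> \<in> space M. l2_norm_vec (bhat \<omega> - vec p (\<lambda>i. \<phi> * q i)) \<le> \<delta>}"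
    using bhat_sparse_minimizer
  proof (rule AE_mp, intro AE_I2 impI)
    fix \<omega> assume \<omega>: "\<omega> \<in> space M" "\<omega> \<in> E"
      and min: "real (card (support_vec p (\<lambda>i. vec_index (bhat \<omega>) i))) \<le> s \<and>
        (\<forall>v. in_ball v \<longrightarrow> real (card (support_vec p (\<lambda>i. vec_index v i))) \<le> s \<longrightarrow>
          quartic_risk p (sc \<omega>) (\<lambda>i. vec_index (bhat \<omega>) i) \<le> quartic_risk p (sc \<omega>) (\<lambda>i. vec_index v i))"
    define e where "e i = vec_index (bhat \<omega>) i - \<phi> * q i" for i
    have be: "(\<lambda>i. vec_index (bhat \<omega>) i) = (\<lambda>i. \<phi> * q i + e i)" by (simp add: e_def)
    have e\<eta>: "sqnorm p e \<le> \<eta>\<^sup>2" using bhat_in_ball[OF \<omega>(1)] unfolding in_ball_def e_def by blast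
    define v where "v = vec p (\<lambda>i. \<phi> * q i + e' i)"
    have vb: "in_ball v" using e'(1) unfolding in_ball_def v_def by (auto simp: sqnorm_def)
    have sv: "support_vec p (\<lambda>i. vec_index v i) = support_vec p (\<lambda>i. \<phi> * q i + e' i)"
      unfolding v_def support_vec_def by auto
    have "quartic_risk p (sc \<omega>) (\<lambda>i. vec_index v i) = quartic_risk p (sc \<omega>) (\<lambda>i. \<phi> * q i + e' i)"
      unfolding quartic_risk_def bilin_def sqnorm_def v_def by simp
    then have le: "quartic_risk p (sc \<omega>) (\<lambda>i. \<phi> * q i + e i) \<le> quartic_risk p (sc \<omega>) (\<lambda>i. \<phi> * q i + e' i)"
      using min vb e'(3) unfolding be sv[symmetric] by metis
    have W1: "\<bar>bilin {..<p} (\<lambda>i j. sc \<omega> i j - cov_mat M p X $$ (i, j)) a c\<bar>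
        \<le> 4 * \<theta> * \<phi> * \<gamma> * sqrt (sqnorm p a) * sqrt (sqnorm p c)"
      if sp: "real (card (support_vec p (\<lambda>i. \<phi> * q i + a i))) \<le> s" and c: "c = a \<or> c = (\<lambda>i. \<phi> * q i)" for a c
    proof -
      let ?T = "support_vec p (\<lambda>i. \<phi> * q i + a i)"
      have az: "a i = 0" if "i < p" "i \<notin> supp \<union> ?T" for i
        using q_zero[of i] support_zero[of i "\<lambda>i. \<phi> * q i + a i"] that by simp
      have cz: "c i = 0" if "i < p" "i \<notin> supp \<union> ?T" for i
        using c az[OF that] q_zero[of i] that by auto
      have "\<bar>bilin {..<p} (\<lambda>i j. sc \<omega> i j - 1 * cov_mat M p X $$ (i, j)) a c\<bar>
        \<le> 1 * (4 * \<theta> * \<phi> * \<gamma>) * sqrt (sqnorm p a) * sqrt (sqnorm p c)"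
        using E(3)[OF \<omega>(2)] sp support_sub az cz unfolding small_noise_def w by blast
      then show ?thesis by simp
    qed
    have "sqrt (sqnorm p e) \<le> \<gamma> * \<phi> / (\<sigma> - 3 * \<eta>)"
    proof (rule estimator_error[OF sc_sym \<theta>_def g e\<eta> e'(1,2) le])
      fix a c assume a: "a = e \<or> a = e'" and c: "c = a \<or> c = (\<lambda>i. \<phi> * q i)"
      have "real (card (support_vec p (\<lambda>i. \<phi> * q i + a i))) \<le> s"
        using a e'(3) min unfolding be by auto
      from W1[OF this c] show "\<bar>bilin {..<p} (\<lambda>i j. sc \<omega> i j - cov_mat M p X $$ (i, j)) a c\<bar>
        \<le> 4 * \<theta> * \<phi> * \<gamma> * sqrt (sqnorm p a) * sqrt (sqnorm p c)" .
    qed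
    moreover have "l2_norm_vec (bhat \<omega> - vec p (\<lambda>i. \<phi> * q i)) = sqrt (sqnorm p e)"
      using bhat_carrier[OF \<omega>(1)] unfolding e_def by (subst l2_norm_vec_sqnorm[of _ p]) (auto simp: sqnorm_def)
    ultimately show "\<omega> \<in> {\<omega> \<in> space M. l2_norm_vec (bhat \<omega> - vec p (\<lambda>i. \<phi> * q i)) \<le> \<delta>}"
      using \<omega>(1) \<delta>le by simp
  qed
  then have "measure M E \<le> measure M {\<omega> \<in> space M. l2_norm_vec (bhat \<omega> - vec p (\<lambda>i. \<phi> * q i)) \<le> \<delta>}"
    by (rule finite_measure_mono_AE[OF _ l2_error_measurable])
  with E(2) show ?thesis by linarith
qed

end

text \<open>Only the gap needs an argument: the second eigenvalue is at most (\<phi>_1 -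
  \<sigma>)^2, and the trace bound for unit vectors orthogonal to q extends to all orthogonal
  vectors by homogeneity.\<close>

lemma leading_eigenvector_cov_mat:
  fixes \<phi> :: "nat \<Rightarrow> real" and q0 :: "real vec"
  assumes gs: "gaussian_series M p X" and p: "2 \<le> p" and eta: "0 < \<eta>" "3 * \<eta> < \<sigma>"
    and ev: "ordered_eigenvalue_roots (cov_mat M p X) p \<phi>" and gap: "\<forall>j\<in>{2..p}. \<phi> j + \<sigma> \<le> \<phi> 1"
    and eig: "eigenvector (cov_mat M p X) q0 ((\<phi> 1)\<^sup>2)" and q0: "l2_norm_vec q0 = 1"
  shows "leading_eigenvector p (\<lambda>i j. cov_mat M p X $$ (i, j)) (\<lambda>i. vec_index q0 i) (\<phi> 1) \<sigma> \<eta>"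
proof -
  interpret gaussian_series M p X by (rule gs)
  let ?A = "cov_mat M p X"
  let ?q = "\<lambda>i. vec_index q0 i"
  have A: "?A \<in> carrier_mat p p" unfolding cov_mat_def by simp
  have sym: "?A $$ (i, j) = ?A $$ (j, i)" if "i < p" "j < p" for i j
    using that by (simp add: cov_mat_def mult.commute)
  have qc: "q0 \<in> carrier_vec p" and Aq: "?A *\<^sub>v q0 = (\<phi> 1)\<^sup>2 \<cdot>\<^sub>v q0"
    using eig A unfolding eigenvector_def by auto
  have qe: "(\<Sum>j<p. ?A $$ (i, j) * ?q j) = (\<phi> 1)\<^sup>2 * ?q i" if i: "i < p" for i
  proof -
    have "vec_index (?A *\<^sub>v q0) i = (\<Sum>j<p. ?A $$ (i, j) * ?q j)"
      using i A qc by (simp add: scalar_prod_def atLeast0LessThan)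
    then show ?thesis unfolding Aq using i qc by simp
  qed
  have q1: "sqnorm p ?q = 1" using q0 unfolding l2_norm_vec_sqnorm[OF qc] by simp
  have nn: "0 \<le> \<phi> j" if "j \<in> {1..p}" for j using ev that unfolding ordered_eigenvalue_roots_def by blast
  have le2: "\<phi> j \<le> \<phi> 1 - \<sigma>" if "j \<in> {2..p}" for j using gap that by force
  \<comment> \<open>Because p is at least 2 there is a second root, and it is nonnegative.\<close>
  have s\<phi>: "\<sigma> \<le> \<phi> 1" using le2[of 2] nn[of 2] p by auto
  show ?thesis
  proof
    show "?A $$ (i, j) = ?A $$ (j, i)" if "i < p" "j < p" for i j using sym that .
    show "0 \<le> bilin {..<p} (\<lambda>i j. ?A $$ (i, j)) a a" for a
      using var_dir_nonneg[of a] unfolding var_dir_def .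
    show "(\<Sum>j<p. ?A $$ (i, j) * ?q j) = (\<phi> 1)\<^sup>2 * ?q i" if "i < p" for i using qe that .
    show "sqnorm p ?q = 1" by (rule q1)
    show "0 < \<eta>" "3 * \<eta> < \<sigma>" "\<sigma> \<le> \<phi> 1" using eta s\<phi> by auto
    fix w assume w: "(\<Sum>i<p. ?q i * w i) = 0"
    show "bilin {..<p} (\<lambda>i j. ?A $$ (i, j)) w w \<le> ((\<phi> 1)\<^sup>2 - \<sigma> * \<phi> 1) * sqnorm p w"
    proof (cases "sqnorm p w = 0")
      case True
      then have "\<forall>i<p. w i = 0" unfolding sqnorm_def by (simp add: sum_nonneg_eq_0_iff)
      then have "bilin {..<p} (\<lambda>i j. ?A $$ (i, j)) w w = 0" unfolding bilin_def by simp
      then show ?thesis using True by simp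
    next
      case False
      then have wp: "0 < sqnorm p w" using sqnorm_nonneg[of p w] by linarith
      define c where "c = 1 / sqrt (sqnorm p w)"
      have c2: "c\<^sup>2 = 1 / sqnorm p w" using wp by (simp add: c_def power_divide)
      have "(\<Sum>i<p. \<Sum>j<p. (c * w i) * (c * w j) * ?A $$ (i, j)) \<le> (\<phi> 1 - \<sigma>)\<^sup>2"
      proof (rule quadratic_form_le_second_eigenvalue[OF A sym, where q = ?q and e = "\<lambda>j. (\<phi> j)\<^sup>2"])
        show "char_poly ?A = (\<Prod>j=1..p. [:- (\<phi> j)\<^sup>2, 1:])" using ev unfolding ordered_eigenvalue_roots_def by blast
        show "1 \<le> p" using p by simp
        show "0 \<le> (\<phi> j)\<^sup>2 \<and> (\<phi> j)\<^sup>2 \<le> (\<phi> 1 - \<sigma>)\<^sup>2" if "j \<in> {2..p}" for j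
          using le2[OF that] nn[of j] that by (auto intro!: power_mono)
        show "(\<Sum>i<p. (?q i)\<^sup>2) = 1" using q1 unfolding sqnorm_def .
        show "(\<Sum>i<p. (c * w i)\<^sup>2) = 1"
          using c2 wp unfolding power_mult_distrib sum_distrib_left[symmetric] sqnorm_def by simp
        show "(\<Sum>i<p. ?q i * (c * w i)) = 0"
        proof -
          have "(\<Sum>i<p. ?q i * (c * w i)) = c * (\<Sum>i<p. ?q i * w i)"
            unfolding sum_distrib_left by (intro sum.cong refl) (simp add: mult_ac)
          then show ?thesis using w by simp
        qed
      qed (use qe in auto)
      also have "(\<Sum>i<p. \<Sum>j<p. (c * w i) * (c * w j) * ?A $$ (i, j)) = c\<^sup>2 * bilin {..<p} (\<lambda>i j. ?A $$ (i, j)) w w"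
        unfolding bilin_def sum_distrib_left by (intro sum.cong refl) (simp add: power2_eq_square mult_ac)
      finally have "bilin {..<p} (\<lambda>i j. ?A $$ (i, j)) w w \<le> (\<phi> 1 - \<sigma>)\<^sup>2 * sqnorm p w"
        unfolding c2 using wp by (simp add: divide_le_eq)
      also have "\<dots> \<le> ((\<phi> 1)\<^sup>2 - \<sigma> * \<phi> 1) * sqnorm p w"
      proof (rule mult_right_mono)
        have "\<sigma> * \<sigma> \<le> \<sigma> * \<phi> 1" using s\<phi> eta by (intro mult_left_mono) auto
        then show "(\<phi> 1 - \<sigma>)\<^sup>2 \<le> (\<phi> 1)\<^sup>2 - \<sigma> * \<phi> 1" by (simp add: power2_eq_square algebra_simps)
      qed (rule sqnorm_nonneg)
      finally show ?thesis .
    qed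
  qed
qed

theorem theorem5p1:
  fixes \<sigma> \<eta> :: real
  assumes "0 < \<eta>" and "3 * \<eta> < \<sigma>"
  shows "\<exists>c>0. \<forall>(M :: 'a measure) (p :: nat \<Rightarrow> nat) (X :: nat \<Rightarrow> 'a process)
      (\<phi> :: nat \<Rightarrow> nat \<Rightarrow> real) (q0 :: nat \<Rightarrow> real vec) (\<beta>0 :: nat \<Rightarrow> real vec)
      (lam0 :: nat \<Rightarrow> real) (\<beta>hat :: nat \<Rightarrow> 'a \<Rightarrow> real vec) (s :: nat \<Rightarrow> real).
    prob_space M \<longrightarrow>
    (\<lambda>n. ln (real (p n)) / real n) \<longlonglongrightarrow> 0 \<longrightarrow>
    (\<forall>n\<ge>1.
       (\<forall>t. random_vec M (p n) (X n t)) \<and>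
       strictly_stationary M (p n) (X n) \<and>
       zero_mean M (p n) (X n) \<and>
       gaussian_process M (p n) (X n) \<and>
       alpha_mixing M (p n) (X n) \<and>
       ordered_eigenvalue_roots (cov_mat M (p n) (X n)) (p n) (\<phi> n) \<and>
       (\<forall>j\<in>{2..p n}. \<phi> n 1 \<ge> \<phi> n j + \<sigma>) \<and>
       eigenvector (cov_mat M (p n) (X n)) (q0 n) ((\<phi> n 1)\<^sup>2) \<and>
       l2_norm_vec (q0 n) = 1 \<and>
       \<beta>0 n = \<phi> n 1 \<cdot>\<^sub>v q0 n \<and>
       0 \<le> lam0 n \<and>
       l0_estimator M (p n) (X n) n (\<beta>0 n) \<eta> (lam0 n) (\<beta>hat n) \<and>
       sparsity_constant M (p n) (X n) n (\<beta>0 n) \<eta> (\<beta>hat n) (s n)) \<longrightarrow>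
    (\<forall>b>0. \<forall>n\<ge>1.
       let \<phi>max = \<phi> n 1;
           s' = max (real (l0_norm_vec (\<beta>0 n))) (s n);
           \<zeta> = sqrt ((b + 4 * s') * ln (real (p n)) / (c * real n));
           \<gamma> = \<phi>max * (\<zeta> * (\<Sum>l=0..n. rho_coeff M (p n) (X n) l));
           \<delta> = (\<gamma> * \<phi>max + sqrt (\<gamma>\<^sup>2 * \<phi>max\<^sup>2 + 4 * (\<sigma> - 3 * \<eta> - \<gamma>) * s' * lam0 n))
                 / (2 * (\<sigma> - 3 * \<eta> - \<gamma>))
       in p n > 6 \<longrightarrow> \<zeta>\<^sup>2 < \<zeta> \<longrightarrow> \<sigma> - 3 * \<eta> - \<gamma> > 0 \<longrightarrow>
          measure M {\<omega> \<in> space M. l2_norm_vec (\<beta>hat n \<omega> - \<beta>0 n) \<le> \<delta>}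
            \<ge> 1 - exp (- b * ln (real (p n))))"
\<comment> \<open>The denominator is 2 * 16 * 1000^2: 16 from the concentration bound, 1000 from
  shrinking \<zeta>, and 2 because the union bound uses up to p^(8 s') events while the tail offers
  only b + 4 s'.\<close>
proof (rule exI[of _ "1 / 32000000"], intro conjI allI impI, simp, unfold Let_def, intro impI)
  fix M :: "'a measure" and p :: "nat \<Rightarrow> nat" and X :: "nat \<Rightarrow> 'a process"
    and \<phi> :: "nat \<Rightarrow> nat \<Rightarrow> real" and q0 \<beta>0 :: "nat \<Rightarrow> real vec"
    and lam0 :: "nat \<Rightarrow> real" and \<beta>hat :: "nat \<Rightarrow> 'a \<Rightarrow> real vec" and s :: "nat \<Rightarrow> real"
    and b :: real and n :: nat
  let ?s = "max (real (l0_norm_vec (\<beta>0 n))) (s n)"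
  let ?\<zeta> = "sqrt ((b + 4 * ?s) * ln (real (p n)) / (1 / 32000000 * real n))"
  let ?\<gamma> = "\<phi> n 1 * (?\<zeta> * (\<Sum>l=0..n. rho_coeff M (p n) (X n) l))"
  let ?\<delta> = "(?\<gamma> * \<phi> n 1 + sqrt (?\<gamma>\<^sup>2 * (\<phi> n 1)\<^sup>2 + 4 * (\<sigma> - 3 * \<eta> - ?\<gamma>) * ?s * lam0 n)) / (2 * (\<sigma> - 3 * \<eta> - ?\<gamma>))"
  assume M: "prob_space M" and b: "0 < b" and n: "1 \<le> n" and p: "6 < p n"
    and \<zeta>: "?\<zeta>\<^sup>2 < ?\<zeta>" and \<gamma>: "0 < \<sigma> - 3 * \<eta> - ?\<gamma>"
  assume "\<forall>n\<ge>1.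
       (\<forall>t. random_vec M (p n) (X n t)) \<and>
       strictly_stationary M (p n) (X n) \<and>
       zero_mean M (p n) (X n) \<and>
       gaussian_process M (p n) (X n) \<and>
       alpha_mixing M (p n) (X n) \<and>
       ordered_eigenvalue_roots (cov_mat M (p n) (X n)) (p n) (\<phi> n) \<and>
       (\<forall>j\<in>{2..p n}. \<phi> n 1 \<ge> \<phi> n j + \<sigma>) \<and>
       eigenvector (cov_mat M (p n) (X n)) (q0 n) ((\<phi> n 1)\<^sup>2) \<and>
       l2_norm_vec (q0 n) = 1 \<and>
       \<beta>0 n = \<phi> n 1 \<cdot>\<^sub>v q0 n \<and>
       0 \<le> lam0 n \<and>
       l0_estimator M (p n) (X n) n (\<beta>0 n) \<eta> (lam0 n) (\<beta>hat n) \<and>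
       sparsity_constant M (p n) (X n) n (\<beta>0 n) \<eta> (\<beta>hat n) (s n)"
  then have h: "\<forall>t. random_vec M (p n) (X n t)" "strictly_stationary M (p n) (X n)"
      "zero_mean M (p n) (X n)" "gaussian_process M (p n) (X n)"
      "ordered_eigenvalue_roots (cov_mat M (p n) (X n)) (p n) (\<phi> n)"
      "\<forall>j\<in>{2..p n}. \<phi> n j + \<sigma> \<le> \<phi> n 1"
      "eigenvector (cov_mat M (p n) (X n)) (q0 n) ((\<phi> n 1)\<^sup>2)"
      "l2_norm_vec (q0 n) = 1" "\<beta>0 n = \<phi> n 1 \<cdot>\<^sub>v q0 n" "0 \<le> lam0 n"
      "l0_estimator M (p n) (X n) n (\<beta>0 n) \<eta> (lam0 n) (\<beta>hat n)"
      "sparsity_constant M (p n) (X n) n (\<beta>0 n) \<eta> (\<beta>hat n) (s n)"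
    using n by auto
  have gs: "gaussian_series M (p n) (X n)"
    using M h(1-4) unfolding gaussian_series_def by blast
  let ?q = "\<lambda>i. vec_index (q0 n) i"
  have le: "leading_eigenvector (p n) (\<lambda>i j. cov_mat M (p n) (X n) $$ (i, j)) ?q (\<phi> n 1) \<sigma> \<eta>"
    using p by (intro leading_eigenvector_cov_mat[OF gs _ assms h(5-8)]) simp
  have qc: "q0 n \<in> carrier_vec (p n)"
    using h(7) unfolding eigenvector_def cov_mat_def by auto
  have \<beta>0: "\<beta>0 n = vec (p n) (\<lambda>i. \<phi> n 1 * ?q i)"
    unfolding h(9) using qc by (intro eq_vecI) auto
  have s0: "0 \<le> s n" using h(12) unfolding sparsity_constant_def by blast
  interpret sparse_pca M "p n" "X n" ?q "\<phi> n 1" \<sigma> \<eta> n "lam0 n" "s n" b "\<beta>hat n"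
    using gs le n p b h(10-12) s0 unfolding sparse_pca_def sparse_pca_axioms_def \<beta>0 by blast
  \<comment> \<open>Since \<phi> is positive, scaling q by it does not alter the support.\<close>
  have "l0_norm_vec (\<beta>0 n) = card supp"
    unfolding supp_def l0_norm_vec_def \<beta>0 support_vec_def using phi_pos
    by (intro arg_cong[where f=card]) auto
  then have sp: "?s = sparsity" unfolding sparsity_def by simp
  show "1 - exp (- b * ln (real (p n))) \<le> measure M {\<omega> \<in> space M. l2_norm_vec (\<beta>hat n \<omega> - \<beta>0 n) \<le> ?\<delta>}"
    using \<zeta> \<gamma> unfolding sp unfolding rho_sum_def[symmetric] \<beta>0
    by (rule error_probability[OF refl _ refl _ refl])
qed

end
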